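(* Let $\mathbb{Z}^d$ act on a probability space $(X,\mu)$ by measure-preserving transformations $(T_k)_{k\in\mathbb{Z}^d}$, ergodically. Let $\rho:X\times\mathbb{Z}^d\times\mathbb{Z}^d\to[0,\infty)$ be a random semimetric on $\mathbb{Z}^d$ modeled on this $\mathbb{Z}^d$-space (with $\mathbb{Z}^d$ acting on itself by translation), i.e. $\rho_x$ is a semimetric on $\mathbb{Z}^d$ for each $x$, $x\mapsto\rho_x(m,n)$ is measurable, and $\rho_{T_kx}(m,n)=\rho_x(m+k,n+k)$ for all $k,m,n$. Suppose that $x\mapsto\rho_x(0,n)$ belongs to the Lorentz space $L^{d,1}(X,\mu)$ for every $n\in\mathbb{Z}^d$. Then there exists a seminorm $L$ on $\mathbb{R}^d$ such that \[ \lim_{|n|\to\infty}\frac{\rho_x(0,n)-L(n)}{|n|}=0 \] for $\mu$-almost every $x\in X$.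
   Context: $|\cdot|$ denotes a norm on $\mathbb{R}^d$ (e.g. the $\ell^1$-norm). For a measurable $f$ on $X$, $d_f(\alpha)=\mu(\{x:|f(x)|>\alpha\})$, $f^*(t)=\inf\{s>0: d_f(s)\le t\}$, and $\|f\|_{p,q}=\left(\int_0^\infty (t^{1/p}f^*(t))^q\,\frac{dt}{t}\right)^{1/q}$ for $q<\infty$; $L^{p,q}(X)$ is the space of $f$ with $\|f\|_{p,q}<\infty$. A semimetric is a symmetric function $\ge0$ vanishing on the diagonal and satisfying the triangle inequality. *)

theory Defs
  imports "HOL-Analysis.Analysis" "HOL-Probability.Probability"
begin

definition distr_fun :: "'a measure \<Rightarrow> ('a \<Rightarrow> real) \<Rightarrow> real \<Rightarrow> ennreal" where
  "distr_fun M f \<alpha> = emeasure M {x \<in> space M. \<bar>f x\<bar> > \<alpha>}"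

text \<open>Decreasing rearrangement  f*(t) = inf{s > 0 : d_f(s) <= t}  (inf of the empty set is infinity).\<close>
definition decr_rearr :: "'a measure \<Rightarrow> ('a \<Rightarrow> real) \<Rightarrow> real \<Rightarrow> ennreal" where
  "decr_rearr M f t = Inf {ennreal s | s. s > 0 \<and> distr_fun M f s \<le> ennreal t}"

text \<open>The q-th power of the Lorentz quasinorm:
  integral over (0,inf) of (t^(1/p) f*(t))^q dt/t.\<close>
definition lorentz_integral :: "real \<Rightarrow> real \<Rightarrow> 'a measure \<Rightarrow> ('a \<Rightarrow> real) \<Rightarrow> ennreal" where
  "lorentz_integral p q M f =
     (\<integral>\<^sup>+ t \<in> {0<..}.
        (if decr_rearr M f t = \<top> then \<top>
         else ennreal ((t powr (1/p) * enn2real (decr_rearr M f t)) powr q / t)) \<partial>lborel)"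

definition lorentz_space :: "real \<Rightarrow> real \<Rightarrow> 'a measure \<Rightarrow> ('a \<Rightarrow> real) set" where
  "lorentz_space p q M = {f. f \<in> borel_measurable M \<and> lorentz_integral p q M f < \<top>}"

definition seminorm_on :: "('b::real_vector \<Rightarrow> real) \<Rightarrow> bool" where
  "seminorm_on L \<longleftrightarrow> (\<forall>x y. L (x + y) \<le> L x + L y) \<and> (\<forall>c x. L (c *\<^sub>R x) = \<bar>c\<bar> * L x)"

definition vec_of_int :: "int ^ 'd \<Rightarrow> real ^ 'd" where
  "vec_of_int n = (\<chi> i. real_of_int (n $ i))"

definition ergodic_Zd_action :: "'a measure \<Rightarrow> (int ^ 'd \<Rightarrow> 'a \<Rightarrow> 'a) \<Rightarrow> bool" where
  "ergodic_Zd_action M T \<longleftrightarrow>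
     prob_space M \<and>
     (\<forall>k. T k \<in> M \<rightarrow>\<^sub>M M \<and> distr M M (T k) = M) \<and>
     (\<forall>x\<in>space M. T 0 x = x) \<and>
     (\<forall>k l. \<forall>x\<in>space M. T (k + l) x = T k (T l x)) \<and>
     (\<forall>A\<in>sets M. (\<forall>k. T k -` A \<inter> space M = A) \<longrightarrow> measure M A = 0 \<or> measure M A = 1)"

definition random_semimetric :: "'a measure \<Rightarrow> (int ^ 'd \<Rightarrow> 'a \<Rightarrow> 'a) \<Rightarrow> ('a \<Rightarrow> int ^ 'd \<Rightarrow> int ^ 'd \<Rightarrow> real) \<Rightarrow> bool" where
  "random_semimetric M T \<rho> \<longleftrightarrow>
     (\<forall>x\<in>space M. (\<forall>m n. \<rho> x m n \<ge> 0) \<and> (\<forall>m. \<rho> x m m = 0) \<and> (\<forall>m n. \<rho> x m n = \<rho> x n m)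
        \<and> (\<forall>m n l. \<rho> x m l \<le> \<rho> x m n + \<rho> x n l)) \<and>
     (\<forall>m n. (\<lambda>x. \<rho> x m n) \<in> borel_measurable M) \<and>
     (\<forall>x\<in>space M. \<forall>k m n. \<rho> (T k x) m n = \<rho> x (m + k) (n + k))"

end

theory Submission
  imports Defs
begin

text \<open>
  Along a fixed direction the limit is an ergodic-theoretic fact: a greedy covering of the orbit, in the
  manner of Katznelson--Weiss and Steele, compares \<open>\<rho>\<close> with its mean and yields both halves of
  Kingman's theorem for the constant limit, constancy coming from ergodicity of the full action.

  Beyond integrability, the Lorentz condition enters only through equicontinuity at infinity. Joining two points by a
  random chain through cubes of dyadic sizes around each of them bounds their distance by a discrete
  Riesz potential of order one of the edge weights. The kernel \<open>\<bar>m\<bar>\<close> to the power \<open>1 - d\<close> sums to at most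
  a constant times \<open>s\<close> to the power \<open>1 / d\<close> over any set of \<open>s\<close> sites, so a level set of the weights
  contributes the \<open>d\<close>-th root of its number of sites in a large cube. By the maximal inequality
  and its Kolmogorov consequence for the exponent \<open>1 / d < 1\<close>, these roots are controlled in mean
  by the \<open>d\<close>-th root of the probability of the level, and the sum over levels is comparable to the
  Lorentz \<open>(d, 1)\<close> quasinorm. Truncation at a high level makes the unbounded part
  negligible. For \<open>d = 1\<close> the exponent is \<open>1\<close> and the weak-type inequality itself is applied to the
  unbounded part.
\<close>

section \<open>Cubes and lattice semimetrics\<close>

text \<open>Ergodicity is assumed for the whole group only, so a single \<open>T n\<close> need not
  be ergodic, and a limit along the ray of \<open>n\<close> is a priori only a
  \<open>T n\<close>-invariant function. Equicontinuity at infinity removes this obstacle: changing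
  the base point by a fixed vector alters \<rho> along the ray by o(k), so "limsup at most c" and
  "liminf at least c" are invariant under all translations and have measure 0 or 1. The same
  property carries the limits from the countably many rays to the whole lattice: with mesh k, about
  1/D of the radius R, every point of the cube of radius R lies within k of some multiple
  \<open>int k *s m\<close>, where m runs through a finite set independent of R. The exponent d is
  the natural one because the d-th root of a number of sites is a length: divided by the radius it
  is scale invariant, and one random variable can bound it at all scales at once. Tolerances in the
  events are powers of 1/2, so that every quantifier there is countable.\<close>

definition cube :: "nat \<Rightarrow> (int ^ 'd) set" where
  "cube r = {m. \<forall>i. \<bar>m $ i\<bar> \<le> int r}"

text \<open>Half-open, so that the cube of side \<open>2 ^ Suc k\<close> is the disjoint union of
  \<open>2 ^ CARD('d)\<close> translates of the cube of side \<open>2 ^ k\<close>.\<close>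

definition corner_cube :: "nat \<Rightarrow> (int ^ 'd) set" where
  "corner_cube k = {m. \<forall>i. 0 \<le> m $ i \<and> m $ i < 2 ^ k}"

lemma vec_set_eq_image: "{m :: 'b ^ 'd. \<forall>i. m $ i \<in> S} = vec_lambda ` (PiE UNIV (\<lambda>_. S))"
proof -
  have "m \<in> vec_lambda ` (PiE UNIV (\<lambda>_. S))" if "\<forall>i. m $ i \<in> S" for m :: "'b ^ 'd"
    using that by (intro image_eqI[of _ _ "vec_nth m"]) (auto simp: PiE_def Pi_def)
  then show ?thesis by auto
qed

lemma finite_vec_set: "finite S \<Longrightarrow> finite {m :: 'b ^ 'd. \<forall>i. m $ i \<in> S}"
  unfolding vec_set_eq_image by (intro finite_imageI finite_PiE) auto

lemma card_vec_set: "finite S \<Longrightarrow> card {m :: 'b ^ 'd. \<forall>i. m $ i \<in> S} = card S ^ CARD('d)"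
  unfolding vec_set_eq_image
  by (subst card_image) (auto simp: inj_on_def card_PiE vec_lambda_inject)

lemma cube_alt: "cube r = {m :: int ^ 'd. \<forall>i. m $ i \<in> {- int r..int r}}"
  unfolding cube_def by (auto simp: abs_le_iff minus_le_iff)

lemma finite_cube [simp]: "finite (cube r)"
  unfolding cube_alt by (rule finite_vec_set) simp

lemma card_cube: "card (cube r :: (int ^ 'd) set) = (2 * r + 1) ^ CARD('d)"
  unfolding cube_alt by (subst card_vec_set) (auto simp: nat_add_distrib nat_mult_distrib)

lemma corner_cube_alt: "corner_cube k = {m :: int ^ 'd. \<forall>i. m $ i \<in> {0..<2 ^ k}}"
  unfolding corner_cube_def by auto

lemma finite_corner_cube [simp]: "finite (corner_cube k)"
  unfolding corner_cube_alt by (rule finite_vec_set) simp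

lemma card_corner_cube: "card (corner_cube k :: (int ^ 'd) set) = 2 ^ (k * CARD('d))"
  unfolding corner_cube_alt by (subst card_vec_set) (auto simp: power_mult nat_power_eq)

lemma zero_in_cube [simp]: "0 \<in> cube r"
  by (simp add: cube_def)

lemma cube_add: "p \<in> cube r \<Longrightarrow> q \<in> cube s \<Longrightarrow> p + q \<in> cube (r + s)"
  unfolding cube_def by (auto intro: order_trans[OF abs_triangle_ineq add_mono])

lemma cube_mono: "r \<le> s \<Longrightarrow> cube r \<subseteq> cube s"
  unfolding cube_def by (auto intro: order_trans)

lemma cube_uminus: "p \<in> cube r \<Longrightarrow> - p \<in> cube r"
  unfolding cube_def by auto

lemma corner_cube_subset: "corner_cube k \<subseteq> cube (2 ^ k)"
  unfolding corner_cube_def cube_def by (auto simp: abs_le_iff intro: less_imp_le order_trans[of _ 0])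

text \<open>Division with remainder by \<open>2 ^ k\<close> in each coordinate: \<open>e\<close>
  holds the leading binary digits and \<open>u\<close> the lower ones.\<close>

lemma sum_corner_cube_Suc:
  fixes F :: "int ^ 'd \<Rightarrow> real"
  shows "sum F (corner_cube (Suc k)) =
    (\<Sum>e\<in>corner_cube 1. \<Sum>u\<in>corner_cube k. F (u + 2 ^ k *s e))"
proof -
  have "(\<Sum>e\<in>corner_cube 1. \<Sum>u\<in>corner_cube k. F (u + 2 ^ k *s e)) =
    (\<Sum>(e, u)\<in>corner_cube 1 \<times> corner_cube k. F (u + 2 ^ k *s e))"
    by (simp add: sum.cartesian_product)
  also have "\<dots> = sum F (corner_cube (Suc k))"
  proof (rule sum.reindex_bij_witness[where
        i = "\<lambda>v. ((\<chi> i. v $ i div 2 ^ k), (\<chi> i. v $ i mod 2 ^ k))" and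
        j = "\<lambda>(e, u). u + 2 ^ k *s e"], goal_cases)
    case (1 a)
    then show ?case by (auto simp: corner_cube_def vec_eq_iff)
  next
    case (2 a)
    then obtain e u where a: "a = (e, u)" and e: "\<And>i. 0 \<le> e $ i \<and> e $ i < 2"
      and u: "\<And>i. 0 \<le> u $ i \<and> u $ i < 2 ^ k"
      by (auto simp: corner_cube_def)
    have "u $ i + 2 ^ k * e $ i < 2 * 2 ^ k" for i
    proof -
      have "e $ i = 0 \<or> e $ i = 1" using e[of i] by auto
      then show ?thesis using u[of i] by (auto)
    qed
    with e u show ?case by (auto simp: a corner_cube_def)
  next
    case (3 b)
    then show ?case by (auto simp: vec_eq_iff)
  next
    case (4 b)
    have "b $ i div 2 ^ k < 2" for i
    proof (rule ccontr)
      assume "\<not> b $ i div 2 ^ k < 2"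
      then have "2 * 2 ^ k \<le> b $ i div 2 ^ k * 2 ^ k" by (intro mult_right_mono) auto
      also have "\<dots> \<le> b $ i" by (metis div_mult_mod_eq le_add_same_cancel1 pos_mod_sign zero_less_numeral zero_less_power)
      finally show False using 4 by (auto simp: corner_cube_def not_less[symmetric])
    qed
    with 4 show ?case
      by (auto simp: corner_cube_def pos_imp_zdiv_nonneg_iff)
  next
    case (5 a)
    then show ?case by auto
  qed
  finally show ?thesis ..
qed

text \<open>Walk from 0 to \<open>w\<close> by unit steps. Undoing a step at a nonzero coordinate
  never leaves the box of points dominated coordinatewise by \<open>w\<close>, so increments have to
  be controlled only there; this is what confines the walk to a cube in
  \<open>sum_translate_le\<close>.\<close>

lemma l1_path_bound:
  fixes F :: "int ^ 'd \<Rightarrow> real"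
  assumes F0: "F 0 \<le> 0"
    and step: "\<And>z i. \<lbrakk>\<And>l. \<bar>z $ l\<bar> \<le> \<bar>w $ l\<bar>; \<And>l. \<bar>(z + axis i 1) $ l\<bar> \<le> \<bar>w $ l\<bar>\<rbrakk>
      \<Longrightarrow> \<bar>F (z + axis i 1) - F z\<bar> \<le> K"
  shows "F w \<le> (\<Sum>i\<in>UNIV. \<bar>real_of_int (w $ i)\<bar>) * K"
proof -
  have "F v \<le> real_of_int s * K"
    if "(\<Sum>i\<in>UNIV. \<bar>v $ i\<bar>) = s" "\<And>l. \<bar>v $ l\<bar> \<le> \<bar>w $ l\<bar>" for v s
    using that
  proof (induction "nat s" arbitrary: v s)
    case 0
    have "s \<ge> 0" unfolding 0(2)[symmetric] by (intro sum_nonneg) auto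
    then have "s = 0" using 0 by auto
    then have "v = 0" using 0(2) by (simp add: sum_nonneg_eq_0_iff vec_eq_iff)
    then show ?case using F0 \<open>s = 0\<close> by simp
  next
    case (Suc n)
    then have "(\<Sum>i\<in>UNIV. \<bar>v $ i\<bar>) \<noteq> 0" by auto
    then obtain i where i: "v $ i \<noteq> 0" by (metis sum.neutral abs_zero)
    have red: "(\<Sum>l\<in>UNIV. \<bar>u $ l\<bar>) = s - 1"
      if "\<bar>u $ i\<bar> = \<bar>v $ i\<bar> - 1" "\<And>l. l \<noteq> i \<Longrightarrow> u $ l = v $ l" for u :: "int ^ 'd"
    proof -
      have "(\<Sum>l\<in>UNIV. \<bar>u $ l\<bar>) = \<bar>u $ i\<bar> + (\<Sum>l\<in>UNIV - {i}. \<bar>u $ l\<bar>)"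
        by (simp add: sum.remove)
      also have "(\<Sum>l\<in>UNIV - {i}. \<bar>u $ l\<bar>) = (\<Sum>l\<in>UNIV - {i}. \<bar>v $ l\<bar>)"
        using that by (intro sum.cong) auto
      also have "\<bar>u $ i\<bar> + \<dots> = (\<Sum>l\<in>UNIV. \<bar>v $ l\<bar>) - 1"
        using that by (simp add: sum.remove[of UNIV i])
      finally show ?thesis using Suc by simp
    qed
    have key: "F v \<le> real_of_int s * K"
      if u: "\<bar>u $ i\<bar> = \<bar>v $ i\<bar> - 1" "\<And>l. l \<noteq> i \<Longrightarrow> u $ l = v $ l"
        and uv: "u = v + axis i 1 \<or> v = u + axis i 1" for u
    proof -
      have ub: "\<bar>u $ l\<bar> \<le> \<bar>w $ l\<bar>" for l
        using u Suc(4)[of l] by (cases "l = i") auto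
      have "F u \<le> real_of_int (s - 1) * K"
        using Suc.hyps(2) red[OF u] ub by (intro Suc.hyps(1)) auto
      moreover have "\<bar>F v - F u\<bar> \<le> K"
        using uv
      proof
        assume e: "u = v + axis i 1"
        show ?thesis using step[of v i] ub Suc(4) unfolding e[symmetric] by (simp add: abs_minus_commute)
      next
        assume e: "v = u + axis i 1"
        show ?thesis using step[of u i] ub Suc(4) unfolding e[symmetric] by simp
      qed
      ultimately show ?thesis by (simp add: algebra_simps)
    qed
    show ?case
    proof (cases "v $ i > 0")
      case True
      then show ?thesis
        by (intro key[of "v - axis i 1"]) (auto simp: axis_def vec_eq_iff)
    next
      case False
      with i show ?thesis
        by (intro key[of "v + axis i 1"]) (auto simp: axis_def vec_eq_iff)
    qed
  qed
  from this[of w] show ?thesis by simp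
qed

section \<open>Chains through dyadic cubes for one fixed semimetric\<close>

locale lattice_semimetric =
  fixes r :: "int ^ 'd \<Rightarrow> int ^ 'd \<Rightarrow> real"
  assumes nonneg: "r m n \<ge> 0" and refl [simp]: "r m m = 0" and sym: "r m n = r n m"
    and triangle: "r m l \<le> r m n + r n l"
begin

definition step :: "int ^ 'd \<Rightarrow> real" where
  "step m = (\<Sum>i\<in>UNIV. r m (m + axis i 1))"

lemma step_nonneg: "step m \<ge> 0"
  unfolding step_def by (intro sum_nonneg nonneg)

lemma r_le_step: "r m (m + axis i 1) \<le> step m"
  unfolding step_def by (rule member_le_sum) (auto simp: nonneg)

definition cube_sum :: "int ^ 'd \<Rightarrow> nat \<Rightarrow> real" where
  "cube_sum p R = (\<Sum>m\<in>cube R. step (p + m))"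

lemma cube_sum_nonneg: "cube_sum p R \<ge> 0"
  unfolding cube_sum_def by (intro sum_nonneg step_nonneg)

lemma triangle_diff: "\<bar>r m l - r m n\<bar> \<le> r n l"
  using triangle[of m l n] triangle[of m n l] sym[of n l] by linarith

text \<open>Only the sum over the translates \<open>u\<close> has a bound this small: a single path costs as much as
  the weights it meets, but its translates spread over the whole cube.\<close>
lemma sum_translate_le:
  assumes "\<And>i. \<bar>w $ i\<bar> \<le> 2 ^ k"
  shows "(\<Sum>u\<in>corner_cube k. r (p + u) (p + u + w)) \<le> real CARD('d) * 2 ^ k * cube_sum p (2 ^ Suc k)"
proof -
  let ?K = "cube_sum p (2 ^ Suc k)"
  let ?F = "\<lambda>w. \<Sum>u\<in>corner_cube k. r (p + u) (p + u + w)"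
  have "?F w \<le> (\<Sum>i\<in>UNIV. \<bar>real_of_int (w $ i)\<bar>) * ?K"
  proof (rule l1_path_bound)
    fix z i assume z: "\<And>l. \<bar>z $ l\<bar> \<le> \<bar>w $ l\<bar>"
    have zc: "z \<in> cube (2 ^ k)" using z assms order_trans unfolding cube_def by fastforce
    have "\<bar>?F (z + axis i 1) - ?F z\<bar> \<le> (\<Sum>u\<in>corner_cube k. step (p + u + z))"
      unfolding sum_subtractf[symmetric]
    proof (intro order_trans[OF sum_abs] sum_mono)
      fix u
      show "\<bar>r (p + u) (p + u + (z + axis i 1)) - r (p + u) (p + u + z)\<bar> \<le> step (p + u + z)"
        using triangle_diff[of "p + u" "p + u + (z + axis i 1)" "p + u + z"] r_le_step[of "p + u + z" i]
        by (simp add: add.assoc)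
    qed
    also have "\<dots> = (\<Sum>m\<in>(\<lambda>u. u + z) ` corner_cube k. step (p + m))"
      by (subst sum.reindex) (auto simp: add.assoc)
    also have "\<dots> \<le> ?K"
      unfolding cube_sum_def
    proof (intro sum_mono2 step_nonneg)
      show "(\<lambda>u. u + z) ` corner_cube k \<subseteq> cube (2 ^ Suc k)"
        using cube_add[of _ "2 ^ k" z "2 ^ k"] corner_cube_subset zc by (auto simp: mult_2)
    qed auto
    finally show "\<bar>?F (z + axis i 1) - ?F z\<bar> \<le> ?K" .
  qed simp
  also have "\<dots> \<le> real CARD('d) * 2 ^ k * ?K"
  proof (rule mult_right_mono[OF _ cube_sum_nonneg])
    have "\<bar>real_of_int (w $ i)\<bar> \<le> 2 ^ k" for i
      using assms[of i] by (metis of_int_abs of_int_le_numeral_power_cancel_iff)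
    then have "(\<Sum>i\<in>UNIV. \<bar>real_of_int (w $ i)\<bar>) \<le> (\<Sum>i\<in>(UNIV::'d set). 2 ^ k)"
      by (intro sum_mono)
    then show "(\<Sum>i\<in>UNIV. \<bar>real_of_int (w $ i)\<bar>) \<le> real CARD('d) * 2 ^ k" by simp
  qed
  finally show ?thesis .
qed

text \<open>The left side is the mean distance from \<open>p\<close> to a uniform point of a dyadic
  cube. A uniform point of the next cube is \<open>u + 2 ^ k *s e\<close>, so the mean grows at most
  by the mean cost of a shift of length \<open>2 ^ k\<close>. After normalisation, scale j carries
  the value of the order-one Riesz kernel at distance \<open>2 ^ j\<close>.\<close>

lemma corner_average_le:
  "(\<Sum>u\<in>corner_cube k. r p (p + u)) / 2 ^ (k * CARD('d)) \<le>
    real CARD('d) * (\<Sum>j<k. 2 ^ j / 2 ^ (j * CARD('d)) * cube_sum p (2 ^ Suc j))"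
proof (induction k)
  case 0
  have "corner_cube 0 = {0 :: int ^ 'd}"
    unfolding corner_cube_def by (auto simp: vec_eq_iff) (metis le_less_Suc_eq int_one_le_iff_zero_less order_antisym not_le)
  then show ?case by simp
next
  case (Suc k)
  let ?A = "\<Sum>u\<in>corner_cube k. r p (p + u)"
  let ?B = "real CARD('d) * 2 ^ k * cube_sum p (2 ^ Suc k)"
  have "(\<Sum>u\<in>corner_cube (Suc k). r p (p + u)) =
      (\<Sum>e\<in>corner_cube 1. \<Sum>u\<in>corner_cube k. r p (p + (u + 2 ^ k *s e)))"
    by (rule sum_corner_cube_Suc)
  also have "\<dots> \<le> (\<Sum>e\<in>(corner_cube 1 :: (int ^ 'd) set). ?A + ?B)"
  proof (rule sum_mono)
    fix e :: "int ^ 'd" assume e: "e \<in> corner_cube 1"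
    have "(\<Sum>u\<in>corner_cube k. r p (p + (u + 2 ^ k *s e))) \<le>
        (\<Sum>u\<in>corner_cube k. r p (p + u) + r (p + u) (p + u + 2 ^ k *s e))"
      by (intro sum_mono) (metis add.assoc triangle)
    also have "\<dots> = ?A + (\<Sum>u\<in>corner_cube k. r (p + u) (p + u + 2 ^ k *s e))"
      by (rule sum.distrib)
    also have "(\<Sum>u\<in>corner_cube k. r (p + u) (p + u + 2 ^ k *s e)) \<le> ?B"
    proof (rule sum_translate_le)
      fix i
      have "e $ i = 0 \<or> e $ i = 1" using e unfolding corner_cube_def by (auto; smt (verit))
      then show "\<bar>(2 ^ k *s e) $ i\<bar> \<le> 2 ^ k" by auto
    qed
    finally show "(\<Sum>u\<in>corner_cube k. r p (p + (u + 2 ^ k *s e))) \<le> ?A + ?B" by simp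
  qed
  also have "\<dots> = 2 ^ CARD('d) * (?A + ?B)"
    by (simp add: card_corner_cube)
  finally have "(\<Sum>u\<in>corner_cube (Suc k). r p (p + u)) / 2 ^ (Suc k * CARD('d)) \<le>
     2 ^ CARD('d) * (?A + ?B) / 2 ^ (Suc k * CARD('d))"
    by (intro divide_right_mono) auto
  also have "\<dots> = ?A / 2 ^ (k * CARD('d)) + ?B / 2 ^ (k * CARD('d))"
    by (simp add: power_add field_simps)
  finally show ?case using Suc by (simp add: algebra_simps)
qed

text \<open>Three legs from \<open>p\<close> to \<open>q\<close> through \<open>p + u\<close> and
  \<open>q + u\<close>, averaged over \<open>u\<close>. The middle leg is a common shift by
  \<open>q - p\<close> and supplies the top summand \<open>k = K\<close>; the outer legs fall under
  \<open>corner_average_le\<close>.\<close>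

lemma multiscale_bound:
  assumes "q - p \<in> cube (2 ^ K)"
  shows "r p q \<le> real CARD('d) *
    (\<Sum>k\<le>K. 2 ^ k / 2 ^ (k * CARD('d)) * (cube_sum p (2 ^ Suc k) + cube_sum q (2 ^ Suc k)))"
proof -
  let ?N = "2 ^ (K * CARD('d)) :: real"
  let ?Q = "corner_cube K :: (int ^ 'd) set"
  let ?S = "\<lambda>p. \<Sum>k<K. 2 ^ k / 2 ^ (k * CARD('d)) * cube_sum p (2 ^ Suc k)"
  have "?N * r p q = (\<Sum>u\<in>?Q. r p q)"
    by (simp add: card_corner_cube)
  also have "\<dots> \<le> (\<Sum>u\<in>?Q. r p (p + u) + r (p + u) (p + u + (q - p)) + r q (q + u))"
  proof (rule sum_mono)
    fix u
    have "p + u + (q - p) = q + u" by simp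
    then show "r p q \<le> r p (p + u) + r (p + u) (p + u + (q - p)) + r q (q + u)"
      using triangle[of p q "p + u"] triangle[of "p + u" q "q + u"] sym[of q "q + u"] by (simp add: add.commute)
  qed
  also have "\<dots> = (\<Sum>u\<in>?Q. r p (p + u)) + (\<Sum>u\<in>?Q. r (p + u) (p + u + (q - p))) + (\<Sum>u\<in>?Q. r q (q + u))"
    by (simp add: sum.distrib)
  also have "\<dots> \<le> (\<Sum>u\<in>?Q. r p (p + u)) + real CARD('d) * 2 ^ K * cube_sum p (2 ^ Suc K) + (\<Sum>u\<in>?Q. r q (q + u))"
    using assms by (intro add_mono order_refl sum_translate_le) (auto simp: cube_def)
  finally have "r p q \<le> ((\<Sum>u\<in>?Q. r p (p + u)) + real CARD('d) * 2 ^ K * cube_sum p (2 ^ Suc K) + (\<Sum>u\<in>?Q. r q (q + u))) / ?N"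
    by (simp add: pos_le_divide_eq mult.commute)
  also have "\<dots> = (\<Sum>u\<in>?Q. r p (p + u)) / ?N + real CARD('d) * (2 ^ K / ?N * cube_sum p (2 ^ Suc K)) + (\<Sum>u\<in>?Q. r q (q + u)) / ?N"
    by (simp add: add_divide_distrib)
  also have "\<dots> \<le> real CARD('d) * ?S p + real CARD('d) * (2 ^ K / ?N * cube_sum p (2 ^ Suc K)) + real CARD('d) * ?S q"
    by (intro add_mono corner_average_le order_refl)
  also have "\<dots> \<le> real CARD('d) * ?S p + real CARD('d) * (2 ^ K / ?N * (cube_sum p (2 ^ Suc K) + cube_sum q (2 ^ Suc K))) + real CARD('d) * ?S q"
    by (intro add_mono mult_left_mono order_refl) (auto simp: cube_sum_nonneg)
  also have "\<dots> = real CARD('d) * (\<Sum>k\<le>K. 2 ^ k / 2 ^ (k * CARD('d)) * (cube_sum p (2 ^ Suc k) + cube_sum q (2 ^ Suc k)))"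
    by (simp add: lessThan_Suc_atMost[symmetric] sum.distrib distrib_left)
  finally show ?thesis .
qed

end

section \<open>Discrete Riesz potentials\<close>

lemma sum_min_pow2_le:
  fixes y :: real
  assumes "y \<ge> 0"
  shows "(\<Sum>k<n. min (2 ^ k) (y\<^sup>2 / 2 ^ k)) \<le> 4 * y"
proof -
  \<comment> \<open>Terms grow up to the scale \<open>y\<close> and then halve. Past the crossover
    the subtracted \<open>2 * y\<^sup>2 / 2 ^ n\<close> is the whole remaining tail, the room that
    the induction consumes.\<close>
  have "(\<Sum>k<n. min (2 ^ k) (y\<^sup>2 / 2 ^ k)) \<le> (if 2 ^ n \<le> 2 * y then 2 ^ n else 4 * y - 2 * y\<^sup>2 / 2 ^ n)"
  proof (induction n)
    case 0
    have "0 \<le> 2 * y * (2 - y)" if "2 * y < 1" using that assms by (intro mult_nonneg_nonneg) auto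
    then show ?case by (auto simp: power2_eq_square algebra_simps)
  next
    case (Suc n)
    define X :: real where "X = 2 ^ n"
    have X: "X > 0" "2 ^ Suc n = 2 * X" by (auto simp: X_def)
    consider "2 * X \<le> 2 * y" | "X \<le> 2 * y" "2 * y < 2 * X" | "2 * y < X" by linarith
    then show ?case
    proof cases
      case 1
      then show ?thesis using Suc X by (simp add: X_def[symmetric])
    next
      case 2
      have "(X - y) * (X - 2 * y) \<le> 0" using 2 by (intro mult_nonneg_nonpos) auto
      then have "X * X + 2 * y\<^sup>2 \<le> 3 * (X * y)" by (simp add: power2_eq_square algebra_simps)
      also have "\<dots> \<le> 4 * (X * y)" using X assms by auto
      finally have "X + y\<^sup>2 / X \<le> 4 * y - 2 * y\<^sup>2 / (2 * X)"
        using divide_right_mono[of "X * X + 2 * y\<^sup>2" "4 * (X * y)" X] X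
        by (simp add: add_divide_distrib)
      moreover have "(\<Sum>k<n. min (2 ^ k) (y\<^sup>2 / 2 ^ k)) \<le> X" "min X (y\<^sup>2 / X) \<le> y\<^sup>2 / X"
        using Suc 2 by (auto simp: X_def)
      ultimately show ?thesis using 2 unfolding X sum.lessThan_Suc X_def[symmetric] by auto
    next
      case 3
      have "(\<Sum>k<n. min (2 ^ k) (y\<^sup>2 / 2 ^ k)) \<le> 4 * y - 2 * y\<^sup>2 / X" "min X (y\<^sup>2 / X) \<le> y\<^sup>2 / X"
        using Suc 3 by (auto simp: X_def)
      moreover have "\<not> 2 * X \<le> 2 * y" using 3 X by linarith
      moreover have "2 * y\<^sup>2 / (2 * X) = y\<^sup>2 / X" "2 * y\<^sup>2 / X = 2 * (y\<^sup>2 / X)" by simp_all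
      ultimately show ?thesis unfolding X sum.lessThan_Suc X_def[symmetric] if_not_P[OF \<open>\<not> 2 * X \<le> 2 * y\<close>] by linarith
    qed
  qed
  also have "\<dots> \<le> 4 * y" using assms by auto
  finally show ?thesis .
qed

text \<open>Meant for \<open>c k\<close> the number of sites of a level set within distance about
  \<open>2 ^ k\<close> of a point, and \<open>y\<close> the d-th root of the number of all its
  sites: \<open>c1\<close> is the volume bound, \<open>c2\<close> the total count. Beyond the scale
  \<open>y\<close> the terms are at most y^d 2^(-k(d-1)), which \<open>d \<ge> 2\<close> lets one
  weaken to the summable \<open>y\<^sup>2 / 2 ^ k\<close>. For d = 1 the kernel is constant and
  every scale may contribute.\<close>

lemma potential_sum_le:
  fixes c :: "nat \<Rightarrow> real"
  assumes "d \<ge> 2" and y: "y \<ge> 0" and c1: "\<And>k. c k \<le> b * 2 ^ (k * d)" and c2: "\<And>k. c k \<le> y ^ d" and b: "b \<ge> 1"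
  shows "(\<Sum>k\<le>K. 2 ^ k / 2 ^ (k * d) * c k) \<le> 4 * b * y"
proof -
  have "2 ^ k / 2 ^ (k * d) * c k \<le> b * min (2 ^ k) (y\<^sup>2 / 2 ^ k)" for k
  proof -
    have 1: "2 ^ k / 2 ^ (k * d) * c k \<le> b * 2 ^ k"
      using c1[of k] by (simp add: field_simps)
    have 2: "2 ^ k / 2 ^ (k * d) * c k \<le> b * (y\<^sup>2 / 2 ^ k)"
    proof (cases "y \<le> 2 ^ k")
      case True
      obtain e where d: "d = e + 2" using assms(1) by (metis add.commute le_Suc_ex)
      have "c k \<le> y ^ e * y\<^sup>2" using c2[of k] by (simp add: d power_add power2_eq_square mult.assoc mult.commute mult.left_commute)
      also have "\<dots> \<le> (2 ^ k) ^ e * y\<^sup>2" using True y by (intro mult_right_mono power_mono) auto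
      finally have "2 ^ k / 2 ^ (k * d) * c k \<le> 2 ^ k / 2 ^ (k * d) * ((2 ^ k) ^ e * y\<^sup>2)"
        by (intro mult_left_mono) auto
      also have "\<dots> = 1 * (y\<^sup>2 / 2 ^ k)"
        by (simp add: d power_add power_mult power2_eq_square distrib_left)
      also have "\<dots> \<le> b * (y\<^sup>2 / 2 ^ k)"
        using b by (intro mult_right_mono) auto
      finally show ?thesis .
    next
      case False
      then have "2 ^ k * 2 ^ k \<le> y\<^sup>2" unfolding power2_eq_square using y by (intro mult_mono) auto
      then have "2 ^ k \<le> y\<^sup>2 / 2 ^ k" by (simp add: field_simps)
      then have "b * 2 ^ k \<le> b * (y\<^sup>2 / 2 ^ k)" using b by (intro mult_left_mono) auto
      with 1 show ?thesis by linarith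
    qed
    show ?thesis using 1 2 b by (simp add: min_def)
  qed
  then have "(\<Sum>k\<le>K. 2 ^ k / 2 ^ (k * d) * c k) \<le> b * (\<Sum>k<Suc K. min (2 ^ k) (y\<^sup>2 / 2 ^ k))"
    unfolding sum_distrib_left lessThan_Suc_atMost by (intro sum_mono)
  also have "\<dots> \<le> b * (4 * y)" using b y by (intro mult_left_mono sum_min_pow2_le) auto
  finally show ?thesis by simp
qed

lemma sum_pow2_ivl: "i0 \<le> I \<Longrightarrow> (\<Sum>i\<in>{i0..<I}. 2 ^ i) = (2 ^ I - 2 ^ i0 :: real)"
  by (induction I rule: dec_induct) auto

text \<open>Discrete layer cake: if \<open>2 ^ i\<close> is the highest level exceeded, the sum
  telescopes to \<open>2 ^ Suc i - 2 ^ i0\<close>, and \<open>a\<close> is at most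
  \<open>2 ^ Suc i\<close>.\<close>

lemma dyadic_layer_le:
  fixes a :: real
  assumes "i0 \<le> I" "a \<le> 2 ^ I"
  shows "a \<le> 2 ^ i0 + (\<Sum>i\<in>{i0..<I}. 2 ^ i * of_bool (a > 2 ^ i))"
  using assms
proof (induction I rule: dec_induct)
  case (step I)
  show ?case
  proof (cases "a \<le> 2 ^ I")
    case True
    then show ?thesis using step by simp
  next
    case False
    have "(\<Sum>i\<in>{i0..<Suc I}. 2 ^ i * of_bool (a > 2 ^ i)) = (\<Sum>i\<in>{i0..<Suc I}. 2 ^ i :: real)"
    proof (rule sum.cong)
      fix i assume "i \<in> {i0..<Suc I}"
      then have "2 ^ i \<le> (2 ^ I :: real)" by (intro power_increasing) auto
      with False have "a > 2 ^ i" by linarith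
      then show "2 ^ i * of_bool (a > 2 ^ i) = (2 ^ i :: real)" by simp
    qed simp
    also have "\<dots> = 2 ^ Suc I - 2 ^ i0" using step by (intro sum_pow2_ivl) auto
    finally show ?thesis using step by simp
  qed
qed simp

lemma sum_dyadic_layer_le:
  fixes f :: "'b \<Rightarrow> real"
  assumes "finite A" "i0 \<le> I" "\<And>s. s \<in> A \<Longrightarrow> f s \<le> 2 ^ I"
  shows "sum f A \<le> 2 ^ i0 * real (card A) + (\<Sum>i\<in>{i0..<I}. 2 ^ i * real (card {s\<in>A. f s > 2 ^ i}))"
proof -
  have "sum f A \<le> (\<Sum>s\<in>A. 2 ^ i0 + (\<Sum>i\<in>{i0..<I}. 2 ^ i * of_bool (f s > 2 ^ i)))"
    using assms by (intro sum_mono dyadic_layer_le) auto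
  also have "\<dots> = 2 ^ i0 * real (card A) + (\<Sum>i\<in>{i0..<I}. \<Sum>s\<in>A. 2 ^ i * of_bool (f s > 2 ^ i))"
    by (subst sum.swap) (simp add: sum.distrib mult.commute)
  also have "(\<lambda>i. \<Sum>s\<in>A. 2 ^ i * of_bool (f s > 2 ^ i)) = (\<lambda>i. 2 ^ i * real (card {s\<in>A. f s > 2 ^ i}))"
    using assms(1) by (simp add: sum_distrib_left[symmetric] sum.If_cases of_bool_def Int_def)
  finally show ?thesis .
qed

text \<open>Asymptotic equicontinuity of the semimetrics rescaled by R, with 2^(-i) and 2^(-j) as
  epsilon and delta. Dyadic parameters keep all quantifiers countable, so that
  \<open>regular\<close> is measurable.\<close>

definition equicontinuous_at_infinity :: "(int ^ 'd \<Rightarrow> int ^ 'd \<Rightarrow> real) \<Rightarrow> bool" where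
  "equicontinuous_at_infinity r \<longleftrightarrow>
     (\<forall>i. \<exists>j R0. \<forall>R\<ge>R0. \<forall>p q. p \<in> cube R \<longrightarrow> q \<in> cube R \<longrightarrow>
        (\<forall>l. 2 ^ j * \<bar>(q - p) $ l\<bar> \<le> int R) \<longrightarrow> 2 ^ i * r p q \<le> real R)"

section \<open>Level counts control displacements\<close>

context lattice_semimetric begin

definition level_count :: "nat \<Rightarrow> nat \<Rightarrow> nat" where
  "level_count i J = card {m \<in> cube (2 ^ J). step m > 2 ^ i}"

text \<open>The scale-invariant form in which the Lorentz condition is used: the sum is a dyadic version of
  the quasinorm of the unbounded part of \<open>step\<close> on a cube of side comparable to \<open>2 ^ J\<close>.\<close>
definition small_tails :: bool where
  "small_tails \<longleftrightarrow> (\<forall>\<epsilon>>0. \<exists>i0. \<forall>I J.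
     (\<Sum>i\<in>{i0..<I}. 2 ^ i * real (level_count i J) powr (1 / CARD('d))) \<le> \<epsilon> * 2 ^ J)"

lemma line_bound: "r p (p + int t *s axis j 1) \<le> (\<Sum>s<t. step (p + int s *s axis j 1))"
proof (induction t)
  case (Suc t)
  let ?q = "p + int t *s axis j 1"
  have "p + int (Suc t) *s axis j 1 = ?q + axis j 1"
    by (auto simp: vec_eq_iff axis_def)
  then show ?case using Suc triangle[of p "?q + axis j 1" ?q] r_le_step[of ?q j] by (simp only: sum.lessThan_Suc)
next
  case 0
  have "p + int 0 *s axis j 1 = p" by (auto simp: vec_eq_iff)
  then show ?case by simp
qed

text \<open>Weights up to \<open>2 ^ i0\<close> cost in proportion to the displacement
  \<open>2 ^ K\<close>. Higher levels cost the d-th roots of their counts whatever \<open>K\<close>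
  is, and \<open>small_tails\<close> makes these small against \<open>2 ^ J\<close>. The constant
  collects 5^d for the volume of a cube of radius \<open>2 ^ Suc k\<close> in units of
  \<open>2 ^ (k * d)\<close>, 4 from \<open>potential_sum_le\<close>, 2 for the two ends and d from
  \<open>multiscale_bound\<close>; in dimension one the direct path along the segment does
  better.\<close>

lemma displacement_bound:
  assumes p: "p \<in> cube (2 ^ J)" and q: "q \<in> cube (2 ^ J)" and qp: "q - p \<in> cube (2 ^ K)" and K: "K < J"
    and I: "i0 \<le> I" "\<And>m. m \<in> cube (2 ^ Suc J) \<Longrightarrow> step m \<le> 2 ^ I"
  shows "r p q \<le> 8 * real CARD('d) * 5 ^ CARD('d) *
    (2 ^ i0 * 2 ^ K + (\<Sum>i\<in>{i0..<I}. 2 ^ i * real (level_count i (Suc J)) powr (1 / CARD('d))))"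
    (is "_ \<le> _ * (_ + ?T)")
proof -
  have T: "?T \<ge> 0" by (intro sum_nonneg) auto
  have "1 * 1 * (1::real) \<le> 8 * real CARD('d) * 5 ^ CARD('d)"
    by (intro mult_mono) auto
  then have C1: "1 \<le> 8 * real CARD('d) * 5 ^ CARD('d)" by simp
  have pow_le: "(2::nat) ^ K \<le> 2 ^ J" using K by (intro power_increasing) auto
  show ?thesis
  proof (cases "CARD('d) = 1")
    case d1: True
    then obtain j :: 'd where j: "UNIV = {j}" by (auto simp: card_1_singleton_iff)
    have key: "r p q \<le> 2 ^ i0 * 2 ^ K + ?T"
      if p: "p \<in> cube (2 ^ J)" and t: "q = p + int t *s axis j 1" and tK: "t \<le> 2 ^ K" for p q t
    proof -
      have in_cube: "p + int s *s axis j 1 \<in> cube (2 ^ Suc J)" if "s < t" for s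
      proof -
        have "int s \<le> 2 ^ J" using that tK pow_le by (metis le_trans less_imp_le of_nat_le_numeral_power_cancel_iff)
        then have "int s *s axis j 1 \<in> cube (2 ^ J)" by (auto simp: cube_def axis_def)
        from cube_add[OF p this] show ?thesis by (simp add: mult_2)
      qed
      have "r p q \<le> (\<Sum>s<t. step (p + int s *s axis j 1))" unfolding t by (rule line_bound)
      also have "\<dots> \<le> 2 ^ i0 * real (card {..<t}) +
          (\<Sum>i\<in>{i0..<I}. 2 ^ i * real (card {s\<in>{..<t}. step (p + int s *s axis j 1) > 2 ^ i}))"
        using I in_cube by (intro sum_dyadic_layer_le) auto
      also have "\<dots> \<le> 2 ^ i0 * 2 ^ K + ?T"
      proof (intro add_mono mult_left_mono sum_mono)
        show "real (card {..<t}) \<le> 2 ^ K" using tK by (simp add: of_nat_le_numeral_power_cancel_iff)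
        fix i
        have "card {s\<in>{..<t}. step (p + int s *s axis j 1) > 2 ^ i} \<le> level_count i (Suc J)"
          unfolding level_count_def
        proof (rule card_inj_on_le)
          show "inj_on (\<lambda>s. p + int s *s axis j 1) {s \<in> {..<t}. 2 ^ i < step (p + int s *s axis j 1)}"
            by (auto simp: inj_on_def vec_eq_iff axis_def)
        qed (use in_cube in auto)
        then show "real (card {s\<in>{..<t}. step (p + int s *s axis j 1) > 2 ^ i}) \<le>
            real (level_count i (Suc J)) powr (1 / real CARD('d))"
          unfolding d1 by simp
      qed auto
      finally show ?thesis .
    qed
    have qpj: "\<bar>(q - p) $ j\<bar> \<le> 2 ^ K" using qp by (auto simp: cube_def)
    have eqI: "u = v" if "u $ j = v $ j" for u v :: "int ^ 'd"
      using that j by (metis UNIV_I singletonD vec_eq_iff)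
    have "r p q \<le> 2 ^ i0 * 2 ^ K + ?T"
    proof (cases "(q - p) $ j \<ge> 0")
      case True
      then show ?thesis using qpj
        by (intro key[OF p, of _ "nat ((q - p) $ j)"])
          (auto intro!: eqI simp: nat_le_iff)
    next
      case False
      then have "r q p \<le> 2 ^ i0 * 2 ^ K + ?T" using qpj
        by (intro key[OF q, of _ "nat ((p - q) $ j)"])
          (auto intro!: eqI simp: nat_le_iff)
      then show ?thesis by (simp add: sym)
    qed
    also have "\<dots> = 1 * \<dots>" by simp
    also have "\<dots> \<le> 8 * real CARD('d) * 5 ^ CARD('d) * (2 ^ i0 * 2 ^ K + ?T)"
      using C1 T by (intro mult_right_mono) auto
    finally show ?thesis .
  next
    case False
    then have d2: "CARD('d) \<ge> 2" using zero_less_card_finite[where 'a='d] by linarith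
    let ?d = "CARD('d)"
    have S: "(\<Sum>k\<le>K. 2 ^ k / 2 ^ (k * ?d) * cube_sum p (2 ^ Suc k)) \<le> 4 * 5 ^ ?d * (2 ^ i0 * 2 ^ K + ?T)"
      if p: "p \<in> cube (2 ^ J)" for p
    proof -
      \<comment> \<open>Set to 0 beyond \<open>K\<close>, because \<open>potential_sum_le\<close>
        asks for its bounds at every \<open>k\<close>, whereas the cubes are known to stay inside
        \<open>cube (2 ^ Suc J)\<close> only up to \<open>K\<close>.\<close>
      define n where "n = (\<lambda>i k. real (if k \<le> K then card {m\<in>cube (2 ^ Suc k). step (p + m) > 2 ^ i} else 0))"
      have in_cube: "p + m \<in> cube (2 ^ Suc J)" if "m \<in> cube (2 ^ Suc k)" "k \<le> K" for m k
      proof -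
        have "(2::nat) ^ Suc k \<le> 2 ^ J" using that K by (intro power_increasing) auto
        then have "m \<in> cube (2 ^ J)" using that(1) cube_mono by blast
        from cube_add[OF p this] show ?thesis by (simp add: mult_2)
      qed
      have card5: "real (card (cube (2 ^ Suc k) :: (int ^ 'd) set)) \<le> 5 ^ ?d * 2 ^ (k * ?d)" for k
      proof -
        have "(2 * 2 ^ Suc k + 1 :: nat) ^ ?d \<le> (5 * 2 ^ k) ^ ?d" by (intro power_mono) auto
        also have "\<dots> = 5 ^ ?d * 2 ^ (k * ?d)" by (simp add: power_mult_distrib power_mult)
        finally show ?thesis unfolding card_cube of_nat_le_iff[symmetric, where 'a=real] by simp
      qed
      have cs: "cube_sum p (2 ^ Suc k) \<le> 2 ^ i0 * (5 ^ ?d * 2 ^ (k * ?d)) + (\<Sum>i\<in>{i0..<I}. 2 ^ i * n i k)"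
        if "k \<le> K" for k
      proof -
        have "cube_sum p (2 ^ Suc k) \<le> 2 ^ i0 * real (card (cube (2 ^ Suc k) :: (int ^ 'd) set)) +
            (\<Sum>i\<in>{i0..<I}. 2 ^ i * real (card {m\<in>cube (2 ^ Suc k). step (p + m) > 2 ^ i}))"
          unfolding cube_sum_def using that I in_cube by (intro sum_dyadic_layer_le) auto
        also have "\<dots> \<le> 2 ^ i0 * (5 ^ ?d * 2 ^ (k * ?d)) + (\<Sum>i\<in>{i0..<I}. 2 ^ i * n i k)"
          using card5 that by (intro add_mono mult_left_mono) (auto simp: n_def)
        finally show ?thesis .
      qed
      have n_sum: "(\<Sum>k\<le>K. 2 ^ k / 2 ^ (k * ?d) * n i k) \<le>
          4 * 5 ^ ?d * real (level_count i (Suc J)) powr (1 / ?d)" for i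
      proof (rule potential_sum_le[OF d2])
        fix k
        have "card {m\<in>cube (2 ^ Suc k). step (p + m) > 2 ^ i} \<le> card (cube (2 ^ Suc k) :: (int ^ 'd) set)"
          by (intro card_mono) auto
        then show "n i k \<le> 5 ^ ?d * 2 ^ (k * ?d)"
          using card5[of k] unfolding n_def by (auto simp del: power_Suc)
        have "card {m\<in>cube (2 ^ Suc k). step (p + m) > 2 ^ i} \<le> level_count i (Suc J)" if "k \<le> K"
          unfolding level_count_def
        proof (rule card_inj_on_le)
          show "inj_on (\<lambda>m. p + m) {m \<in> cube (2 ^ Suc k). 2 ^ i < step (p + m)}" by auto
        qed (use in_cube that in \<open>auto simp del: power_Suc\<close>)
        then have "n i k \<le> level_count i (Suc J)" unfolding n_def by (auto simp del: power_Suc)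
        also have "\<dots> = (real (level_count i (Suc J)) powr (1 / ?d)) ^ ?d"
        proof (cases "level_count i (Suc J) = 0")
          case False
          then show ?thesis by (simp add: powr_realpow[symmetric] powr_powr)
        qed simp
        finally show "n i k \<le> (real (level_count i (Suc J)) powr (1 / ?d)) ^ ?d" .
      qed auto
      have "(\<Sum>k\<le>K. 2 ^ k / 2 ^ (k * ?d) * cube_sum p (2 ^ Suc k)) \<le>
          (\<Sum>k\<le>K. 2 ^ k / 2 ^ (k * ?d) * (2 ^ i0 * (5 ^ ?d * 2 ^ (k * ?d)) + (\<Sum>i\<in>{i0..<I}. 2 ^ i * n i k)))"
        using cs by (intro sum_mono mult_left_mono) auto
      also have "\<dots> = (\<Sum>k\<le>K. 2 ^ i0 * 5 ^ ?d * 2 ^ k) +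
          (\<Sum>i\<in>{i0..<I}. 2 ^ i * (\<Sum>k\<le>K. 2 ^ k / 2 ^ (k * ?d) * n i k))"
      proof -
        have "(\<Sum>i\<in>{i0..<I}. 2 ^ i * (\<Sum>k\<le>K. 2 ^ k / 2 ^ (k * ?d) * n i k)) =
          (\<Sum>k\<le>K. 2 ^ k / 2 ^ (k * ?d) * (\<Sum>i\<in>{i0..<I}. 2 ^ i * n i k))"
          unfolding sum_distrib_left sum.swap[of _ _ "{i0..<I}"] by (simp add: algebra_simps)
        then show ?thesis by (simp add: distrib_left sum.distrib algebra_simps)
      qed
      also have "(\<Sum>k\<le>K. 2 ^ i0 * 5 ^ ?d * 2 ^ k) = 2 ^ i0 * 5 ^ ?d * (2 ^ Suc K - 1 :: real)"
        unfolding sum_distrib_left[symmetric] using sum_pow2_ivl[of 0 "Suc K"]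
        by (simp add: atLeast0LessThan lessThan_Suc_atMost)
      also have "\<dots> \<le> 4 * 5 ^ ?d * (2 ^ i0 * 2 ^ K)"
        by (simp add: algebra_simps)
      also have "(\<Sum>i\<in>{i0..<I}. 2 ^ i * (\<Sum>k\<le>K. 2 ^ k / 2 ^ (k * ?d) * n i k)) \<le>
          (\<Sum>i\<in>{i0..<I}. 2 ^ i * (4 * 5 ^ ?d * real (level_count i (Suc J)) powr (1 / ?d)))"
        by (intro sum_mono mult_left_mono n_sum) auto
      also have "\<dots> = 4 * 5 ^ ?d * ?T" unfolding sum_distrib_left by (simp add: algebra_simps)
      finally show ?thesis by (simp add: algebra_simps)
    qed
    have "r p q \<le> real ?d * ((\<Sum>k\<le>K. 2 ^ k / 2 ^ (k * ?d) * cube_sum p (2 ^ Suc k)) +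
        (\<Sum>k\<le>K. 2 ^ k / 2 ^ (k * ?d) * cube_sum q (2 ^ Suc k)))"
      using multiscale_bound[OF qp] by (simp add: distrib_left sum.distrib)
    also have "\<dots> \<le> real ?d * (4 * 5 ^ ?d * (2 ^ i0 * 2 ^ K + ?T) + 4 * 5 ^ ?d * (2 ^ i0 * 2 ^ K + ?T))"
      by (intro mult_left_mono add_mono S p q) auto
    finally show ?thesis by (simp add: algebra_simps)
  qed
qed

lemma equicontinuousI:
  assumes small_tails
  shows "equicontinuous_at_infinity r"
  unfolding equicontinuous_at_infinity_def
proof
  fix i
  define C where "C = 8 * real CARD('d) * 5 ^ CARD('d)"
  have C: "C > 0" by (simp add: C_def)
  \<comment> \<open>The tail at scale \<open>Suc J\<close> will be at most
    \<open>\<epsilon> * (4 * R)\<close>, as \<open>2 ^ J \<le> 2 * R\<close>. Multiplied by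
    \<open>C\<close> this is half of the target \<open>R / 2 ^ i\<close>; the choice of
    \<open>j0\<close> leaves the other half to the bounded weights.\<close>
  define \<epsilon> where "\<epsilon> = 1 / (8 * C * 2 ^ i)"
  have \<epsilon>: "\<epsilon> > 0" using C by (simp add: \<epsilon>_def)
  obtain i0 where i0: "\<And>I J. (\<Sum>i\<in>{i0..<I}. 2 ^ i * real (level_count i J) powr (1 / CARD('d))) \<le> \<epsilon> * 2 ^ J"
    using assms \<epsilon> unfolding small_tails_def by blast
  obtain j0 where j0: "4 * C * 2 ^ i0 * 2 ^ i < 2 ^ j0"
    using real_arch_pow[of 2] by auto
  \<comment> \<open>The successor gives \<open>j \<ge> 1\<close>, so that \<open>J - j < J\<close>
    as \<open>displacement_bound\<close> requires.\<close>
  define j where "j = Suc j0"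
  have "(2::real) ^ j = 2 * 2 ^ j0" by (simp add: j_def)
  moreover have "0 < (2::real) ^ j0" by simp
  ultimately have j: "4 * C * 2 ^ i0 * 2 ^ i \<le> 2 ^ j" "j \<ge> 1" using j0 unfolding j_def by linarith+
  have "2 ^ i * r p q \<le> real R"
    if R: "R \<ge> 2 ^ j" and p: "p \<in> cube R" and q: "q \<in> cube R" and pq: "\<forall>l. 2 ^ j * \<bar>(q - p) $ l\<bar> \<le> int R" for R p q
  proof -
    have "1 \<le> R" using R by (metis one_le_numeral one_le_power order_trans)
    then obtain n where n: "2 ^ n \<le> R" "R < 2 ^ (n + 1)" using ex_power_ivl1[of 2 R] by auto
    define J where "J = Suc n"
    have J: "R \<le> 2 ^ J" "2 ^ J \<le> 2 * R" using n by (auto simp: J_def)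
    have Jr: "2 ^ J \<le> 2 * real R" using J(2) by (metis of_nat_le_iff of_nat_mult of_nat_numeral of_nat_power)
    have "(2::nat) ^ j < 2 ^ J" using R n unfolding J_def by simp
    then have jJ: "j < J" by (metis nat_power_less_imp_less zero_less_numeral)
    have pJ: "p \<in> cube (2 ^ J)" and qJ: "q \<in> cube (2 ^ J)" using p q J(1) cube_mono by blast+
    have "\<bar>(q - p) $ l\<bar> \<le> 2 ^ (J - j)" for l
    proof -
      have "2 ^ j * \<bar>(q - p) $ l\<bar> \<le> int R" using pq by blast
      also have "\<dots> \<le> 2 ^ J" using J(1) by (metis of_nat_le_numeral_power_cancel_iff)
      also have "\<dots> = 2 ^ j * 2 ^ (J - j)" using jJ by (simp add: power_add[symmetric])
      finally show ?thesis by (metis mult_le_cancel_left_pos zero_less_numeral zero_less_power)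
    qed
    then have qp: "q - p \<in> cube (2 ^ (J - j))" unfolding cube_def by auto
    obtain B where B: "\<And>m. m \<in> cube (2 ^ Suc J) \<Longrightarrow> step m \<le> B"
      using bdd_above_finite[of "step ` cube (2 ^ Suc J)"] unfolding bdd_above_def by (metis finite_cube finite_imageI imageI)
    obtain I0 where I0: "B < 2 ^ I0" using real_arch_pow[of 2 B] by auto
    define I where "I = max i0 I0"
    have "(2::real) ^ I0 \<le> 2 ^ I" unfolding I_def by (intro power_increasing) auto
    then have "step m \<le> 2 ^ I" if "m \<in> cube (2 ^ Suc J)" for m using B[OF that] I0 by linarith
    then have "r p q \<le> C * (2 ^ i0 * 2 ^ (J - j) + (\<Sum>i\<in>{i0..<I}. 2 ^ i * real (level_count i (Suc J)) powr (1 / CARD('d))))"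
      unfolding C_def using jJ j by (intro displacement_bound[OF pJ qJ qp]) (auto simp: I_def)
    also have "\<dots> \<le> C * (2 ^ i0 * (2 * real R / 2 ^ j) + \<epsilon> * (4 * real R))"
    proof (intro mult_left_mono add_mono)
      have "2 ^ (J - j) = (2 ^ J / 2 ^ j :: real)" using jJ by (simp add: power_diff)
      then show "2 ^ (J - j) \<le> 2 * real R / 2 ^ j" using Jr by (simp add: divide_right_mono)
      have "(\<Sum>i\<in>{i0..<I}. 2 ^ i * real (level_count i (Suc J)) powr (1 / CARD('d))) \<le> \<epsilon> * 2 ^ Suc J"
        by (rule i0)
      also have "\<dots> \<le> \<epsilon> * (4 * real R)" using Jr \<epsilon> by (intro mult_left_mono) auto
      finally show "(\<Sum>i\<in>{i0..<I}. 2 ^ i * real (level_count i (Suc J)) powr (1 / CARD('d))) \<le> \<epsilon> * (4 * real R)" .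
    qed (use C in auto)
    finally have "2 ^ i * r p q \<le> 2 ^ i * (C * (2 ^ i0 * (2 * real R / 2 ^ j) + \<epsilon> * (4 * real R)))"
      by (intro mult_left_mono) auto
    also have "\<dots> = real R * ((4 * C * 2 ^ i0 * 2 ^ i) / 2 ^ j / 2 + 1 / 2)"
      using C by (simp add: \<epsilon>_def field_simps)
    also have "\<dots> \<le> real R * (1 / 2 + 1 / 2)"
      using j by (intro mult_left_mono add_mono) (auto simp: field_simps)
    finally show ?thesis by simp
  qed
  then show "\<exists>j R0. \<forall>R\<ge>R0. \<forall>p q. p \<in> cube R \<longrightarrow> q \<in> cube R \<longrightarrow>
        (\<forall>l. 2 ^ j * \<bar>(q - p) $ l\<bar> \<le> int R) \<longrightarrow> 2 ^ i * r p q \<le> real R" by blast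
qed

end

section \<open>Maximal inequality and Lorentz levels\<close>

text \<open>Greedy Vitali selection: take a centre of largest radius; every centre whose cube meets
  the chosen one lies in the concentric cube of twice the radius, and the remaining cubes are
  disjoint from it. Only centres are counted, so the factor is 2^d and not the customary
  3^d.\<close>

lemma vitali_count:
  fixes D :: "(int ^ 'd) set" and rad :: "int ^ 'd \<Rightarrow> nat" and \<phi> :: "int ^ 'd \<Rightarrow> ennreal"
  assumes "finite D" "\<And>m. m \<in> D \<Longrightarrow> c * of_nat ((2 * rad m + 1) ^ CARD('d)) \<le> (\<Sum>u\<in>cube (rad m). \<phi> (m + u))"
  shows "c * of_nat (card D) \<le> 2 ^ CARD('d) * sum \<phi> (\<Union>m\<in>D. (+) m ` cube (rad m))"
  using assms
proof (induction "card D" arbitrary: D rule: less_induct)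
  case less
  show ?case
  proof (cases "D = {}")
    case False
    define Q where "Q = (\<lambda>m. (+) m ` cube (rad m))"
    have "Max (rad ` D) \<in> rad ` D" using less(2) False by (intro Max_in) auto
    then obtain m where m: "m \<in> D" "rad m = Max (rad ` D)" by auto
    have m_max: "rad m' \<le> rad m" if "m' \<in> D" for m'
      using that less(2) unfolding m(2) by (intro Max_ge) auto
    define D' where "D' = {m'\<in>D. Q m' \<inter> Q m = {}}"
    have fin: "finite D'" "finite (Q a)" for a using less(2) by (auto simp: D'_def Q_def)
    have "m \<in> Q m" unfolding Q_def by (rule image_eqI[of _ _ 0]) auto
    then have "D' \<subset> D" using m(1) unfolding D'_def by blast
    then have cD: "card D' < card D" using less(2) by (simp add: psubset_card_mono)
    have "D - D' \<subseteq> (+) m ` cube (2 * rad m)"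
    proof
      fix m' assume m': "m' \<in> D - D'"
      then obtain u v where uv: "u \<in> cube (rad m')" "v \<in> cube (rad m)" "m' + u = m + v"
        unfolding D'_def Q_def by auto
      have "u \<in> cube (rad m)" using uv(1) m_max[of m'] m' cube_mono by blast
      then have "v + - u \<in> cube (rad m + rad m)" by (intro cube_add uv cube_uminus)
      moreover have "m' = m + (v + - u)" using uv(3) by (metis add_diff_cancel_right' add_diff_eq diff_conv_add_uminus)
      ultimately show "m' \<in> (+) m ` cube (2 * rad m)" unfolding mult_2 by (rule image_eqI[rotated])
    qed
    then have "card (D - D') \<le> card ((+) m ` cube (2 * rad m))" by (intro card_mono) auto
    also have "\<dots> = (2 * (2 * rad m) + 1) ^ CARD('d)" by (simp add: card_image card_cube)
    also have "\<dots> \<le> (2 * (2 * rad m + 1)) ^ CARD('d)" by (intro power_mono) auto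
    finally have "card (D - D') \<le> 2 ^ CARD('d) * (2 * rad m + 1) ^ CARD('d)" by (simp only: power_mult_distrib)
    then have "of_nat (card (D - D')) \<le> (of_nat (2 ^ CARD('d) * (2 * rad m + 1) ^ CARD('d)) :: ennreal)"
      by (rule of_nat_mono)
    then have "c * of_nat (card (D - D')) \<le> c * (of_nat (2 ^ CARD('d) * (2 * rad m + 1) ^ CARD('d)))"
      by (intro mult_left_mono) auto
    also have "\<dots> = 2 ^ CARD('d) * (c * of_nat ((2 * rad m + 1) ^ CARD('d)))"
      by (simp add: mult_ac)
    also have "\<dots> \<le> 2 ^ CARD('d) * (\<Sum>u\<in>cube (rad m). \<phi> (m + u))"
      using less(3)[OF m(1)] by (intro mult_left_mono) auto
    also have "(\<Sum>u\<in>cube (rad m). \<phi> (m + u)) = sum \<phi> (Q m)"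
      unfolding Q_def by (simp add: sum.reindex)
    finally have 1: "c * of_nat (card (D - D')) \<le> 2 ^ CARD('d) * sum \<phi> (Q m)" .
    have 2: "c * of_nat (card D') \<le> 2 ^ CARD('d) * sum \<phi> (\<Union>m\<in>D'. Q m)"
      unfolding Q_def using less(3) cD fin by (intro less(1)) (auto simp: D'_def)
    have "card D = card D' + card (D - D')"
      using \<open>D' \<subset> D\<close> less(2) fin(1) by (simp add: card_Diff_subset card_mono psubset_imp_subset)
    then have "c * of_nat (card D) = c * of_nat (card D') + c * of_nat (card (D - D'))"
      by (simp add: distrib_left)
    also have "\<dots> \<le> 2 ^ CARD('d) * sum \<phi> (\<Union>m\<in>D'. Q m) + 2 ^ CARD('d) * sum \<phi> (Q m)"
      by (intro add_mono 1 2)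
    also have "\<dots> = 2 ^ CARD('d) * sum \<phi> ((\<Union>m\<in>D'. Q m) \<union> Q m)"
      using fin by (subst sum.union_disjoint) (auto simp: D'_def distrib_left)
    also have "\<dots> \<le> 2 ^ CARD('d) * sum \<phi> (\<Union>m\<in>D. Q m)"
      using m(1) less(2) fin by (intro mult_left_mono sum_mono2) (auto simp: D'_def)
    finally show ?thesis unfolding Q_def .
  qed simp
qed

section \<open>Measure-preserving lattice actions and the maximal inequality\<close>

locale lattice_action = prob_space M for M :: "'a measure" +
  fixes T :: "int ^ 'd \<Rightarrow> 'a \<Rightarrow> 'a"
  assumes T_measurable [measurable]: "T k \<in> M \<rightarrow>\<^sub>M M" and distr_T: "distr M M (T k) = M"
    and T_0: "x \<in> space M \<Longrightarrow> T 0 x = x"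
    and T_add: "x \<in> space M \<Longrightarrow> T (k + l) x = T k (T l x)"
begin

lemma T_space [simp]: "x \<in> space M \<Longrightarrow> T k x \<in> space M"
  using T_measurable by (rule measurable_space)

lemma nn_integral_T:
  assumes [measurable]: "f \<in> borel_measurable M"
  shows "(\<integral>\<^sup>+x. f (T k x) \<partial>M) = (\<integral>\<^sup>+x. f x \<partial>M)"
  using nn_integral_distr[of "T k" M M f] by (simp add: distr_T)

text \<open>Wiener's inequality by transference: \<open>vitali_count\<close> is applied to the
  visits of an orbit to the exceptional set within a window of radius \<open>L\<close>, and the
  result is integrated. One factor 2^d comes from the covering, the other from comparing windows of
  radii \<open>2 * L\<close> and \<open>L\<close>; the restriction to radii at most \<open>L\<close>
  is removed by continuity from below.\<close>

lemma maximal_inequality: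
  fixes f :: "'a \<Rightarrow> ennreal"
  assumes f [measurable]: "f \<in> borel_measurable M"
  shows "c * emeasure M {x \<in> space M. \<exists>r. c * of_nat ((2 * r + 1) ^ CARD('d)) \<le> (\<Sum>u\<in>cube r. f (T u x))}
    \<le> 4 ^ CARD('d) * (\<integral>\<^sup>+x. f x \<partial>M)"
proof -
  define D where "D = (\<lambda>L::nat. {x \<in> space M. \<exists>r\<le>L. c * of_nat ((2 * r + 1) ^ CARD('d)) \<le> (\<Sum>u\<in>cube r. f (T u x))})"
  have D [measurable]: "D L \<in> sets M" for L unfolding D_def by measurable
  have bound: "c * emeasure M (D L) \<le> 4 ^ CARD('d) * (\<integral>\<^sup>+x. f x \<partial>M)" for L
  proof -
    let ?n = "(2 * L + 1) ^ CARD('d)"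
    have pw: "c * (\<Sum>m\<in>cube L. indicator (D L) (T m x)) \<le> 2 ^ CARD('d) * (\<Sum>u\<in>cube (2 * L). f (T u x))"
      if x: "x \<in> space M" for x
    proof -
      define C where "C = {m \<in> cube L. T m x \<in> D L}"
      have "\<exists>rad. \<forall>m\<in>C. rad m \<le> L \<and> c * of_nat ((2 * rad m + 1) ^ CARD('d)) \<le> (\<Sum>u\<in>cube (rad m). f (T (m + u) x))"
        unfolding C_def D_def using x by (intro bchoice) (auto simp: T_add[symmetric] add.commute)
      then obtain rad where rad: "\<And>m. m \<in> C \<Longrightarrow> rad m \<le> L"
          "\<And>m. m \<in> C \<Longrightarrow> c * of_nat ((2 * rad m + 1) ^ CARD('d)) \<le> (\<Sum>u\<in>cube (rad m). f (T (m + u) x))"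
        by blast
      have C: "finite C" unfolding C_def by simp
      have "(\<Sum>m\<in>cube L. indicator (D L) (T m x)) = (of_nat (card C) :: ennreal)"
        unfolding C_def by (simp add: indicator_def sum.If_cases Int_def)
      then have "c * (\<Sum>m\<in>cube L. indicator (D L) (T m x)) \<le> 2 ^ CARD('d) * (\<Sum>u\<in>(\<Union>m\<in>C. (+) m ` cube (rad m)). f (T u x))"
        using vitali_count[OF C rad(2)] by simp
      also have "\<dots> \<le> 2 ^ CARD('d) * (\<Sum>u\<in>cube (2 * L). f (T u x))"
      proof (intro mult_left_mono sum_mono2)
        show "(\<Union>m\<in>C. (+) m ` cube (rad m)) \<subseteq> cube (2 * L)"
        proof clarify
          fix m u :: "int ^ 'd" assume "m \<in> C" "u \<in> cube (rad m)"
          then have "m \<in> cube L" "u \<in> cube L" using rad(1) cube_mono by (auto simp: C_def)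
          then show "m + u \<in> cube (2 * L)" unfolding mult_2 by (rule cube_add)
        qed
      qed auto
      finally show ?thesis .
    qed
    have "(\<integral>\<^sup>+x. c * (\<Sum>m\<in>cube L. indicator (D L) (T m x)) \<partial>M) \<le> (\<integral>\<^sup>+x. 2 ^ CARD('d) * (\<Sum>u\<in>cube (2 * L). f (T u x)) \<partial>M)"
      by (intro nn_integral_mono pw)
    then have "c * (of_nat ?n * emeasure M (D L)) \<le> 2 ^ CARD('d) * (of_nat ((2 * (2 * L) + 1) ^ CARD('d)) * (\<integral>\<^sup>+x. f x \<partial>M))"
      by (simp add: nn_integral_cmult nn_integral_sum nn_integral_T card_cube)
    also have "\<dots> \<le> 2 ^ CARD('d) * (of_nat (2 ^ CARD('d) * ?n) * (\<integral>\<^sup>+x. f x \<partial>M))"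
    proof (intro mult_left_mono mult_right_mono of_nat_mono)
      have "(2 * (2 * L) + 1) ^ CARD('d) \<le> (2 * (2 * L + 1)) ^ CARD('d)" by (intro power_mono) auto
      then show "(2 * (2 * L) + 1) ^ CARD('d) \<le> 2 ^ CARD('d) * (2 * L + 1) ^ CARD('d)" by (simp only: power_mult_distrib)
    qed auto
    also have "\<dots> = of_nat ?n * (4 ^ CARD('d) * (\<integral>\<^sup>+x. f x \<partial>M))"
    proof -
      have "(4::ennreal) ^ CARD('d) = 2 ^ CARD('d) * 2 ^ CARD('d)" by (simp add: power_mult_distrib[symmetric])
      then show ?thesis by (simp add: mult_ac)
    qed
    finally have *: "of_nat ?n * (c * emeasure M (D L)) \<le> of_nat ?n * (4 ^ CARD('d) * (\<integral>\<^sup>+x. f x \<partial>M))"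
      by (simp add: mult_ac)
    have "0 < (of_nat ?n :: ennreal)" "(of_nat ?n :: ennreal) < \<top>"
      by (simp_all add: of_nat_less_top del: of_nat_power of_nat_add of_nat_mult)
    with * show ?thesis by (subst (asm) ennreal_mult_le_mult_iff) auto
  qed
  have "{x \<in> space M. \<exists>r. c * of_nat ((2 * r + 1) ^ CARD('d)) \<le> (\<Sum>u\<in>cube r. f (T u x))} = (\<Union>L. D L)"
    unfolding D_def by auto
  moreover have "(SUP L. emeasure M (D L)) = emeasure M (\<Union>L. D L)"
    by (rule SUP_emeasure_incseq) (auto simp: incseq_def D_def intro: order_trans simp del: of_nat_power of_nat_add of_nat_mult)
  ultimately have "c * emeasure M {x \<in> space M. \<exists>r. c * of_nat ((2 * r + 1) ^ CARD('d)) \<le> (\<Sum>u\<in>cube r. f (T u x))}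
      = (SUP L. c * emeasure M (D L))"
    by (simp only: SUP_mult_left_ennreal[symmetric])
  also have "\<dots> \<le> 4 ^ CARD('d) * (\<integral>\<^sup>+x. f x \<partial>M)" by (intro SUP_least bound)
  finally show ?thesis .
qed

end

text \<open>Fails for \<open>d = 1\<close>, where weak type does not give integrability.\<close>
lemma nn_integral_weak_type_le:
  fixes Z :: "'a \<Rightarrow> ennreal"
  assumes "prob_space M" and Z [measurable]: "Z \<in> borel_measurable M" and fin: "\<And>x. Z x < \<top>" and "\<tau> > 0" "d \<ge> 2"
    and weak: "\<And>t. t > 0 \<Longrightarrow> ennreal (t ^ d) * emeasure M {x \<in> space M. Z x > ennreal t} \<le> ennreal (\<tau> ^ d)"
  shows "(\<integral>\<^sup>+x. Z x \<partial>M) \<le> ennreal (5 * \<tau>)"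
proof -
  interpret prob_space M by fact
  define A where "A = (\<lambda>i::nat. {x \<in> space M. Z x > ennreal (2 ^ i * \<tau>)})"
  have [measurable]: "A i \<in> sets M" for i unfolding A_def by measurable
  have pw: "Z x \<le> ennreal \<tau> + (\<Sum>i. ennreal (2 * 2 ^ i * \<tau>) * indicator (A i) x)" if x: "x \<in> space M" for x
  proof -
    obtain z where z: "Z x = ennreal z" "z \<ge> 0" using fin[of x] by (cases "Z x") auto
    show ?thesis
    proof (cases "z \<le> \<tau>")
      case True
      then show ?thesis unfolding z by (intro add_increasing2) (auto simp: ennreal_leI)
    next
      case False
      define n where "n = (LEAST n. z \<le> 2 ^ n * \<tau>)"
      obtain n0 where "z / \<tau> < 2 ^ n0" using real_arch_pow[of 2] by auto
      then have "z \<le> 2 ^ n0 * \<tau>" using \<open>\<tau> > 0\<close> by (simp add: field_simps)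
      then have n: "z \<le> 2 ^ n * \<tau>" unfolding n_def by (rule LeastI)
      with False have "n \<noteq> 0" by (cases n) auto
      then obtain k where k: "n = Suc k" by (cases n) auto
      then have "\<not> z \<le> 2 ^ k * \<tau>" using not_less_Least[of k "\<lambda>n. z \<le> 2 ^ n * \<tau>"] unfolding n_def by simp
      then have "x \<in> A k" using x \<open>\<tau> > 0\<close> by (auto simp: A_def z ennreal_less_iff)
      then have "Z x \<le> ennreal (2 * 2 ^ k * \<tau>) * indicator (A k) x"
        using n k by (auto simp: z intro!: ennreal_leI)
      also have "\<dots> \<le> (\<Sum>i. ennreal (2 * 2 ^ i * \<tau>) * indicator (A i) x)"
        using sum_le_suminf[of "\<lambda>i. ennreal (2 * 2 ^ i * \<tau>) * indicator (A i) x" "{k}"]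
        by (simp add: sum.insert_if del: mult_eq_0_iff sum_mult_indicator)
      finally show ?thesis by (intro add_increasing) auto
    qed
  qed
  \<comment> \<open>At height \<open>2 ^ i * \<tau>\<close> the weak-type bound gives measure at
    most 2^(-id), hence at most 4^(-i). The layers then sum to 4 \<tau>, and the part below \<tau>
    makes it 5 \<tau>.\<close>
  have term_le: "ennreal (2 * 2 ^ i * \<tau>) * emeasure M (A i) \<le> ennreal (2 * \<tau> * (1 / 2) ^ i)" for i
  proof -
    have "ennreal ((2 ^ i * \<tau>) ^ d) * emeasure M (A i) \<le> ennreal (\<tau> ^ d)"
      unfolding A_def using \<open>\<tau> > 0\<close> by (intro weak) auto
    then have "(2 ^ i * \<tau>) ^ d * measure M (A i) \<le> \<tau> ^ d"
      using \<open>\<tau> > 0\<close> by (simp add: emeasure_eq_measure ennreal_mult[symmetric])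
    then have "(2 ^ i) ^ d * measure M (A i) \<le> 1"
      using \<open>\<tau> > 0\<close> by (simp add: power_mult_distrib mult.assoc mult_le_cancel_left1 mult.left_commute)
    moreover have "((2::real) ^ i) ^ 2 * measure M (A i) \<le> (2 ^ i) ^ d * measure M (A i)"
      using \<open>d \<ge> 2\<close> by (intro mult_right_mono power_increasing) auto
    ultimately have "2 ^ i * (2 ^ i * measure M (A i)) \<le> 1" by (simp add: power2_eq_square mult.assoc)
    then have "2 ^ i * measure M (A i) \<le> (1 / 2) ^ i" by (simp add: power_divide field_simps)
    then have "2 * \<tau> * (2 ^ i * measure M (A i)) \<le> 2 * \<tau> * (1 / 2) ^ i" using \<open>\<tau> > 0\<close> by (intro mult_left_mono) auto
    then show ?thesis using \<open>\<tau> > 0\<close> by (simp add: emeasure_eq_measure ennreal_mult[symmetric] mult_ac ennreal_leI)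
  qed
  have "(\<integral>\<^sup>+x. Z x \<partial>M) \<le> (\<integral>\<^sup>+x. ennreal \<tau> + (\<Sum>i. ennreal (2 * 2 ^ i * \<tau>) * indicator (A i) x) \<partial>M)"
    by (intro nn_integral_mono pw)
  also have "\<dots> = ennreal \<tau> + (\<Sum>i. ennreal (2 * 2 ^ i * \<tau>) * emeasure M (A i))"
    by (simp add: nn_integral_add nn_integral_suminf nn_integral_cmult_indicator emeasure_space_1)
  also have "\<dots> \<le> ennreal \<tau> + (\<Sum>i. ennreal (2 * \<tau> * (1 / 2) ^ i))"
    by (intro add_left_mono suminf_le term_le) auto
  also have "(\<Sum>i. ennreal (2 * \<tau> * (1 / 2) ^ i)) = ennreal (2 * \<tau> * 2)"
    using \<open>\<tau> > 0\<close> geometric_sums[of "1/2::real"] by (intro suminf_ennreal_eq sums_mult) auto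
  also have "ennreal \<tau> + \<dots> = ennreal (5 * \<tau>)" using \<open>\<tau> > 0\<close> by (simp flip: ennreal_plus)
  finally show ?thesis .
qed

section \<open>Dyadic levels of functions in a Lorentz space\<close>

lemma suminf_pow2_le: "y \<ge> 0 \<Longrightarrow> (\<Sum>i. ennreal (2 ^ i * of_bool (2 ^ i \<le> y))) \<le> ennreal (2 * y)" for y :: real
proof -
  assume y: "y \<ge> 0"
  define n where "n = (LEAST n. y < 2 ^ n)"
  have n: "y < 2 ^ n" unfolding n_def by (rule LeastI_ex) (simp add: real_arch_pow)
  have n': "2 ^ n \<le> 2 * y + 1"
  proof (cases n)
    case (Suc k)
    then have "\<not> y < 2 ^ k" using not_less_Least[of k "\<lambda>n. y < 2 ^ n"] unfolding n_def by simp
    then show ?thesis using Suc by simp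
  qed (use y in auto)
  have "(\<Sum>i. ennreal (2 ^ i * of_bool (2 ^ i \<le> y))) = (\<Sum>i<n. ennreal (2 ^ i * of_bool (2 ^ i \<le> y)))"
  proof (rule suminf_finite)
    fix i assume "i \<notin> {..<n}"
    then have "(2::real) ^ n \<le> 2 ^ i" by (intro power_increasing) auto
    with n have "\<not> 2 ^ i \<le> y" by linarith
    then show "ennreal (2 ^ i * of_bool (2 ^ i \<le> y)) = 0" by simp
  qed simp
  also have "\<dots> \<le> (\<Sum>i<n. ennreal (2 ^ i))" by (intro sum_mono ennreal_leI) auto
  also have "\<dots> = ennreal (2 ^ n - 1)"
    using sum_pow2_ivl[of 0 n] by (simp add: sum_ennreal atLeast0LessThan)
  also have "\<dots> \<le> ennreal (2 * y)" using n' by (intro ennreal_leI) auto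
  finally show ?thesis .
qed

lemma decr_rearr_ge:
  assumes "finite_measure M" "f \<in> borel_measurable M" "t \<ge> 0" "t < measure M {x \<in> space M. \<bar>f x\<bar> > s}"
  shows "ennreal s \<le> decr_rearr M f t"
  unfolding decr_rearr_def
proof (rule Inf_greatest)
  interpret finite_measure M by fact
  note [measurable] = assms(2)
  fix y assume "y \<in> {ennreal s' | s'. s' > 0 \<and> distr_fun M f s' \<le> ennreal t}"
  then obtain s' where s': "y = ennreal s'" "s' > 0" "distr_fun M f s' \<le> ennreal t" by auto
  have "s \<le> s'"
  proof (rule ccontr)
    assume "\<not> s \<le> s'"
    then have "emeasure M {x \<in> space M. \<bar>f x\<bar> > s} \<le> emeasure M {x \<in> space M. \<bar>f x\<bar> > s'}"
      by (intro emeasure_mono) auto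
    also have "\<dots> \<le> ennreal t" using s'(3) unfolding distr_fun_def .
    finally show False using assms(3,4) by (simp add: emeasure_eq_measure)
  qed
  then show "ennreal s \<le> y" unfolding s' by (rule ennreal_leI)
qed

text \<open>On \<open>{0<..<\<mu> i}\<close> the rearrangement is at least
  \<open>\<kappa> * 2 ^ i\<close>, so up to \<open>\<kappa> / 2\<close> the Lorentz integrand
  dominates a sum over levels; by Tonelli each level can be integrated separately, giving at least
  \<open>\<mu> i powr (1 / p)\<close>. The free factor \<open>\<kappa>\<close> pays for splitting a
  sum of functions into its terms.\<close>

lemma lorentz_levels_summable:
  assumes "prob_space M" and f: "f \<in> lorentz_space p 1 M" and p: "p \<ge> 1" and \<kappa>: "\<kappa> > 0"
  shows "(\<Sum>i. ennreal (2 ^ i * measure M {x \<in> space M. \<bar>f x\<bar> > \<kappa> * 2 ^ i} powr (1 / p))) < \<top>"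
proof -
  interpret prob_space M by fact
  have [measurable]: "f \<in> borel_measurable M" and fin: "lorentz_integral p 1 M f < \<top>"
    using f unfolding lorentz_space_def by auto
  define \<mu> where "\<mu> = (\<lambda>i::nat. measure M {x \<in> space M. \<bar>f x\<bar> > \<kappa> * 2 ^ i})"
  have \<mu>: "\<mu> i \<ge> 0" for i by (simp add: \<mu>_def)
  define F where "F = (\<lambda>t. if decr_rearr M f t = \<top> then \<top>
         else ennreal ((t powr (1/p) * enn2real (decr_rearr M f t)) powr 1 / t))"
  \<comment> \<open>The factor \<open>\<kappa> / 2\<close> cancels the constant of
    \<open>suminf_pow2_le\<close> taken at \<open>s / \<kappa>\<close>.\<close>
  define G where "G = (\<lambda>t. ennreal (\<kappa> / 2) * (\<Sum>i. ennreal (2 ^ i) * (ennreal (t powr (1 / p - 1)) * indicator {0<..<\<mu> i} t)))"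
  have GF: "G t \<le> F t * indicator {0<..} t" for t
  proof (cases "t > 0 \<and> decr_rearr M f t \<noteq> \<top>")
    case True
    define s where "s = enn2real (decr_rearr M f t)"
    have s: "decr_rearr M f t = ennreal s" "s \<ge> 0"
      using True by (auto simp: s_def less_top)
    have "ennreal (2 ^ i) * (ennreal (t powr (1 / p - 1)) * indicator {0<..<\<mu> i} t) \<le>
        ennreal (t powr (1 / p - 1)) * ennreal (2 ^ i * of_bool (2 ^ i \<le> s / \<kappa>))" for i
    proof (cases "t < \<mu> i")
      case True
      then have "ennreal (\<kappa> * 2 ^ i) \<le> ennreal s"
        unfolding s(1)[symmetric] using \<open>t > 0 \<and> _\<close>
        by (intro decr_rearr_ge) (auto simp: \<mu>_def finite_measure_axioms)
      then have "2 ^ i \<le> s / \<kappa>" using s \<kappa> by (simp add: field_simps)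
      then show ?thesis using True \<open>t > 0 \<and> _\<close> by (simp add: mult.commute)
    qed auto
    then have "G t \<le> ennreal (\<kappa> / 2) * (\<Sum>i. ennreal (t powr (1 / p - 1)) * ennreal (2 ^ i * of_bool (2 ^ i \<le> s / \<kappa>)))"
      unfolding G_def by (intro mult_left_mono suminf_le) auto
    also have "\<dots> = ennreal (\<kappa> / 2) * (ennreal (t powr (1 / p - 1)) * (\<Sum>i. ennreal (2 ^ i * of_bool (2 ^ i \<le> s / \<kappa>))))"
      by (simp only: ennreal_suminf_cmult)
    also have "\<dots> \<le> ennreal (\<kappa> / 2) * (ennreal (t powr (1 / p - 1)) * ennreal (2 * (s / \<kappa>)))"
      using s \<kappa> by (intro mult_left_mono suminf_pow2_le) auto
    also have "\<dots> = ennreal (t powr (1 / p - 1) * s)"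
      using s \<kappa> by (simp add: ennreal_mult[symmetric])
    also have "t powr (1 / p - 1) * s = (t powr (1/p) * s) powr 1 / t"
      using True s by (simp add: powr_diff)
    also have "ennreal \<dots> = F t * indicator {0<..} t"
      using True by (simp add: F_def s_def)
    finally show ?thesis .
  next
    case False
    then show ?thesis by (cases "t > 0") (auto simp: F_def G_def)
  qed
  \<comment> \<open>Since \<open>p \<ge> 1\<close> the integrand is nonincreasing, and its value at
    the right end already gives this; the exact integral is p times as large.\<close>
  have int_ge: "ennreal (\<mu> i powr (1 / p)) \<le> (\<integral>\<^sup>+t. ennreal (t powr (1 / p - 1)) * indicator {0<..<\<mu> i} t \<partial>lborel)" for i
  proof (cases "\<mu> i = 0")
    case False
    then have pos: "\<mu> i > 0" using \<mu>[of i] by simp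
    have "ennreal (\<mu> i powr (1 / p)) = ennreal (\<mu> i powr (1 / p - 1)) * ennreal (\<mu> i)"
      using pos by (simp add: ennreal_mult[symmetric] powr_diff)
    also have "\<dots> = (\<integral>\<^sup>+t. ennreal (\<mu> i powr (1 / p - 1)) * indicator {0<..<\<mu> i} t \<partial>lborel)"
      using pos by (simp add: nn_integral_cmult_indicator)
    also have "\<dots> \<le> (\<integral>\<^sup>+t. ennreal (t powr (1 / p - 1)) * indicator {0<..<\<mu> i} t \<partial>lborel)"
    proof (intro nn_integral_mono)
      fix t
      show "ennreal (\<mu> i powr (1 / p - 1)) * indicator {0<..<\<mu> i} t \<le> ennreal (t powr (1 / p - 1)) * indicator {0<..<\<mu> i} t"
        using p by (auto simp: indicator_def intro!: ennreal_leI powr_mono2')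
    qed
    finally show ?thesis .
  qed simp
  have "ennreal (\<kappa> / 2) * (\<Sum>i. ennreal (2 ^ i * \<mu> i powr (1 / p))) \<le>
      ennreal (\<kappa> / 2) * (\<Sum>i. ennreal (2 ^ i) * (\<integral>\<^sup>+t. ennreal (t powr (1 / p - 1)) * indicator {0<..<\<mu> i} t \<partial>lborel))"
    by (intro mult_left_mono suminf_le) (auto simp: ennreal_mult intro!: mult_left_mono int_ge)
  also have "\<dots> = (\<integral>\<^sup>+t. G t \<partial>lborel)"
    unfolding G_def by (simp add: nn_integral_cmult nn_integral_suminf)
  also have "\<dots> \<le> (\<integral>\<^sup>+t. F t * indicator {0<..} t \<partial>lborel)"
    by (intro nn_integral_mono GF)
  also have "\<dots> < \<top>"
    using fin unfolding lorentz_integral_def F_def .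
  finally show ?thesis
    using \<kappa> unfolding \<mu>_def by (auto simp: ennreal_mult_less_top)
qed

section \<open>Equicontinuity at infinity\<close>

lemma power_powr_inverse: "0 < x \<Longrightarrow> 0 < n \<Longrightarrow> (x ^ n) powr (1 / real n) = (x :: real)"
  by (simp add: powr_powr flip: powr_realpow)

lemma ennreal_mult_cube_card:
  assumes "c \<ge> 0"
  shows "ennreal c * of_nat ((2 * 2 ^ J + 1) ^ n) = ennreal (c * (2 * 2 ^ J + 1) ^ n)"
proof -
  have "real ((2 * 2 ^ J + 1) ^ n) = (2 * 2 ^ J + 1) ^ n" by (simp add: add.commute)
  then show ?thesis
    unfolding ennreal_of_nat_eq_real_of_nat using assms by (simp only: ennreal_mult of_nat_0_le_iff)
qed

locale stationary_semimetric = lattice_action M T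
  for M :: "'a measure" and T :: "int ^ 'd \<Rightarrow> 'a \<Rightarrow> 'a" +
  fixes \<rho> :: "'a \<Rightarrow> int ^ 'd \<Rightarrow> int ^ 'd \<Rightarrow> real"
  assumes semimetric: "x \<in> space M \<Longrightarrow> lattice_semimetric (\<rho> x)"
    and \<rho>_measurable [measurable]: "(\<lambda>x. \<rho> x m n) \<in> borel_measurable M"
    and \<rho>_T: "x \<in> space M \<Longrightarrow> \<rho> (T k x) m n = \<rho> x (m + k) (n + k)"
    and lorentz: "(\<lambda>x. \<rho> x 0 n) \<in> lorentz_space (real CARD('d)) 1 M"
begin

text \<open>The edge weight seen from the origin: at \<open>T m x\<close> it equals
  \<open>step m\<close> for \<open>\<rho> x\<close>, which turns level counts into orbit sums of
  indicators.\<close>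

definition speed :: "'a \<Rightarrow> real" where
  "speed x = (\<Sum>i\<in>UNIV. \<rho> x 0 (axis i 1))"

definition level_set :: "nat \<Rightarrow> 'a set" where
  "level_set i = {x \<in> space M. speed x > 2 ^ i}"

lemma speed_measurable [measurable]: "speed \<in> borel_measurable M"
  unfolding speed_def by measurable

lemma level_set_measurable [measurable]: "level_set i \<in> sets M"
  unfolding level_set_def by measurable

lemma \<rho>_nonneg: "x \<in> space M \<Longrightarrow> \<rho> x m n \<ge> 0"
  using semimetric by (rule lattice_semimetric.nonneg)

lemma sum_indicator_level_set:
  assumes x: "x \<in> space M"
  shows "(\<Sum>m\<in>cube (2 ^ J). indicator (level_set i) (T m x)) = (of_nat (lattice_semimetric.level_count (\<rho> x) i J) :: ennreal)"
proof -
  interpret lattice_semimetric "\<rho> x" using x by (rule semimetric)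
  have "speed (T m x) = step m" for m
    using x by (simp add: speed_def step_def \<rho>_T add.commute)
  then show ?thesis
    using x by (simp add: level_count_def level_set_def indicator_def sum.If_cases Int_def)
qed

text \<open>A sum of d weights exceeds \<open>2 ^ i\<close> only if one of them exceeds
  \<open>2 ^ i / d\<close>, so the Lorentz condition for the unit vectors, taken with
  \<open>\<kappa> = 1 / d\<close>, passes to \<open>speed\<close>.\<close>

lemma levels_summable:
  "(\<Sum>i. ennreal (2 ^ i * measure M (level_set i) powr (1 / CARD('d)))) < \<top>"
proof -
  let ?d = "real CARD('d)"
  have d: "?d \<ge> 1" using zero_less_card_finite[where 'a='d] by linarith
  define A where "A = (\<lambda>(j::'d) i. {x \<in> space M. \<bar>\<rho> x 0 (axis j 1)\<bar> > 1 / ?d * 2 ^ i})"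
  have [measurable]: "A j i \<in> sets M" for j i unfolding A_def by measurable
  have le: "measure M (level_set i) powr (1 / ?d) \<le> ?d * (\<Sum>j\<in>UNIV. measure M (A j i) powr (1 / ?d))" for i
  proof -
    define s where "s = (\<Sum>j\<in>UNIV. measure M (A j i) powr (1 / ?d))"
    have s: "s \<ge> 0" unfolding s_def by (intro sum_nonneg) auto
    have "level_set i \<subseteq> (\<Union>j\<in>UNIV. A j i)"
    proof
      fix x assume x: "x \<in> level_set i"
      show "x \<in> (\<Union>j\<in>UNIV. A j i)"
      proof (rule ccontr)
        assume "x \<notin> (\<Union>j\<in>UNIV. A j i)"
        then have "\<rho> x 0 (axis j 1) \<le> 1 / ?d * 2 ^ i" for j
          using x by (auto simp: A_def level_set_def not_less intro: order_trans[OF abs_ge_self])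
        then have "speed x \<le> (\<Sum>j\<in>(UNIV::'d set). 1 / ?d * 2 ^ i)"
          unfolding speed_def by (intro sum_mono)
        also have "\<dots> = 2 ^ i" by simp
        finally show False using x by (simp add: level_set_def)
      qed
    qed
    then have "measure M (level_set i) \<le> measure M (\<Union>j\<in>UNIV. A j i)"
      by (intro finite_measure_mono) auto
    also have "\<dots> \<le> (\<Sum>j\<in>UNIV. measure M (A j i))"
      by (intro finite_measure_subadditive_finite) auto
    \<comment> \<open>Each measure is at most \<open>s powr ?d\<close>; the number of terms is then
      absorbed through \<open>?d \<le> ?d powr ?d\<close>, which leaves a pure power whose root can
      be taken.\<close>
    also have "\<dots> \<le> (\<Sum>j\<in>(UNIV::'d set). s powr ?d)"
    proof (rule sum_mono)
      fix j :: 'd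
      have "measure M (A j i) powr (1 / ?d) \<le> s"
        unfolding s_def by (rule member_le_sum) auto
      then have "(measure M (A j i) powr (1 / ?d)) powr ?d \<le> s powr ?d"
        using d by (intro powr_mono2) auto
      then show "measure M (A j i) \<le> s powr ?d"
        using d by (cases "measure M (A j i) = 0") (auto simp: powr_powr)
    qed
    also have "\<dots> = ?d powr 1 * s powr ?d" by simp
    also have "\<dots> \<le> ?d powr ?d * s powr ?d"
      using d by (intro mult_right_mono powr_mono) auto
    also have "\<dots> = (?d * s) powr ?d" using d s by (simp add: powr_mult)
    finally have "measure M (level_set i) powr (1 / ?d) \<le> ((?d * s) powr ?d) powr (1 / ?d)"
      using d by (intro powr_mono2) auto
    also have "\<dots> = ?d * s" using d s by (simp add: powr_powr)
    finally show ?thesis unfolding s_def .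
  qed
  have "(\<Sum>i. ennreal (2 ^ i * measure M (level_set i) powr (1 / ?d))) \<le>
      (\<Sum>i. ennreal ?d * (\<Sum>j\<in>UNIV. ennreal (2 ^ i * measure M (A j i) powr (1 / ?d))))"
  proof (intro suminf_le)
    fix i
    have "2 ^ i * measure M (level_set i) powr (1 / ?d) \<le> 2 ^ i * (?d * (\<Sum>j\<in>UNIV. measure M (A j i) powr (1 / ?d)))"
      using le by (intro mult_left_mono) auto
    also have "\<dots> = ?d * (\<Sum>j\<in>UNIV. 2 ^ i * measure M (A j i) powr (1 / ?d))"
      by (simp add: sum_distrib_left mult_ac)
    finally show "ennreal (2 ^ i * measure M (level_set i) powr (1 / ?d)) \<le>
        ennreal ?d * (\<Sum>j\<in>UNIV. ennreal (2 ^ i * measure M (A j i) powr (1 / ?d)))"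
      by (simp add: sum_nonneg ennreal_leI flip: ennreal_mult)
  qed auto
  also have "\<dots> = ennreal ?d * (\<Sum>j\<in>UNIV. (\<Sum>i. ennreal (2 ^ i * measure M (A j i) powr (1 / ?d))))"
    by (simp only: ennreal_suminf_cmult suminf_sum[OF summableI])
  also have "\<dots> < \<top>"
  proof -
    have s: "(\<Sum>i. ennreal (2 ^ i * measure M (A j i) powr (1 / ?d))) < \<top>" for j
      unfolding A_def using d by (intro lorentz_levels_summable lorentz) (auto simp: prob_space_axioms)
    have *: "ennreal ?d * (\<Sum>j\<in>UNIV. X j) < \<top>" if "\<And>j. X j < \<top>" for X :: "'d \<Rightarrow> ennreal"
      using that by (simp add: ennreal_mult_less_top)
    show ?thesis by (rule *) (rule s)
  qed
  finally show ?thesis .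
qed

text \<open>A probability is at most its d-th root, so the dyadic Lorentz sum dominates the one that
  bounds the integral of \<open>\<rho> x 0 n\<close>; stationarity covers the other pairs.\<close>

lemma integrable_\<rho>: "integrable M (\<lambda>x. \<rho> x m n)"
proof -
  have 0: "integrable M (\<lambda>x. \<rho> x 0 n)" for n
  proof (rule integrableI_bounded)
    define A where "A = (\<lambda>i. {x \<in> space M. \<bar>\<rho> x 0 n\<bar> > 1 * 2 ^ i})"
    have [measurable]: "A i \<in> sets M" for i unfolding A_def by measurable
    have pw: "ennreal (norm (\<rho> x 0 n)) \<le> 1 + (\<Sum>i. ennreal (2 ^ i) * indicator (A i) x)" if x: "x \<in> space M" for x
    proof -
      obtain I where I: "\<rho> x 0 n < 2 ^ I" using real_arch_pow[of 2] by auto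
      then have "\<rho> x 0 n \<le> 2 ^ 0 + (\<Sum>i\<in>{0..<I}. 2 ^ i * of_bool (\<rho> x 0 n > 2 ^ i))"
        by (intro dyadic_layer_le) auto
      then have "ennreal (norm (\<rho> x 0 n)) \<le> ennreal (2 ^ 0 + (\<Sum>i\<in>{0..<I}. 2 ^ i * of_bool (\<rho> x 0 n > 2 ^ i)))"
        using \<rho>_nonneg[OF x] by (intro ennreal_leI) auto
      also have "\<dots> = 1 + (\<Sum>i\<in>{0..<I}. ennreal (2 ^ i * of_bool (\<rho> x 0 n > 2 ^ i)))"
        by (simp add: sum_nonneg)
      also have "(\<Sum>i\<in>{0..<I}. ennreal (2 ^ i * of_bool (\<rho> x 0 n > 2 ^ i))) = (\<Sum>i\<in>{0..<I}. ennreal (2 ^ i) * indicator (A i) x)"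
        using x \<rho>_nonneg[OF x] by (intro sum.cong) (auto simp: A_def indicator_def)
      also have "\<dots> \<le> (\<Sum>i. ennreal (2 ^ i) * indicator (A i) x)"
        by (intro sum_le_suminf) auto
      finally show ?thesis by (simp add: add_left_mono)
    qed
    have "(\<integral>\<^sup>+x. ennreal (norm (\<rho> x 0 n)) \<partial>M) \<le> (\<integral>\<^sup>+x. 1 + (\<Sum>i. ennreal (2 ^ i) * indicator (A i) x) \<partial>M)"
      by (intro nn_integral_mono pw)
    also have "\<dots> = 1 + (\<Sum>i. ennreal (2 ^ i) * emeasure M (A i))"
      by (simp add: nn_integral_add nn_integral_suminf nn_integral_cmult_indicator emeasure_space_1)
    also have "\<dots> \<le> 1 + (\<Sum>i. ennreal (2 ^ i * measure M (A i) powr (1 / CARD('d))))"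
    proof (intro add_left_mono suminf_le)
      fix i
      have "measure M (A i) powr 1 \<le> measure M (A i) powr (1 / CARD('d))"
        by (intro powr_mono') auto
      then show "ennreal (2 ^ i) * emeasure M (A i) \<le> ennreal (2 ^ i * measure M (A i) powr (1 / CARD('d)))"
        by (simp add: emeasure_eq_measure ennreal_leI flip: ennreal_mult)
    qed auto
    also have "\<dots> < \<top>"
    proof -
      have d: "real CARD('d) \<ge> 1" using zero_less_card_finite[where 'a='d] by linarith
      have "(\<Sum>i. ennreal (2 ^ i * measure M (A i) powr (1 / CARD('d)))) < \<top>"
        unfolding A_def using d by (intro lorentz_levels_summable lorentz) (auto simp: prob_space_axioms)
      then show ?thesis by simp
    qed
    finally show "(\<integral>\<^sup>+x. ennreal (norm (\<rho> x 0 n)) \<partial>M) < \<infinity>" by simp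
  qed simp
  have "integrable (distr M M (T m)) (\<lambda>x. \<rho> x 0 (n - m))" unfolding distr_T by (rule 0)
  then have "integrable M (\<lambda>x. \<rho> (T m x) 0 (n - m))" by (subst (asm) integrable_distr_eq) auto
  then show ?thesis by (rule Bochner_Integration.integrable_cong[THEN iffD1, rotated -1]) (auto simp: \<rho>_T)
qed

text \<open>With exponent 1 the sum over levels is bounded by a single orbit sum, that of
  \<open>b i0\<close>. Its mean tends to 0 as \<open>i0\<close> grows, and the maximal inequality
  bounds the measure of \<open>N i0 c\<close> by \<open>4 / c\<close> times this mean, so the
  intersection over \<open>i0\<close> is null.\<close>

lemma AE_small_tails_line:
  assumes d1: "CARD('d) = 1"
  shows "AE x in M. lattice_semimetric.small_tails (\<rho> x)"
proof -
  have fin: "(\<Sum>i. ennreal (2 ^ i * measure M (level_set i))) < \<top>"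
    using levels_summable by (simp add: d1)
  define b where "b = (\<lambda>i0 x. \<Sum>i. ennreal (2 ^ (i + i0)) * indicator (level_set (i + i0)) x)"
  have [measurable]: "b i0 \<in> borel_measurable M" for i0 unfolding b_def by measurable
  have b_int: "(\<integral>\<^sup>+x. b i0 x \<partial>M) = (\<Sum>i. ennreal (2 ^ (i + i0) * measure M (level_set (i + i0))))" for i0
    unfolding b_def by (simp add: nn_integral_suminf nn_integral_cmult_indicator emeasure_eq_measure ennreal_mult)
  have b_lim: "(\<lambda>i0. \<integral>\<^sup>+x. b i0 x \<partial>M) \<longlonglongrightarrow> 0"
  proof -
    have s: "summable (\<lambda>i. 2 ^ i * measure M (level_set i))"
      using fin by (intro summable_suminf_not_top) auto
    have "(\<integral>\<^sup>+x. b i0 x \<partial>M) = ennreal (\<Sum>i. 2 ^ (i + i0) * measure M (level_set (i + i0)))" for i0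
      unfolding b_int using s summable_ignore_initial_segment[OF s, of i0] by (intro suminf_ennreal2) auto
    moreover have "(\<lambda>i0. \<Sum>i. 2 ^ (i + i0) * measure M (level_set (i + i0))) \<longlonglongrightarrow> 0"
      using suminf_exist_split2[OF s] by simp
    ultimately show ?thesis using tendsto_ennrealI by fastforce
  qed
  define N where "N = (\<lambda>i0 c. {x \<in> space M. \<exists>r. ennreal c * of_nat ((2 * r + 1) ^ CARD('d)) \<le> (\<Sum>u\<in>cube r. b i0 (T u x))})"
  have [measurable]: "N i0 c \<in> sets M" for i0 c unfolding N_def by measurable
  have null: "AE x in M. \<exists>i0. x \<notin> N i0 c" if c: "c > 0" for c
  proof -
    have "emeasure M (\<Inter>i0. N i0 c) \<le> 0"
    proof (rule LIMSEQ_le_const)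
      have "(\<lambda>i0. ennreal (4 / c) * (\<integral>\<^sup>+x. b i0 x \<partial>M)) \<longlonglongrightarrow> ennreal (4 / c) * 0"
        by (intro ennreal_tendsto_cmult b_lim) auto
      then show "(\<lambda>i0. ennreal (4 / c) * (\<integral>\<^sup>+x. b i0 x \<partial>M)) \<longlonglongrightarrow> 0" by simp
      have "emeasure M (\<Inter>i0. N i0 c) \<le> ennreal (4 / c) * (\<integral>\<^sup>+x. b i0 x \<partial>M)" for i0
      proof -
        have "emeasure M (\<Inter>i0. N i0 c) \<le> emeasure M (N i0 c)" by (intro emeasure_mono) auto
        also have "\<dots> = ennreal (1 / c) * (ennreal c * emeasure M (N i0 c))"
          using c by (simp add: mult.assoc[symmetric] flip: ennreal_mult)
        also have "\<dots> \<le> ennreal (1 / c) * (4 ^ CARD('d) * (\<integral>\<^sup>+x. b i0 x \<partial>M))"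
          unfolding N_def by (intro mult_left_mono maximal_inequality) auto
        also have "\<dots> = ennreal (4 / c) * (\<integral>\<^sup>+x. b i0 x \<partial>M)"
        proof -
          have "ennreal (1 / c) * 4 = ennreal (4 / c)"
            using c ennreal_mult[of "1 / c" 4] by simp
          then show ?thesis by (simp add: d1 mult.assoc[symmetric])
        qed
        finally show ?thesis .
      qed
      then show "\<exists>N'. \<forall>i0\<ge>N'. emeasure M (\<Inter>i0. N i0 c) \<le> ennreal (4 / c) * (\<integral>\<^sup>+x. b i0 x \<partial>M)" by blast
    qed
    then have "(\<Inter>i0. N i0 c) \<in> null_sets M" by (auto simp: null_sets_def)
    then have "AE x in M. x \<notin> (\<Inter>i0. N i0 c)" by (rule AE_not_in)
    then show ?thesis by eventually_elim auto
  qed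
  have "AE x in M. \<forall>k::nat. \<exists>i0. x \<notin> N i0 (1 / real (Suc k))"
    unfolding AE_all_countable by (intro allI null) auto
  moreover have "AE x in M. x \<in> space M" by simp
  ultimately show ?thesis
  proof eventually_elim
    case (elim x)
    then have x: "x \<in> space M" by simp
    interpret lattice_semimetric "\<rho> x" using x by (rule semimetric)
    show ?case
      unfolding small_tails_def
    proof (intro allI impI)
      fix \<epsilon> :: real assume "\<epsilon> > 0"
      \<comment> \<open>The 3 anticipates \<open>2 * 2 ^ J + 1 \<le> 3 * 2 ^ J\<close>, the passage
        from the side of the cube to its scale.\<close>
      then obtain k where k: "1 / real (Suc k) < \<epsilon> / 3" using nat_approx_posE[of "\<epsilon> / 3"] by auto
      define c where "c = 1 / real (Suc k)"
      have c: "c > 0" "3 * c \<le> \<epsilon>" using k by (auto simp: c_def)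
      obtain i0 where i0: "x \<notin> N i0 c" using elim unfolding c_def by blast
      have "(\<Sum>i\<in>{i0..<I}. 2 ^ i * real (level_count i J) powr (1 / CARD('d))) \<le> \<epsilon> * 2 ^ J" for I J
      proof -
        have "ennreal (\<Sum>i\<in>{i0..<I}. 2 ^ i * real (level_count i J)) = (\<Sum>i\<in>{i0..<I}. ennreal (2 ^ i) * of_nat (level_count i J))"
          by (simp add: ennreal_mult ennreal_of_nat_eq_real_of_nat flip: sum_ennreal)
        also have "\<dots> = (\<Sum>m\<in>cube (2 ^ J). \<Sum>i\<in>{i0..<I}. ennreal (2 ^ i) * indicator (level_set i) (T m x))"
          unfolding sum_indicator_level_set[OF x, symmetric] sum_distrib_left by (rule sum.swap)
        also have "\<dots> \<le> (\<Sum>m\<in>cube (2 ^ J). b i0 (T m x))"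
        proof (rule sum_mono)
          fix m :: "int ^ 'd"
          have "{i0..<I} \<subseteq> (\<lambda>i. i + i0) ` {..<I}"
          proof
            fix i assume "i \<in> {i0..<I}"
            then show "i \<in> (\<lambda>i. i + i0) ` {..<I}" by (intro image_eqI[of _ _ "i - i0"]) auto
          qed
          then have "(\<Sum>i\<in>{i0..<I}. ennreal (2 ^ i) * indicator (level_set i) (T m x)) \<le>
              (\<Sum>i\<in>(\<lambda>i. i + i0) ` {..<I}. ennreal (2 ^ i) * indicator (level_set i) (T m x))"
            by (intro sum_mono2) auto
          also have "\<dots> = (\<Sum>i<I. ennreal (2 ^ (i + i0)) * indicator (level_set (i + i0)) (T m x))"
            by (subst sum.reindex) (simp_all add: inj_on_def)
          also have "\<dots> \<le> b i0 (T m x)" unfolding b_def by (intro sum_le_suminf) auto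
          finally show "(\<Sum>i\<in>{i0..<I}. ennreal (2 ^ i) * indicator (level_set i) (T m x)) \<le> b i0 (T m x)" .
        qed
        also have "\<dots> \<le> ennreal c * of_nat ((2 * 2 ^ J + 1) ^ CARD('d))"
          using i0 x unfolding N_def mem_Collect_eq not_ex not_le de_Morgan_conj by (blast intro: less_imp_le)
        also have "\<dots> = ennreal (c * (2 * 2 ^ J + 1))"
          unfolding d1 using c by (subst ennreal_mult_cube_card) auto
        finally have "(\<Sum>i\<in>{i0..<I}. 2 ^ i * real (level_count i J)) \<le> c * (2 * 2 ^ J + 1)"
          using c by (simp add: ennreal_le_iff)
        also have "\<dots> \<le> c * (3 * 2 ^ J)" using c by (intro mult_left_mono) auto
        also have "\<dots> \<le> \<epsilon> * 2 ^ J" using c mult_right_mono[of "3 * c" \<epsilon> "2 ^ J"] by (simp add: mult_ac)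
        finally show ?thesis by (simp add: d1)
      qed
      then show "\<exists>i0. \<forall>I J. (\<Sum>i\<in>{i0..<I}. 2 ^ i * real (level_count i J) powr (1 / CARD('d))) \<le> \<epsilon> * 2 ^ J"
        by blast
    qed
  qed
qed

text \<open>The d-th root of a dyadic maximal function of the indicator of the level, with
  \<open>2 ^ J\<close> in place of the d-th root of the volume. Having the supremum over
  \<open>J\<close> inside is what later lets one \<open>i0\<close> serve all cubes.\<close>

definition level_density :: "nat \<Rightarrow> 'a \<Rightarrow> ennreal" where
  "level_density i x = (SUP J. ennreal ((\<Sum>m\<in>cube (2 ^ J). indicator (level_set i) (T m x)) powr (1 / CARD('d)) / 2 ^ J))"

lemma level_density_measurable [measurable]: "level_density i \<in> borel_measurable M"
  unfolding level_density_def by measurable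

lemma level_density_le: "level_density i x \<le> 3"
  unfolding level_density_def
proof (rule SUP_least)
  fix J
  have "(\<Sum>m\<in>(cube (2 ^ J) :: (int ^ 'd) set). indicator (level_set i) (T m x)) \<le> (\<Sum>m\<in>(cube (2 ^ J) :: (int ^ 'd) set). 1 :: real)"
    by (intro sum_mono) (auto simp: indicator_def)
  also have "\<dots> = (2 * 2 ^ J + 1) ^ CARD('d)" by (simp add: card_cube add.commute)
  also have "\<dots> \<le> (3 * 2 ^ J) ^ CARD('d)" by (intro power_mono) auto
  finally have "(\<Sum>m\<in>cube (2 ^ J). indicator (level_set i) (T m x)) powr (1 / CARD('d)) \<le> (((3::real) * 2 ^ J) ^ CARD('d)) powr (1 / CARD('d))"
    by (intro powr_mono2 sum_nonneg) auto
  also have "\<dots> = 3 * 2 ^ J"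
    by (intro power_powr_inverse) auto
  finally have "(\<Sum>m\<in>cube (2 ^ J). indicator (level_set i) (T m x)) powr (1 / CARD('d)) / 2 ^ J \<le> (3::real)"
    by (simp add: field_simps)
  then show "ennreal ((\<Sum>m\<in>cube (2 ^ J). indicator (level_set i) (T m x)) powr (1 / CARD('d)) / 2 ^ J) \<le> 3"
    using ennreal_leI[of _ 3] by simp
qed

text \<open>A cube of radius \<open>2 ^ J\<close> has side at most \<open>3 * 2 ^ J\<close>, so a
  value above \<open>t\<close> forces an ordinary density of at least \<open>(t / 3) ^ d\<close>.
  The maximal inequality then gives 12^d as 3^d times 4^d.\<close>

lemma level_density_weak_type:
  assumes t: "t > 0"
  shows "t ^ CARD('d) * measure M {x \<in> space M. level_density i x > ennreal t} \<le> 12 ^ CARD('d) * measure M (level_set i)"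
proof -
  let ?d = "CARD('d)"
  define c where "c = (t / 3) ^ ?d"
  have c: "c > 0" using t by (simp add: c_def)
  define N where "N = {x \<in> space M. \<exists>r. ennreal c * of_nat ((2 * r + 1) ^ CARD('d)) \<le> (\<Sum>u\<in>cube r. indicator (level_set i) (T u x))}"
  have [measurable]: "N \<in> sets M" unfolding N_def by measurable
  have "{x \<in> space M. level_density i x > ennreal t} \<subseteq> N"
  proof
    fix x assume x: "x \<in> {x \<in> space M. level_density i x > ennreal t}"
    define s where "s = (\<lambda>J. \<Sum>m\<in>cube (2 ^ J). indicator (level_set i) (T m x) :: real)"
    have s: "s J \<ge> 0" for J unfolding s_def by (intro sum_nonneg) auto
    from x obtain J where "ennreal t < ennreal (s J powr (1 / ?d) / 2 ^ J)"
      unfolding level_density_def less_SUP_iff s_def by auto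
    then have "t < s J powr (1 / ?d) / 2 ^ J" using t by (simp add: ennreal_less_iff)
    then have "t * 2 ^ J \<le> s J powr (1 / ?d)" by (simp add: field_simps)
    moreover have "t / 3 * (2 * 2 ^ J + 1) \<le> t / 3 * (3 * 2 ^ J)" using t by (intro mult_left_mono) auto
    moreover have "t / 3 * (3 * 2 ^ J) = t * 2 ^ J" by simp
    ultimately have "t / 3 * (2 * 2 ^ J + 1) \<le> s J powr (1 / ?d)" by linarith
    then have "(t / 3 * (2 * 2 ^ J + 1)) ^ ?d \<le> (s J powr (1 / ?d)) ^ ?d"
      by (rule power_mono) (use t in auto)
    also have "\<dots> = s J"
    proof (cases "s J = 0")
      case False
      then show ?thesis using s[of J] by (simp add: powr_powr flip: powr_realpow)
    qed simp
    finally have "ennreal (c * (2 * 2 ^ J + 1) ^ ?d) \<le> ennreal (s J)"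
      unfolding c_def power_mult_distrib by (rule ennreal_leI)
    moreover have "ennreal (s J) = (\<Sum>m\<in>cube (2 ^ J). indicator (level_set i) (T m x))"
      unfolding s_def by (subst sum_ennreal[symmetric]) (auto simp: ennreal_indicator)
    moreover have "ennreal (c * (2 * 2 ^ J + 1) ^ ?d) = ennreal c * of_nat ((2 * 2 ^ J + 1) ^ ?d)"
      using c by (subst ennreal_mult_cube_card) auto
    ultimately have "ennreal c * of_nat ((2 * 2 ^ J + 1) ^ ?d) \<le> (\<Sum>m\<in>cube (2 ^ J). indicator (level_set i) (T m x))"
      by simp
    then show "x \<in> N" using x unfolding N_def by blast
  qed
  then have "measure M {x \<in> space M. level_density i x > ennreal t} \<le> measure M N"
    by (intro finite_measure_mono) auto
  then have "c * measure M {x \<in> space M. level_density i x > ennreal t} \<le> c * measure M N"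
    using c by simp
  also have "\<dots> \<le> 4 ^ ?d * measure M (level_set i)"
  proof -
    have "ennreal c * emeasure M N \<le> 4 ^ ?d * (\<integral>\<^sup>+x. indicator (level_set i) x \<partial>M)"
      unfolding N_def by (rule maximal_inequality) simp
    also have "\<dots> = ennreal (4 ^ ?d * measure M (level_set i))"
      by (simp add: emeasure_eq_measure ennreal_mult flip: ennreal_power)
    finally show ?thesis using c by (simp add: emeasure_eq_measure flip: ennreal_mult)
  qed
  finally have "3 ^ ?d * (c * measure M {x \<in> space M. level_density i x > ennreal t}) \<le> 3 ^ ?d * (4 ^ ?d * measure M (level_set i))"
    by (intro mult_left_mono) auto
  moreover have "3 ^ ?d * c = t ^ ?d" by (simp add: c_def power_divide)
  moreover have "(3::real) ^ ?d * 4 ^ ?d = 12 ^ ?d" by (simp flip: power_mult_distrib)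
  ultimately show ?thesis by (simp add: mult.assoc[symmetric])
qed

text \<open>Up to the summable error, the mean of \<open>level_density i\<close> is at most a
  constant times the d-th root of the probability of the level. Hence the series weighted by
  \<open>2 ^ i\<close> has finite mean and converges almost surely, and its Cauchy tails supply
  \<open>i0\<close> for all \<open>J\<close> simultaneously.\<close>

lemma AE_small_tails_higher:
  assumes d2: "CARD('d) \<ge> 2"
  shows "AE x in M. lattice_semimetric.small_tails (\<rho> x)"
proof -
  let ?d = "CARD('d)"
  let ?\<mu> = "\<lambda>i. measure M (level_set i) powr (1 / ?d)"
  \<comment> \<open>The term \<open>(1 / 4) ^ i\<close> keeps the constant positive on null levels and stays summable against \<open>2 ^ i\<close>.\<close>
  have int_le: "(\<integral>\<^sup>+x. level_density i x \<partial>M) \<le> ennreal (5 * (12 * ?\<mu> i + (1 / 4) ^ i))" for i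
  proof (rule nn_integral_weak_type_le[OF prob_space_axioms _ _ _ d2])
    show "level_density i x < \<top>" for x
      using level_density_le[of i x] by (simp add: le_less_trans)
    show "0 < 12 * ?\<mu> i + (1 / 4) ^ i" by (intro add_nonneg_pos) auto
    fix t :: real assume t: "t > 0"
    have "t ^ ?d * measure M {x \<in> space M. level_density i x > ennreal t} \<le> 12 ^ ?d * measure M (level_set i)"
      by (rule level_density_weak_type[OF t])
    also have "\<dots> = (12 * ?\<mu> i) ^ ?d"
    proof (cases "measure M (level_set i) = 0")
      case False
      then show ?thesis by (simp add: power_mult_distrib powr_powr zero_less_measure_iff flip: powr_realpow)
    qed simp
    also have "\<dots> \<le> (12 * ?\<mu> i + (1 / 4) ^ i) ^ ?d" by (intro power_mono) auto
    finally show "ennreal (t ^ ?d) * emeasure M {x \<in> space M. level_density i x > ennreal t} \<le> ennreal ((12 * ?\<mu> i + (1 / 4) ^ i) ^ ?d)"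
      using t by (simp add: emeasure_eq_measure ennreal_leI flip: ennreal_mult)
  qed simp
  have "(\<integral>\<^sup>+x. (\<Sum>i. ennreal (2 ^ i) * level_density i x) \<partial>M) = (\<Sum>i. ennreal (2 ^ i) * (\<integral>\<^sup>+x. level_density i x \<partial>M))"
    by (simp add: nn_integral_suminf nn_integral_cmult)
  also have "\<dots> \<le> (\<Sum>i. ennreal 60 * ennreal (2 ^ i * ?\<mu> i) + ennreal 5 * ennreal ((1 / 2) ^ i))"
  proof (intro suminf_le)
    fix i
    have "ennreal (2 ^ i) * (\<integral>\<^sup>+x. level_density i x \<partial>M) \<le> ennreal (2 ^ i) * ennreal (5 * (12 * ?\<mu> i + (1 / 4) ^ i))"
      by (intro mult_left_mono int_le) auto
    also have "\<dots> = ennreal (60 * (2 ^ i * ?\<mu> i) + 5 * (1 / 2) ^ i)"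
    proof -
      have "(2::real) ^ i * (1 / 4) ^ i = (1 / 2) ^ i" by (simp flip: power_mult_distrib)
      then have "2 ^ i * (5 * (12 * ?\<mu> i + (1 / 4) ^ i)) = 60 * (2 ^ i * ?\<mu> i) + 5 * (1 / 2) ^ i"
        by (simp add: algebra_simps)
      moreover have "ennreal (2 ^ i) * ennreal (5 * (12 * ?\<mu> i + (1 / 4) ^ i)) = ennreal (2 ^ i * (5 * (12 * ?\<mu> i + (1 / 4) ^ i)))"
        by (rule ennreal_mult[symmetric]) auto
      ultimately show ?thesis by (simp only:)
    qed
    also have "\<dots> = ennreal 60 * ennreal (2 ^ i * ?\<mu> i) + ennreal 5 * ennreal ((1 / 2) ^ i)"
      by (simp only: ennreal_mult[symmetric] ennreal_plus[symmetric] measure_nonneg mult_nonneg_nonneg zero_le_power zero_le_numeral powr_ge_zero zero_le_divide_1_iff)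
    finally show "ennreal (2 ^ i) * (\<integral>\<^sup>+x. level_density i x \<partial>M) \<le> \<dots>" .
  qed auto
  also have "\<dots> = ennreal 60 * (\<Sum>i. ennreal (2 ^ i * ?\<mu> i)) + ennreal 5 * (\<Sum>i. ennreal ((1 / 2) ^ i))"
    by (simp only: ennreal_suminf_cmult suminf_add[symmetric] summableI)
  also have "\<dots> < \<top>"
  proof -
    have "(\<Sum>i. ennreal ((1 / 2) ^ i)) = ennreal 2"
      using geometric_sums[of "1 / 2 :: real"] by (intro suminf_ennreal_eq) auto
    then show ?thesis using levels_summable by (simp add: ennreal_mult_less_top)
  qed
  finally have "(\<integral>\<^sup>+x. (\<Sum>i. ennreal (2 ^ i) * level_density i x) \<partial>M) \<noteq> \<infinity>" by simp
  then have "AE x in M. (\<Sum>i. ennreal (2 ^ i) * level_density i x) \<noteq> \<infinity>"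
    by (intro nn_integral_PInf_AE) (auto simp: infinity_ennreal_def)
  moreover have "AE x in M. x \<in> space M" by simp
  ultimately show ?thesis
  proof eventually_elim
    case (elim x)
    then have x: "x \<in> space M" by simp
    interpret lattice_semimetric "\<rho> x" using x by (rule semimetric)
    define w where "w = (\<lambda>i. 2 ^ i * enn2real (level_density i x))"
    have fin: "level_density i x < \<top>" for i
      using level_density_le[of i x] by (simp add: le_less_trans)
    then have "ennreal (2 ^ i) * level_density i x = ennreal (w i)" for i
      by (simp add: w_def ennreal_mult)
    with elim have "(\<Sum>i. ennreal (w i)) \<noteq> \<top>" by simp
    then have sw: "summable w" by (intro summable_suminf_not_top) (auto simp: w_def)
    have term_le: "2 ^ i * real (level_count i J) powr (1 / ?d) \<le> w i * 2 ^ J" for i J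
    proof -
      have "ennreal (\<Sum>m\<in>cube (2 ^ J). indicator (level_set i) (T m x)) = (\<Sum>m\<in>cube (2 ^ J). indicator (level_set i) (T m x))"
        by (subst sum_ennreal[symmetric]) (auto simp: ennreal_indicator)
      also have "\<dots> = ennreal (real (level_count i J))"
        unfolding sum_indicator_level_set[OF x] by (rule ennreal_of_nat_eq_real_of_nat)
      finally have eq: "(\<Sum>m\<in>cube (2 ^ J). indicator (level_set i) (T m x)) = real (level_count i J)"
        by (subst (asm) ennreal_inj) (auto intro: sum_nonneg)
      have "ennreal (real (level_count i J) powr (1 / ?d) / 2 ^ J) \<le> level_density i x"
        unfolding level_density_def eq[symmetric] by (rule SUP_upper) simp
      also have "\<dots> = ennreal (enn2real (level_density i x))" using fin by simp
      finally have "real (level_count i J) powr (1 / ?d) / 2 ^ J \<le> enn2real (level_density i x)"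
        by (simp add: ennreal_le_iff)
      then have "2 ^ i * (real (level_count i J) powr (1 / ?d)) \<le> 2 ^ i * (enn2real (level_density i x) * 2 ^ J)"
        by (intro mult_left_mono) (auto simp: field_simps)
      then show ?thesis by (simp add: w_def mult.assoc)
    qed
    show ?case
      unfolding small_tails_def
    proof (intro allI impI)
      fix \<epsilon> :: real assume "\<epsilon> > 0"
      then obtain i0 where i0: "\<And>m n. m \<ge> i0 \<Longrightarrow> norm (sum w {m..<n}) < \<epsilon>"
        using sw unfolding summable_Cauchy by blast
      have "(\<Sum>i\<in>{i0..<I}. 2 ^ i * real (level_count i J) powr (1 / ?d)) \<le> \<epsilon> * 2 ^ J" for I J
      proof -
        have "(\<Sum>i\<in>{i0..<I}. 2 ^ i * real (level_count i J) powr (1 / ?d)) \<le> (\<Sum>i\<in>{i0..<I}. w i * 2 ^ J)"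
          by (intro sum_mono term_le)
        also have "\<dots> = sum w {i0..<I} * 2 ^ J" by (simp add: sum_distrib_right)
        also have "\<dots> \<le> \<epsilon> * 2 ^ J" using i0[of i0 I] by (intro mult_right_mono) auto
        finally show ?thesis .
      qed
      then show "\<exists>i0. \<forall>I J. (\<Sum>i\<in>{i0..<I}. 2 ^ i * real (level_count i J) powr (1 / ?d)) \<le> \<epsilon> * 2 ^ J"
        by blast
    qed
  qed
qed

lemma AE_equicontinuous: "AE x in M. equicontinuous_at_infinity (\<rho> x)"
proof -
  have "CARD('d) = 1 \<or> CARD('d) \<ge> 2" using zero_less_card_finite[where 'a='d] by linarith
  then have "AE x in M. lattice_semimetric.small_tails (\<rho> x)"
    using AE_small_tails_line AE_small_tails_higher by blast
  moreover have "AE x in M. x \<in> space M" by simp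
  ultimately show ?thesis
    by eventually_elim (rule lattice_semimetric.equicontinuousI[OF semimetric])
qed

end

section \<open>Limits along directions\<close>

text \<open>Stands in for division by \<open>k\<close> and passage to the limit.\<close>

lemma nonpos_of_bounded_multiples:
  fixes a b :: real
  assumes "\<And>k::nat. k \<ge> 1 \<Longrightarrow> real k * a \<le> b"
  shows "a \<le> 0"
proof (rule ccontr)
  assume "\<not> a \<le> 0"
  then obtain k where "b < real k * a" using reals_Archimedean3[of a] by auto
  moreover have "real k * a \<le> real (Suc k) * a" using \<open>\<not> a \<le> 0\<close> by (intro mult_right_mono) auto
  ultimately show False using assms[of "Suc k"] by simp
qed

text \<open>Walk from \<open>i\<close> to \<open>k\<close>: at a good site jump over a block whose
  weights pay for its length, at a bad site move by one and charge \<open>c\<close>. Once at most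
  \<open>N\<close> sites are left, the whole remainder is charged, whence
  \<open>c * real N\<close>.\<close>

lemma greedy_cover_ge:
  fixes a :: "nat \<Rightarrow> real"
  assumes a: "\<And>j. a j \<ge> 0" and c: "c \<ge> 0"
    and good: "\<And>i. \<not> bad i \<Longrightarrow> \<exists>l\<in>{1..N}. c * real l \<le> (\<Sum>j\<in>{i..<i + l}. a j)"
    and "i \<le> k"
  shows "c * real (k - i) \<le> (\<Sum>j\<in>{i..<k}. a j) + c * (\<Sum>j\<in>{i..<k}. of_bool (bad j)) + c * real N"
  using \<open>i \<le> k\<close>
proof (induction "k - i" arbitrary: i rule: less_induct)
  case less
  have nn: "0 \<le> c * (\<Sum>j\<in>{i..<k}. of_bool (bad j))" using c by (intro mult_nonneg_nonneg sum_nonneg) auto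
  show ?case
  proof (cases "k - i \<le> N")
    case True
    then have "c * real (k - i) \<le> c * real N" using c by (intro mult_left_mono) auto
    moreover have "0 \<le> (\<Sum>j\<in>{i..<k}. a j)" by (intro sum_nonneg a)
    ultimately show ?thesis using nn by linarith
  next
    case False
    have split: "(\<Sum>j\<in>{i..<k}. f j) = (\<Sum>j\<in>{i..<i + l}. f j) + (\<Sum>j\<in>{i + l..<k}. f j)" if "i + l \<le> k" for l and f :: "nat \<Rightarrow> real"
      using that by (subst sum.atLeastLessThan_concat) auto
    show ?thesis
    proof (cases "bad i")
      case True
      have "c * real (k - (i + 1)) \<le> (\<Sum>j\<in>{i + 1..<k}. a j) + c * (\<Sum>j\<in>{i + 1..<k}. of_bool (bad j)) + c * real N"
        using False by (intro less) auto
      moreover have "real (k - i) = real (k - (i + 1)) + 1" using False by simp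
      ultimately show ?thesis
        using split[of 1 a] split[of 1 "\<lambda>j. of_bool (bad j)"] False True a[of i] by (simp add: algebra_simps)
    next
      case good': False
      then obtain l where l: "1 \<le> l" "l \<le> N" "c * real l \<le> (\<Sum>j\<in>{i..<i + l}. a j)" using good by fastforce
      have le: "i + l \<le> k" using False l by simp
      have "c * real (k - (i + l)) \<le> (\<Sum>j\<in>{i + l..<k}. a j) + c * (\<Sum>j\<in>{i + l..<k}. of_bool (bad j)) + c * real N"
        using False l by (intro less) auto
      moreover have "real (k - i) = real (k - (i + l)) + real l" using le by simp
      moreover have "0 \<le> c * (\<Sum>j\<in>{i..<i + l}. of_bool (bad j))" using c by (intro mult_nonneg_nonneg sum_nonneg) auto
      ultimately show ?thesis
        using split[OF le, of a] split[OF le, of "\<lambda>j. of_bool (bad j)"] l(3) by (simp add: algebra_simps)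
    qed
  qed
qed

text \<open>The dual walk, resting on subadditivity: good sites jump along a cheap block, while bad
  sites and those within \<open>N\<close> of the end move by one at the true cost. That cost has no
  uniform bound, so it stays inside the sums and is controlled only after integration.\<close>

lemma greedy_cover_le:
  fixes g :: "nat \<Rightarrow> nat \<Rightarrow> real"
  assumes g0: "\<And>i. g i i \<le> 0" and tri: "\<And>i j k. g i k \<le> g i j + g j k" and a: "\<And>j. g j (Suc j) \<ge> 0" and c: "c \<ge> 0"
    and good: "\<And>i. \<not> bad i \<Longrightarrow> \<exists>l\<in>{1..N}. g i (i + l) \<le> c * real l"
    and "i \<le> k"
  shows "g i k \<le> c * real (k - i) + (\<Sum>j\<in>{i..<k}. of_bool (bad j) * g j (Suc j)) + (\<Sum>j\<in>{i..<k}. of_bool (k \<le> j + N) * g j (Suc j))"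
  using \<open>i \<le> k\<close>
proof (induction "k - i" arbitrary: i rule: less_induct)
  case less
  show ?case
  proof (cases "i = k")
    case True
    then show ?thesis using g0 by simp
  next
    case False
    have split: "(\<Sum>j\<in>{i..<k}. f j) = (\<Sum>j\<in>{i..<i + l}. f j) + (\<Sum>j\<in>{i + l..<k}. f j)" if "i + l \<le> k" for l and f :: "nat \<Rightarrow> real"
      using that by (subst sum.atLeastLessThan_concat) auto
    let ?f1 = "\<lambda>j. of_bool (bad j) * g j (Suc j)" and ?f2 = "\<lambda>j. of_bool (k \<le> j + N) * g j (Suc j)"
    have step: ?thesis if "bad i \<or> k \<le> i + N"
    proof -
      have "g (Suc i) k \<le> c * real (k - Suc i) + (\<Sum>j\<in>{Suc i..<k}. ?f1 j) + (\<Sum>j\<in>{Suc i..<k}. ?f2 j)"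
        using False less(2) by (intro less) auto
      moreover have "g i (Suc i) \<le> ?f1 i + ?f2 i" using that a[of i] by auto
      moreover have "c * real (k - Suc i) \<le> c * real (k - i)" using c by (intro mult_left_mono) auto
      ultimately show ?thesis
        using sum.atLeast_Suc_lessThan[of i k ?f1] sum.atLeast_Suc_lessThan[of i k ?f2] False less(2) tri[of i k "Suc i"] by linarith
    qed
    show ?thesis
    proof (cases "bad i \<or> k \<le> i + N")
      case good': False
      then obtain l where l: "1 \<le> l" "l \<le> N" "g i (i + l) \<le> c * real l" using good by fastforce
      have le: "i + l \<le> k" using good' l by simp
      have "g (i + l) k \<le> c * real (k - (i + l)) + (\<Sum>j\<in>{i + l..<k}. ?f1 j) + (\<Sum>j\<in>{i + l..<k}. ?f2 j)"
        using good' l by (intro less) auto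
      moreover have "real (k - i) = real (k - (i + l)) + real l" using le by simp
      moreover have "0 \<le> (\<Sum>j\<in>{i..<i + l}. ?f1 j)" "0 \<le> (\<Sum>j\<in>{i..<i + l}. ?f2 j)" using a by (auto intro!: sum_nonneg)
      ultimately show ?thesis
        using split[OF le, of ?f1] split[OF le, of ?f2] l(3) tri[of i k "i + l"] by (simp add: algebra_simps)
    qed (rule step)
  qed
qed

lemma Suc_smult: "int (Suc j) *s n = int j *s n + (n :: int ^ 'd)"
  by (simp add: vec_eq_iff algebra_simps)

lemma ex_cube: "\<exists>N\<ge>1. n \<in> cube N"
proof -
  define s where "s = (\<Sum>i\<in>UNIV. \<bar>n $ i\<bar>)"
  have le: "\<bar>n $ i\<bar> \<le> s" for i
    unfolding s_def by (rule member_le_sum) auto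
  have "\<bar>n $ i\<bar> \<le> int (nat s + 1)" for i
    using le[of i] by linarith
  then show ?thesis unfolding cube_def by (intro exI[of _ "nat s + 1"]) auto
qed

lemma cube_smult: "n \<in> cube N \<Longrightarrow> int k *s n \<in> cube (k * N)"
  unfolding cube_def by (auto simp: abs_mult intro: mult_left_mono)

text \<open>A fixed displacement eventually falls below any given fraction of the radius, here
  \<open>2 * k * N\<close>, so equicontinuity applies to it.\<close>

lemma equicontinuous_drift:
  assumes eq: "equicontinuous_at_infinity r" and "\<eta> > 0"
  shows "\<exists>k0. \<forall>k\<ge>k0. r (int k *s n) (int k *s n + m) \<le> \<eta> * real k"
proof -
  obtain N1 N2 where N12: "N1 \<ge> 1" "n \<in> cube N1" "m \<in> cube N2" using ex_cube by metis
  define N where "N = N1 + N2"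
  have N: "N \<ge> 1" "n \<in> cube N" "m \<in> cube N" using N12 cube_mono[of N1 N] cube_mono[of N2 N] by (auto simp: N_def)
  obtain i where i: "2 * real N / \<eta> < 2 ^ i" using real_arch_pow[of 2] by auto
  obtain j R0 where jR: "\<And>R p q. \<lbrakk>R \<ge> R0; p \<in> cube R; q \<in> cube R; \<forall>l. 2 ^ j * \<bar>(q - p) $ l\<bar> \<le> int R\<rbrakk> \<Longrightarrow> 2 ^ i * r p q \<le> real R"
    using eq unfolding equicontinuous_at_infinity_def by meson
  have "r (int k *s n) (int k *s n + m) \<le> \<eta> * real k" if k: "k \<ge> R0 + 2 ^ j + 1" for k
  proof -
    have kN: "k * N + N \<le> 2 * k * N" "k \<le> k * N" using k N(1) by auto
    have "2 ^ i * r (int k *s n) (int k *s n + m) \<le> real (2 * k * N)"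
    proof (rule jR)
      show "R0 \<le> 2 * k * N" using k kN by linarith
      show "int k *s n \<in> cube (2 * k * N)" using cube_smult[OF N(2), of k] cube_mono[of "k * N" "2 * k * N"] by auto
      show "int k *s n + m \<in> cube (2 * k * N)"
        using cube_add[OF cube_smult[OF N(2), of k] N(3)] cube_mono[OF kN(1)] by auto
      show "\<forall>l. 2 ^ j * \<bar>(int k *s n + m - int k *s n) $ l\<bar> \<le> int (2 * k * N)"
      proof
        fix l
        have "2 ^ j * \<bar>m $ l\<bar> \<le> int k * int N"
        proof (rule mult_mono)
          show "(2::int) ^ j \<le> int k" using k by (metis add_leD1 add_leD2 of_nat_le_iff of_nat_numeral of_nat_power order_trans)
          show "\<bar>m $ l\<bar> \<le> int N" using N(3) by (auto simp: cube_def)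
        qed auto
          moreover have "0 \<le> int k * int N" by simp
          moreover have "int (2 * k * N) = 2 * (int k * int N)" by simp
          ultimately show "2 ^ j * \<bar>(int k *s n + m - int k *s n) $ l\<bar> \<le> int (2 * k * N)"
            by (simp only: add_diff_cancel_left')
      qed
    qed
    also have "\<dots> \<le> 2 ^ i * (\<eta> * real k)"
      using i \<open>\<eta> > 0\<close> mult_right_mono[of "2 * real N" "2 ^ i * \<eta>" "real k"] by (simp add: field_simps)
    finally show ?thesis by simp
  qed
  then show ?thesis by blast
qed

section \<open>Zero-one laws and the ergodic theorem along one direction\<close>

locale ergodic_semimetric = stationary_semimetric M T \<rho>
  for M :: "'a measure" and T :: "int ^ 'd \<Rightarrow> 'a \<Rightarrow> 'a" and \<rho> +
  assumes ergodic: "A \<in> sets M \<Longrightarrow> (\<And>k. T k -` A \<inter> space M = A) \<Longrightarrow> measure M A = 0 \<or> measure M A = 1"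
begin

text \<open>Forward invariance under the whole group is enough: applied to \<open>- k\<close> it
  gives the reverse inclusion.\<close>

lemma invariant_zero_one:
  assumes A: "A \<in> sets M" and inv: "\<And>k x. x \<in> A \<Longrightarrow> T k x \<in> A"
  shows "measure M A = 0 \<or> measure M A = 1"
proof (rule ergodic[OF A])
  fix k
  have "x \<in> A" if "x \<in> space M" "T k x \<in> A" for x
    using inv[OF that(2), of "- k"] that(1) by (simp add: T_add[symmetric] T_0)
  then show "T k -` A \<inter> space M = A" using inv sets.sets_into_space[OF A] by auto
qed

text \<open>Equicontinuity is strictly, not just almost surely, invariant under the action, so the sets
  \<open>below\<close> and \<open>above\<close> are strictly invariant as the hypothesis of ergodicity demands.\<close>
definition regular :: "'a set" where
  "regular = {x \<in> space M. equicontinuous_at_infinity (\<rho> x)}"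

lemma regular_measurable [measurable]: "regular \<in> sets M"
  unfolding regular_def equicontinuous_at_infinity_def by measurable

lemma AE_regular: "AE x in M. x \<in> regular"
  using AE_equicontinuous AE_space unfolding regular_def by eventually_elim auto

lemma regular_drift:
  "x \<in> regular \<Longrightarrow> \<eta> > 0 \<Longrightarrow> \<exists>k0. \<forall>k\<ge>k0. \<rho> x (int k *s n) (int k *s n + m) \<le> \<eta> * real k"
  unfolding regular_def by (auto intro: equicontinuous_drift)

lemma regular_space: "x \<in> regular \<Longrightarrow> x \<in> space M"
  by (simp add: regular_def)

lemma T_regular:
  assumes x: "x \<in> regular"
  shows "T m x \<in> regular"
proof -
  obtain N where N: "m \<in> cube N" using ex_cube by blast
  have "\<exists>j R0. \<forall>R\<ge>R0. \<forall>p q. p \<in> cube R \<longrightarrow> q \<in> cube R \<longrightarrow>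
        (\<forall>l. 2 ^ j * \<bar>(q - p) $ l\<bar> \<le> int R) \<longrightarrow> 2 ^ i * \<rho> (T m x) p q \<le> real R" for i
  proof -
    \<comment> \<open>\<open>Suc i\<close> compensates for passing from \<open>R\<close> to
      \<open>2 * R\<close>, a radius whose cube contains the points translated by
      \<open>m\<close>.\<close>
    obtain j R0 where jR: "\<And>R p q. \<lbrakk>R \<ge> R0; p \<in> cube R; q \<in> cube R; \<forall>l. 2 ^ j * \<bar>(q - p) $ l\<bar> \<le> int R\<rbrakk> \<Longrightarrow> 2 ^ Suc i * \<rho> x p q \<le> real R"
      using x unfolding regular_def equicontinuous_at_infinity_def by blast
    have "2 ^ i * \<rho> (T m x) p q \<le> real R"
      if R: "R \<ge> R0 + N" and p: "p \<in> cube R" and q: "q \<in> cube R" and pq: "\<forall>l. 2 ^ j * \<bar>(q - p) $ l\<bar> \<le> int R" for R p q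
    proof -
      have "2 ^ Suc i * \<rho> x (p + m) (q + m) \<le> real (2 * R)"
      proof (rule jR)
        show "p + m \<in> cube (2 * R)" "q + m \<in> cube (2 * R)"
          using cube_add[OF p N] cube_add[OF q N] cube_mono[of "R + N" "2 * R"] R by auto
        show "\<forall>l. 2 ^ j * \<bar>(q + m - (p + m)) $ l\<bar> \<le> int (2 * R)"
        proof
          fix l
          have "2 ^ j * \<bar>(q - p) $ l\<bar> \<le> int R" using pq by blast
          then show "2 ^ j * \<bar>(q + m - (p + m)) $ l\<bar> \<le> int (2 * R)" by simp
        qed
      qed (use R in auto)
      then show ?thesis using x by (simp add: \<rho>_T regular_space)
    qed
    then show ?thesis by blast
  qed
  then show ?thesis
    using x unfolding regular_def equicontinuous_at_infinity_def by simp
qed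

lemma regular_translate:
  assumes x: "x \<in> regular" and \<eta>: "\<eta> > 0"
  shows "\<exists>k0. \<forall>k\<ge>k0. \<bar>\<rho> (T m x) 0 (int k *s n) - \<rho> x 0 (int k *s n)\<bar> \<le> \<eta> * real k"
proof -
  interpret lattice_semimetric "\<rho> x" using x by (intro semimetric regular_space)
  have \<eta>2: "\<eta> / 2 > 0" using \<eta> by simp
  obtain k1 where k1: "\<And>k. k \<ge> k1 \<Longrightarrow> \<rho> x (int k *s n) (int k *s n + m) \<le> \<eta> / 2 * real k"
    using regular_drift[OF x \<eta>2] by blast
  \<comment> \<open>With \<open>n = 0\<close> the drift lemma says that the constant
    \<open>\<rho> x 0 m\<close> is eventually at most \<open>\<eta> / 2 * real k\<close>.\<close>
  obtain k2 where k2: "\<And>k. k \<ge> k2 \<Longrightarrow> \<rho> x (int k *s 0) (int k *s 0 + m) \<le> \<eta> / 2 * real k"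
    using regular_drift[OF x \<eta>2] by blast
  have "\<bar>\<rho> (T m x) 0 (int k *s n) - \<rho> x 0 (int k *s n)\<bar> \<le> \<eta> * real k" if k: "k \<ge> max k1 k2" for k
  proof -
    let ?q = "int k *s n"
    have "\<rho> (T m x) 0 ?q = \<rho> x m (?q + m)" using x by (simp add: \<rho>_T regular_space)
    moreover have "int k *s (0::int ^ 'd) = 0" by (simp add: vec_eq_iff)
    moreover have "\<bar>\<rho> x m (?q + m) - \<rho> x 0 ?q\<bar> \<le> \<rho> x 0 m + \<rho> x ?q (?q + m)"
      using triangle_diff[of m "?q + m" "?q"] triangle_diff[of ?q m 0] sym[of m ?q] sym[of 0 ?q] sym[of 0 m]
      by linarith
    ultimately show ?thesis using k1[of k] k2[of k] k by simp
  qed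
  then show ?thesis by blast
qed

definition mean :: "int ^ 'd \<Rightarrow> real" where
  "mean n = (\<integral>x. \<rho> x 0 n \<partial>M)"

lemma mean_nonneg: "mean n \<ge> 0"
  unfolding mean_def by (intro integral_nonneg_AE AE_I2 \<rho>_nonneg)

lemma integral_\<rho>: "(\<integral>x. \<rho> x m n \<partial>M) = mean (n - m)"
proof -
  have "mean (n - m) = (\<integral>x. \<rho> x 0 (n - m) \<partial>distr M M (T m))" by (simp add: distr_T mean_def)
  also have "\<dots> = (\<integral>x. \<rho> (T m x) 0 (n - m) \<partial>M)" by (intro integral_distr) auto
  also have "\<dots> = (\<integral>x. \<rho> x m n \<partial>M)"
    by (intro Bochner_Integration.integral_cong) (auto simp: \<rho>_T)
  finally show ?thesis ..
qed

lemma mean_add: "mean (m + n) \<le> mean m + mean n"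
proof -
  have "mean (m + n) \<le> (\<integral>x. \<rho> x 0 m + \<rho> x m (m + n) \<partial>M)"
    unfolding mean_def
    by (intro integral_mono Bochner_Integration.integrable_add integrable_\<rho> lattice_semimetric.triangle[OF semimetric])
  also have "\<dots> = mean m + mean n"
    by (subst Bochner_Integration.integral_add) (auto simp: integrable_\<rho> integral_\<rho>)
  finally show ?thesis .
qed

lemma mean_0: "mean 0 = 0"
  unfolding mean_def using lattice_semimetric.refl[OF semimetric] by (simp cong: Bochner_Integration.integral_cong)

lemma mean_uminus: "mean (- n) = mean n"
proof -
  have "(\<integral>x. \<rho> x 0 n \<partial>M) = (\<integral>x. \<rho> x n 0 \<partial>M)"
    by (intro Bochner_Integration.integral_cong lattice_semimetric.sym[OF semimetric]) auto
  then show ?thesis by (simp add: integral_\<rho>)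
qed

text \<open>On regular points this says that the limsup of
  \<open>\<rho> x 0 (int k *s n) / k\<close> is at most \<open>c\<close>; \<open>above\<close> is
  the dual statement on the liminf. The slack absorbs the o(k) error of a change of base
  point.\<close>

definition below :: "real \<Rightarrow> int ^ 'd \<Rightarrow> 'a set" where
  "below c n = {x \<in> space M. x \<in> regular \<and> (\<forall>i. \<exists>k0. \<forall>k\<ge>k0. \<rho> x 0 (int k *s n) \<le> (c + 1 / 2 ^ i) * real k)}"

definition above :: "real \<Rightarrow> int ^ 'd \<Rightarrow> 'a set" where
  "above c n = {x \<in> space M. x \<in> regular \<and> (\<forall>i. \<exists>k0. \<forall>k\<ge>k0. (c - 1 / 2 ^ i) * real k \<le> \<rho> x 0 (int k *s n))}"

lemma below_zero_one: "measure M (below c n) = 0 \<or> measure M (below c n) = 1"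
proof (rule invariant_zero_one)
  show "below c n \<in> sets M" unfolding below_def by measurable
  fix m x assume x: "x \<in> below c n"
  have "\<exists>k0. \<forall>k\<ge>k0. \<rho> (T m x) 0 (int k *s n) \<le> (c + 1 / 2 ^ i) * real k" for i
  proof -
    obtain k1 where k1: "\<And>k. k \<ge> k1 \<Longrightarrow> \<rho> x 0 (int k *s n) \<le> (c + 1 / 2 ^ Suc i) * real k"
      using x unfolding below_def by blast
    obtain k2 where k2: "\<And>k. k \<ge> k2 \<Longrightarrow> \<bar>\<rho> (T m x) 0 (int k *s n) - \<rho> x 0 (int k *s n)\<bar> \<le> 1 / 2 ^ Suc i * real k"
      using regular_translate[of x "1 / 2 ^ Suc i" m n] x unfolding below_def by auto
    have "\<rho> (T m x) 0 (int k *s n) \<le> (c + 1 / 2 ^ i) * real k" if "k \<ge> max k1 k2" for k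
      using k1[of k] k2[of k] that by (simp add: algebra_simps)
    then show ?thesis by blast
  qed
  then show "T m x \<in> below c n" using x T_regular unfolding below_def by auto
qed

lemma above_zero_one: "measure M (above c n) = 0 \<or> measure M (above c n) = 1"
proof (rule invariant_zero_one)
  show "above c n \<in> sets M" unfolding above_def by measurable
  fix m x assume x: "x \<in> above c n"
  have "\<exists>k0. \<forall>k\<ge>k0. (c - 1 / 2 ^ i) * real k \<le> \<rho> (T m x) 0 (int k *s n)" for i
  proof -
    obtain k1 where k1: "\<And>k. k \<ge> k1 \<Longrightarrow> (c - 1 / 2 ^ Suc i) * real k \<le> \<rho> x 0 (int k *s n)"
      using x unfolding above_def by blast
    obtain k2 where k2: "\<And>k. k \<ge> k2 \<Longrightarrow> \<bar>\<rho> (T m x) 0 (int k *s n) - \<rho> x 0 (int k *s n)\<bar> \<le> 1 / 2 ^ Suc i * real k"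
      using regular_translate[of x "1 / 2 ^ Suc i" m n] x unfolding above_def by auto
    have "(c - 1 / 2 ^ i) * real k \<le> \<rho> (T m x) 0 (int k *s n)" if "k \<ge> max k1 k2" for k
      using k1[of k] k2[of k] that by (simp add: algebra_simps)
    then show ?thesis by blast
  qed
  then show "T m x \<in> above c n" using x T_regular unfolding above_def by auto
qed

lemma chain_le:
  assumes "x \<in> space M"
  shows "\<rho> x (int i *s n) (int (i + l) *s n) \<le> (\<Sum>j\<in>{i..<i + l}. \<rho> x (int j *s n) (int (Suc j) *s n))"
proof (induction l)
  case 0
  then show ?case using lattice_semimetric.refl[OF semimetric[OF assms]] by simp
next
  case (Suc l)
  have "\<rho> x (int i *s n) (int (i + Suc l) *s n) \<le> \<rho> x (int i *s n) (int (i + l) *s n) + \<rho> x (int (i + l) *s n) (int (Suc (i + l)) *s n)"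
    using lattice_semimetric.triangle[OF semimetric[OF assms]] by simp
  with Suc show ?case by simp
qed

lemma \<rho>_T_line: "x \<in> space M \<Longrightarrow> \<rho> (T (int i *s n) x) 0 (int l *s n) = \<rho> x (int i *s n) (int (i + l) *s n)"
  by (simp add: \<rho>_T add.commute)

lemma integral_indicator_T:
  assumes [measurable]: "B \<in> sets M"
  shows "(\<integral>x. indicator B (T k x) \<partial>M) = measure M B"
proof -
  have "(\<integral>x. indicator B (T k x) \<partial>M) = (\<integral>x. indicator B x \<partial>distr M M (T k) :: real)"
    by (intro integral_distr[symmetric]) auto
  then show ?thesis by (simp add: distr_T)
qed

lemma integral_vanishing_indicator_tendsto_0:
  assumes [measurable]: "\<And>N::nat. B N \<in> sets M" and dec: "\<And>x N N'. x \<in> B N' \<Longrightarrow> N \<le> N' \<Longrightarrow> x \<in> B N"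
    and ex: "AE x in M. \<exists>N. x \<notin> B N" and f: "integrable M f"
  shows "(\<lambda>N. \<integral>x. indicator (B N) x * f x \<partial>M) \<longlonglongrightarrow> (0 :: real)"
proof -
  have "(\<lambda>N. \<integral>x. indicator (B N) x * f x \<partial>M) \<longlonglongrightarrow> (\<integral>x. 0 \<partial>M)"
  proof (rule integral_dominated_convergence[where w = "\<lambda>x. norm (f x)"])
    show "AE x in M. (\<lambda>N. indicator (B N) x * f x) \<longlonglongrightarrow> 0"
      using ex
    proof eventually_elim
      case (elim x)
      then obtain N where "x \<notin> B N" by blast
      then have "\<forall>\<^sub>F N in sequentially. indicator (B N) x * f x = 0"
        using dec unfolding eventually_sequentially by (intro exI[of _ N]) (auto simp: indicator_def)
      then show ?case by (rule tendsto_eventually)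
    qed
  qed (use f in \<open>auto simp: indicator_def\<close>)
  then show ?thesis by simp
qed

text \<open>Otherwise, by the zero-one law, almost every point starts a block whose length-averaged
  distance is at least \<open>c\<close>. Covering a long orbit segment by such blocks makes its unit
  steps cost about \<open>c\<close> each, while their mean cost is \<open>mean n\<close>; the error
  \<open>c * measure M (B N)\<close> vanishes as \<open>N\<close> grows. Only single steps are
  compared here, and \<open>AE_rate_upper\<close> sharpens the bound by passing to multiples of
  \<open>n\<close>.\<close>

lemma AE_below:
  assumes c: "mean n < c"
  shows "AE x in M. x \<in> below c n"
proof -
  have [measurable]: "below c n \<in> sets M" unfolding below_def by measurable
  have c0: "c \<ge> 0" using c mean_nonneg[of n] by linarith
  have "measure M (below c n) \<noteq> 0"
  proof
    assume "measure M (below c n) = 0"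
    then have "AE x in M. x \<notin> below c n"
      by (intro AE_not_in) (auto simp: null_sets_def emeasure_eq_measure)
    then have ex: "AE x in M. \<exists>l\<ge>1. c * real l \<le> \<rho> x 0 (int l *s n)"
      using AE_regular
    proof eventually_elim
      case (elim x)
      then obtain i where "\<And>k0. \<exists>k\<ge>k0. (c + 1 / 2 ^ i) * real k < \<rho> x 0 (int k *s n)"
        unfolding below_def using regular_space by (force simp: not_le)
      then obtain k where k: "k \<ge> 1" "(c + 1 / 2 ^ i) * real k < \<rho> x 0 (int k *s n)" by blast
      have "c * real k \<le> (c + 1 / 2 ^ i) * real k" by (intro mult_right_mono) auto
      with k have "c * real k \<le> \<rho> x 0 (int k *s n)" by linarith
      with k show ?case by blast
    qed
    \<comment> \<open>Points at which no heavy block of length at most \<open>N\<close> starts;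
      these sets decrease to a null set.\<close>
    define B where "B = (\<lambda>N::nat. {x \<in> space M. \<forall>l\<in>{1..N}. \<rho> x 0 (int l *s n) < c * real l})"
    have B [measurable]: "B N \<in> sets M" for N unfolding B_def by measurable
    have "c - mean n - c * measure M (B N) \<le> 0" for N
    proof (rule nonpos_of_bounded_multiples)
      fix k :: nat assume "k \<ge> 1"
      let ?a = "\<lambda>x j. \<rho> x (int j *s n) (int (Suc j) *s n)"
      have pw: "c * real k \<le> (\<Sum>j<k. ?a x j) + c * (\<Sum>j<k. indicator (B N) (T (int j *s n) x)) + c * real N"
        if x: "x \<in> space M" for x
      proof -
        have "c * real (k - 0) \<le> (\<Sum>j\<in>{0..<k}. ?a x j) + c * (\<Sum>j\<in>{0..<k}. of_bool (T (int j *s n) x \<in> B N)) + c * real N"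
        proof (rule greedy_cover_ge)
          fix i assume "T (int i *s n) x \<notin> B N"
          then obtain l where l: "l \<in> {1..N}" "c * real l \<le> \<rho> (T (int i *s n) x) 0 (int l *s n)"
            using x unfolding B_def by (auto simp: not_less)
          then have "c * real l \<le> (\<Sum>j\<in>{i..<i + l}. ?a x j)"
            using chain_le[OF x, of i n l] \<rho>_T_line[OF x, of i n l] by simp
          with l show "\<exists>l\<in>{1..N}. c * real l \<le> (\<Sum>j\<in>{i..<i + l}. ?a x j)" by blast
        qed (use c0 x \<rho>_nonneg in auto)
        then show ?thesis by (simp add: atLeast0LessThan indicator_def of_bool_def)
      qed
      have int: "integrable M (\<lambda>x. indicator (B N) (T (int j *s n) x) :: real)" for j
        by (rule integrable_const_bound[where B = 1]) (auto simp: indicator_def)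
      have "(\<integral>x. c * real k \<partial>M) \<le> (\<integral>x. (\<Sum>j<k. ?a x j) + c * (\<Sum>j<k. indicator (B N) (T (int j *s n) x)) + c * real N \<partial>M)"
        by (intro integral_mono pw Bochner_Integration.integrable_add Bochner_Integration.integrable_sum
            integrable_mult_right integrable_\<rho> int integrable_const)
      also have "\<dots> = (\<Sum>j<k. mean n) + c * (\<Sum>j<k. measure M (B N)) + c * real N"
        by (simp add: integrable_\<rho> int integral_\<rho> integral_indicator_T Suc_smult prob_space del: of_nat_Suc)
      finally show "real k * (c - mean n - c * measure M (B N)) \<le> c * real N"
        by (simp add: prob_space algebra_simps)
    qed
    moreover have "(\<lambda>N. measure M (B N)) \<longlonglongrightarrow> 0"
    proof -
      have "(\<lambda>N. \<integral>x. indicator (B N) x * 1 \<partial>M) \<longlonglongrightarrow> (0 :: real)"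
      proof (rule integral_vanishing_indicator_tendsto_0)
        show "AE x in M. \<exists>N. x \<notin> B N"
          using ex proof eventually_elim
            case (elim x)
            then obtain l where "l \<ge> 1" "c * real l \<le> \<rho> x 0 (int l *s n)" by blast
            then have "x \<notin> B l" unfolding B_def by force
            then show ?case by blast
          qed
      qed (auto simp: B_def)
      then show ?thesis by simp
    qed
    then have "(\<lambda>N. c - mean n - c * measure M (B N)) \<longlonglongrightarrow> c - mean n - c * 0"
      by (intro tendsto_intros)
    ultimately have "c - mean n - c * 0 \<le> 0" by (intro LIMSEQ_le_const2) auto
    then show False using c by simp
  qed
  then have "measure M (below c n) = 1" using below_zero_one by blast
  then show ?thesis by (simp add: prob_eq_1)
qed

text \<open>Otherwise almost every point starts a block of average at most \<open>c\<close>.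
  Concatenating such blocks bounds \<open>mean (int k *s n)\<close> by \<open>c * k\<close>, plus
  \<open>k\<close> times the integral of \<open>\<rho> x 0 n\<close> over \<open>B N\<close>, plus a
  boundary term bounded in \<open>k\<close>; for large \<open>N\<close> this contradicts growth at
  rate \<open>L > c\<close>.\<close>

lemma AE_above:
  assumes c: "c < L" "c \<ge> 0" and L: "\<And>k. k \<ge> 1 \<Longrightarrow> real k * L \<le> mean (int k *s n)"
  shows "AE x in M. x \<in> above c n"
proof -
  have [measurable]: "above c n \<in> sets M" unfolding above_def by measurable
  have "measure M (above c n) \<noteq> 0"
  proof
    assume "measure M (above c n) = 0"
    then have "AE x in M. x \<notin> above c n"
      by (intro AE_not_in) (auto simp: null_sets_def emeasure_eq_measure)
    then have ex: "AE x in M. \<exists>l\<ge>1. \<rho> x 0 (int l *s n) \<le> c * real l"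
      using AE_regular
    proof eventually_elim
      case (elim x)
      then obtain i where "\<And>k0. \<exists>k\<ge>k0. \<rho> x 0 (int k *s n) < (c - 1 / 2 ^ i) * real k"
        unfolding above_def using regular_space by (force simp: not_le)
      then obtain k where k: "k \<ge> 1" "\<rho> x 0 (int k *s n) < (c - 1 / 2 ^ i) * real k" by blast
      have "(c - 1 / 2 ^ i) * real k \<le> c * real k" by (intro mult_right_mono) auto
      with k have "\<rho> x 0 (int k *s n) \<le> c * real k" by linarith
      with k show ?case by blast
    qed
    define B where "B = (\<lambda>N::nat. {x \<in> space M. \<forall>l\<in>{1..N}. \<rho> x 0 (int l *s n) > c * real l})"
    have B [measurable]: "B N \<in> sets M" for N unfolding B_def by measurable
    let ?I = "\<lambda>N. \<integral>x. indicator (B N) x * \<rho> x 0 n \<partial>M"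
    have intB: "integrable M (\<lambda>x. indicator (B N) x * \<rho> x 0 n)" for N
      using integrable_mult_indicator[OF B integrable_\<rho>] by simp
    have "L - c - ?I N \<le> 0" for N
    proof (rule nonpos_of_bounded_multiples)
      fix k :: nat assume k: "k \<ge> 1"
      let ?a = "\<lambda>x j. \<rho> x (int j *s n) (int (Suc j) *s n)"
      have pw: "\<rho> x 0 (int k *s n) \<le> c * real k + (\<Sum>j<k. indicator (B N) (T (int j *s n) x) * \<rho> (T (int j *s n) x) 0 n)
          + (\<Sum>j<k. of_bool (k \<le> j + N) * ?a x j)"
        if x: "x \<in> space M" for x
      proof -
        interpret lattice_semimetric "\<rho> x" using x by (rule semimetric)
        have "\<rho> x (int 0 *s n) (int k *s n) \<le> c * real (k - 0) + (\<Sum>j\<in>{0..<k}. of_bool (T (int j *s n) x \<in> B N) * ?a x j)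
          + (\<Sum>j\<in>{0..<k}. of_bool (k \<le> j + N) * ?a x j)"
        proof (rule greedy_cover_le)
          fix i assume "T (int i *s n) x \<notin> B N"
          then obtain l where l: "l \<in> {1..N}" "\<rho> (T (int i *s n) x) 0 (int l *s n) \<le> c * real l"
            using x unfolding B_def by (auto simp: not_less)
          then show "\<exists>l\<in>{1..N}. \<rho> x (int i *s n) (int (i + l) *s n) \<le> c * real l"
            using \<rho>_T_line[OF x, of i n l] by auto
        qed (use c nonneg triangle in auto)
        then show ?thesis by (simp add: \<rho>_T[OF x] atLeast0LessThan indicator_def of_bool_def)
      qed
      have intBT: "integrable M (\<lambda>x. indicator (B N) (T m x) * \<rho> (T m x) 0 n)"
        and BT: "(\<integral>x. indicator (B N) (T m x) * \<rho> (T m x) 0 n \<partial>M) = ?I N" for m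
      proof -
        have "integrable (distr M M (T m)) (\<lambda>x. indicator (B N) x * \<rho> x 0 n)"
          unfolding distr_T by (rule intB)
        then show "integrable M (\<lambda>x. indicator (B N) (T m x) * \<rho> (T m x) 0 n)"
          by (subst (asm) integrable_distr_eq) auto
        have "(\<integral>x. indicator (B N) (T m x) * \<rho> (T m x) 0 n \<partial>M) = (\<integral>x. indicator (B N) x * \<rho> x 0 n \<partial>distr M M (T m))"
          by (intro integral_distr[symmetric]) auto
        then show "(\<integral>x. indicator (B N) (T m x) * \<rho> (T m x) 0 n \<partial>M) = ?I N" by (simp add: distr_T)
      qed
      have "mean (int k *s n) \<le> (\<integral>x. c * real k + (\<Sum>j<k. indicator (B N) (T (int j *s n) x) * \<rho> (T (int j *s n) x) 0 n)
          + (\<Sum>j<k. of_bool (k \<le> j + N) * ?a x j) \<partial>M)"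
        unfolding mean_def
        by (intro integral_mono pw Bochner_Integration.integrable_add Bochner_Integration.integrable_sum
            integrable_mult_right integrable_\<rho> intBT integrable_const)
      also have "\<dots> = c * real k + (\<Sum>j<k. ?I N) + (\<Sum>j<k. of_bool (k \<le> j + N) * mean n)"
      proof -
        have "(\<integral>x. c * real k + (\<Sum>j<k. F j x) + (\<Sum>j<k. G j x) \<partial>M) = c * real k + (\<Sum>j<k. \<integral>x. F j x \<partial>M) + (\<Sum>j<k. \<integral>x. G j x \<partial>M)"
          if "\<And>j. integrable M (F j)" "\<And>j. integrable M (G j)" for F G :: "nat \<Rightarrow> 'a \<Rightarrow> real"
          using that by (simp add: prob_space)
        note this[of "\<lambda>j x. indicator (B N) (T (int j *s n) x) * \<rho> (T (int j *s n) x) 0 n" "\<lambda>j x. of_bool (k \<le> j + N) * ?a x j"]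
        moreover have "(\<integral>x. of_bool b * ?a x j \<partial>M) = of_bool b * mean n" for b j
          by (simp add: integral_\<rho> Suc_smult del: of_nat_Suc)
        ultimately show ?thesis
          by (simp only: intBT BT integrable_\<rho> integrable_mult_right)
      qed
      \<comment> \<open>Only the last \<open>N\<close> sites qualify, so the boundary term stays
        bounded as \<open>k\<close> grows.\<close>
      also have "(\<Sum>j<k. of_bool (k \<le> j + N) * mean n) = real (card {j\<in>{..<k}. k \<le> j + N}) * mean n"
        by (simp add: sum_distrib_right[symmetric] sum.If_cases of_bool_def Int_def)
      also have "\<dots> \<le> real N * mean n"
      proof -
        have "card {j\<in>{..<k}. k \<le> j + N} \<le> card {k - N..<k}" by (intro card_mono) auto
        also have "\<dots> \<le> N" by simp
        finally show ?thesis by (intro mult_right_mono mean_nonneg) simp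
      qed
      finally show "real k * (L - c - ?I N) \<le> real N * mean n"
        using L[OF k] by (simp add: algebra_simps)
    qed
    moreover have "?I \<longlonglongrightarrow> 0"
    proof (rule integral_vanishing_indicator_tendsto_0)
      show "AE x in M. \<exists>N. x \<notin> B N"
        using ex proof eventually_elim
          case (elim x)
          then obtain l where "l \<ge> 1" "\<rho> x 0 (int l *s n) \<le> c * real l" by blast
          then have "x \<notin> B l" unfolding B_def by force
          then show ?case by blast
        qed
    qed (auto simp: B_def integrable_\<rho>)
    then have "(\<lambda>N. L - c - ?I N) \<longlonglongrightarrow> L - c - 0"
      by (intro tendsto_intros)
    ultimately have "L - c - 0 \<le> 0" by (intro LIMSEQ_le_const2) auto
    then show False using c by simp
  qed
  then have "measure M (above c n) = 1" using above_zero_one by blast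
  then show ?thesis by (simp add: prob_eq_1)
qed

text \<open>The time constant of Kingman's theorem; by Fekete's lemma the infimum is also the limit.
  It is written in the form in which \<open>seminorm_extension\<close> identifies the seminorm at
  lattice points.\<close>

definition rate :: "int ^ 'd \<Rightarrow> real" where
  "rate n = (INF k\<in>{1..}. mean (int k *s n) / real k)"

lemma rate_le: "k \<ge> 1 \<Longrightarrow> real k * rate n \<le> mean (int k *s n)"
proof -
  assume k: "k \<ge> 1"
  have "rate n \<le> mean (int k *s n) / real k"
    unfolding rate_def using k mean_nonneg by (intro cINF_lower bdd_belowI[of _ 0]) auto
  then show ?thesis using k by (simp add: field_simps)
qed

lemma rate_nonneg: "rate n \<ge> 0"
  unfolding rate_def using mean_nonneg by (intro cINF_greatest) auto

lemma rate_approx: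
  assumes "\<epsilon> > 0"
  shows "\<exists>k\<ge>1. mean (int k *s n) < real k * (rate n + \<epsilon>)"
proof -
  have "(INF k\<in>{1..}. mean (int k *s n) / real k) < rate n + \<epsilon>" using assms by (simp add: rate_def)
  then obtain k where "k \<ge> 1" "mean (int k *s n) / real k < rate n + \<epsilon>"
    by (subst (asm) cINF_less_iff) (auto intro!: bdd_belowI[of _ 0] simp: mean_nonneg)
  then show ?thesis by (intro exI[of _ k]) (auto simp: field_simps)
qed

lemma AE_rate_lower:
  assumes "\<epsilon> > 0"
  shows "AE x in M. \<exists>k0. \<forall>k\<ge>k0. (rate n - \<epsilon>) * real k \<le> \<rho> x 0 (int k *s n)"
\<comment> \<open>\<open>AE_above\<close> takes a nonnegative level; in the other case the claimed
  lower bound is nonpositive and follows from \<open>\<rho>_nonneg\<close>.\<close>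
proof (cases "rate n - \<epsilon> / 2 \<ge> 0")
  case True
  obtain i where i: "1 / (\<epsilon> / 2) < 2 ^ i" using real_arch_pow[of 2] by auto
  then have i': "1 / 2 ^ i \<le> \<epsilon> / 2" using assms by (simp add: field_simps)
  have "AE x in M. x \<in> above (rate n - \<epsilon> / 2) n"
    using True assms by (intro AE_above[where L = "rate n"] rate_le) auto
  then show ?thesis
  proof eventually_elim
    case (elim x)
    then obtain k0 where k0: "\<And>k. k \<ge> k0 \<Longrightarrow> (rate n - \<epsilon> / 2 - 1 / 2 ^ i) * real k \<le> \<rho> x 0 (int k *s n)"
      unfolding above_def by blast
    have "(rate n - \<epsilon>) * real k \<le> \<rho> x 0 (int k *s n)" if "k \<ge> k0" for k
    proof -
      have "(rate n - \<epsilon>) * real k \<le> (rate n - \<epsilon> / 2 - 1 / 2 ^ i) * real k"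
        using i' by (intro mult_right_mono) auto
      with k0[OF that] show ?thesis by linarith
    qed
    then show ?case by blast
  qed
next
  case False
  have "(rate n - \<epsilon>) * real k \<le> \<rho> x 0 (int k *s n)" if "x \<in> space M" for x k
  proof -
    have "(rate n - \<epsilon>) * real k \<le> 0" using False assms by (intro mult_nonpos_nonneg) auto
    then show ?thesis using \<rho>_nonneg[OF that] order_trans by blast
  qed
  then show ?thesis by (intro AE_I2) auto
qed

text \<open>\<open>AE_below\<close> for the vector \<open>int j *s n\<close>, with \<open>j\<close>
  chosen so that \<open>mean (int j *s n) / j\<close> is close to the infimum, settles the multiples
  of \<open>j\<close>. The remainder \<open>r < j\<close> takes only finitely many values, and each
  gap is o(k) by \<open>regular_drift\<close>.\<close>

lemma AE_rate_upper:
  assumes "\<epsilon> > 0"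
  shows "AE x in M. \<exists>k0. \<forall>k\<ge>k0. \<rho> x 0 (int k *s n) \<le> (rate n + \<epsilon>) * real k"
proof -
  \<comment> \<open>One third each for the choice of \<open>j\<close>, the slack in
    \<open>below\<close> and the gap of length \<open>r\<close>.\<close>
  define \<delta> where "\<delta> = \<epsilon> / 3"
  have \<delta>: "\<delta> > 0" using assms by (simp add: \<delta>_def)
  obtain j where j: "j \<ge> 1" "mean (int j *s n) < real j * (rate n + \<delta>)" using rate_approx[OF \<delta>] by blast
  let ?c = "real j * (rate n + \<delta>)"
  obtain i where i: "1 / \<delta> < 2 ^ i" using real_arch_pow[of 2] by auto
  then have i': "1 / 2 ^ i \<le> \<delta>" using \<delta> by (simp add: field_simps)
  have "AE x in M. x \<in> below ?c (int j *s n)" by (rule AE_below[OF j(2)])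
  then show ?thesis
  proof eventually_elim
    case (elim x)
    then have x: "x \<in> regular" "x \<in> space M" unfolding below_def by auto
    obtain q0 where q0: "\<And>q. q \<ge> q0 \<Longrightarrow> \<rho> x 0 (int q *s (int j *s n)) \<le> (?c + 1 / 2 ^ i) * real q"
      using elim unfolding below_def by blast
    have "\<exists>q1. \<forall>r. \<forall>q\<ge>q1 r. \<rho> x (int q *s (int j *s n)) (int q *s (int j *s n) + int r *s n) \<le> \<delta> * real q"
      by (rule choice, rule allI, rule regular_drift[OF x(1) \<delta>])
    then obtain q1 where q1: "\<And>r q. q \<ge> q1 r \<Longrightarrow> \<rho> x (int q *s (int j *s n)) (int q *s (int j *s n) + int r *s n) \<le> \<delta> * real q"
      by blast
    define Q where "Q = q0 + (\<Sum>r<j. q1 r)"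
    have "\<rho> x 0 (int k *s n) \<le> (rate n + \<epsilon>) * real k" if k: "k \<ge> j * Q" for k
    proof -
      define q r where "q = k div j" and "r = k mod j"
      have r: "r < j" using j by (simp add: r_def)
      have k_eq: "k = q * j + r" by (simp add: q_def r_def)
      have "Q \<le> q" using k j unfolding q_def by (metis div_le_mono nonzero_mult_div_cancel_left not_one_le_zero)
      moreover have "q1 r \<le> (\<Sum>r<j. q1 r)" using r by (intro member_le_sum) auto
      ultimately have q: "q \<ge> q0" "q \<ge> q1 r" by (auto simp: Q_def)
      have "int k *s n = int q *s (int j *s n) + int r *s n"
        by (simp add: k_eq vec_eq_iff algebra_simps)
      then have "\<rho> x 0 (int k *s n) \<le> \<rho> x 0 (int q *s (int j *s n)) + \<rho> x (int q *s (int j *s n)) (int q *s (int j *s n) + int r *s n)"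
        using lattice_semimetric.triangle[OF semimetric[OF x(2)]] by simp
      also have "\<dots> \<le> (?c + 1 / 2 ^ i) * real q + \<delta> * real q" by (intro add_mono q0 q1 q)
      also have "\<dots> = (?c + 1 / 2 ^ i + \<delta>) * real q" by (simp add: algebra_simps)
      also have "\<dots> \<le> (?c + \<delta> + \<delta>) * real q" using i' by (intro mult_right_mono) auto
      also have "\<dots> \<le> (?c + real j * \<delta> + real j * \<delta>) * real q"
      proof (rule mult_right_mono)
        have "1 * \<delta> \<le> real j * \<delta>" using \<delta> j by (intro mult_right_mono) auto
        then show "?c + \<delta> + \<delta> \<le> ?c + real j * \<delta> + real j * \<delta>" by linarith
      qed simp
      also have "\<dots> = (rate n + \<epsilon>) * real (q * j)" by (simp add: \<delta>_def algebra_simps)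
      also have "\<dots> \<le> (rate n + \<epsilon>) * real k"
        using assms rate_nonneg[of n] by (intro mult_left_mono) (auto simp: k_eq)
      finally show ?thesis .
    qed
    then show ?case by blast
  qed
qed

lemma AE_rate:
  "AE x in M. \<forall>n i. \<exists>k0. \<forall>k\<ge>k0. \<bar>\<rho> x 0 (int k *s n) - real k * rate n\<bar> \<le> 1 / 2 ^ i * real k"
  unfolding AE_all_countable
proof (intro allI)
  fix n i
  have pos: "(1::real) / 2 ^ i > 0" by simp
  show "AE x in M. \<exists>k0. \<forall>k\<ge>k0. \<bar>\<rho> x 0 (int k *s n) - real k * rate n\<bar> \<le> 1 / 2 ^ i * real k"
    using AE_rate_lower[OF pos, of n] AE_rate_upper[OF pos, of n]
  proof eventually_elim
    case (elim x)
    then obtain k1 k2 where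
      "\<And>k. k \<ge> k1 \<Longrightarrow> (rate n - 1 / 2 ^ i) * real k \<le> \<rho> x 0 (int k *s n)"
      "\<And>k. k \<ge> k2 \<Longrightarrow> \<rho> x 0 (int k *s n) \<le> (rate n + 1 / 2 ^ i) * real k" by blast
    then have "\<bar>\<rho> x 0 (int k *s n) - real k * rate n\<bar> \<le> 1 / 2 ^ i * real k" if "k \<ge> max k1 k2" for k
      using that by (fastforce simp: abs_le_iff algebra_simps)
    then show ?case by blast
  qed
qed

end

section \<open>The limiting seminorm\<close>

lemma vec_of_int_add: "vec_of_int (m + n) = vec_of_int m + vec_of_int n"
  and vec_of_int_diff: "vec_of_int (m - n) = vec_of_int m - vec_of_int n"
  and vec_of_int_uminus: "vec_of_int (- n) = - vec_of_int n"
  and vec_of_int_smult: "vec_of_int (int k *s n) = real k *\<^sub>R vec_of_int n"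
  and vec_of_int_0 [simp]: "vec_of_int 0 = 0"
  by (simp_all add: vec_of_int_def vec_eq_iff)

text \<open>At a lattice point the convolution changes nothing: \<open>m = int k *s n\<close> kills
  the norm term, and conversely subadditivity with \<open>bound\<close> gives
  \<open>g (int k *s n) \<le> g m + C * norm (...)\<close> for every \<open>m\<close>. Off the
  lattice the norm term yields the Lipschitz control that extends homogeneity from natural to real
  factors.\<close>

lemma seminorm_extension:
  fixes g :: "int ^ 'd \<Rightarrow> real"
  assumes nonneg: "\<And>n. g n \<ge> 0" and zero: "g 0 = 0" and add: "\<And>m n. g (m + n) \<le> g m + g n"
    and uminus: "\<And>n. g (- n) = g n" and C: "C \<ge> 0" and bound: "\<And>n. g n \<le> C * norm (vec_of_int n)"
  shows "\<exists>L :: real ^ 'd \<Rightarrow> real. seminorm_on L \<and> (\<forall>v. L v \<le> C * norm v) \<and>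
    (\<forall>n. L (vec_of_int n) = (INF k\<in>{1..}. g (int k *s n) / real k))"
proof -
  \<comment> \<open>Inf-convolution of the homogenised \<open>g\<close> with a large multiple of the norm, so that no limit has to be taken.\<close>
  define \<phi> where "\<phi> = (\<lambda>(v :: real ^ 'd) (k, m). (g m + C * norm (real k *\<^sub>R v - vec_of_int m)) / real k)"
  define L where "L = (\<lambda>v. INF km\<in>{1..} \<times> UNIV. \<phi> v km)"
  have \<phi>_nonneg: "\<phi> v km \<ge> 0" for v km
    using nonneg C by (auto simp: \<phi>_def split: prod.splits)
  have L_le: "L v \<le> \<phi> v (k, m)" if "k \<ge> 1" for v k m
    unfolding L_def using that by (intro cINF_lower bdd_belowI2[of _ 0] \<phi>_nonneg) auto
  have L_ge: "c \<le> L v" if "\<And>k m. k \<ge> 1 \<Longrightarrow> c \<le> \<phi> v (k, m)" for c v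
    unfolding L_def using that by (intro cINF_greatest) auto
  have L_nonneg: "L v \<ge> 0" for v by (intro L_ge \<phi>_nonneg)
  have L_norm: "L v \<le> C * norm v" for v
    using L_le[of 1 v 0] by (simp add: \<phi>_def zero)
  have L_0: "L 0 = 0" using L_norm[of 0] L_nonneg[of 0] by simp
  have g_smult: "g (int k *s n) \<le> real k * g n" for k n
  proof (induction k)
    case 0
    have "int 0 *s n = 0" by (simp add: vec_eq_iff)
    then show ?case using zero by simp
  next
    case (Suc k)
    then show ?case using add[of "int k *s n" n] by (simp add: Suc_smult algebra_simps del: of_nat_Suc) (simp add: algebra_simps)
  qed
  have L_add: "L (v + w) \<le> L v + L w" for v w
  proof -
    have "L (v + w) \<le> \<phi> v (k, m) + \<phi> w (l, n)" if k: "k \<ge> 1" and l: "l \<ge> 1" for k l m n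
    proof -
      let ?u = "int l *s m + int k *s n"
      have "L (v + w) \<le> \<phi> (v + w) (k * l, ?u)" using k l by (intro L_le) simp
      also have "\<dots> \<le> (real l * (g m + C * norm (real k *\<^sub>R v - vec_of_int m)) + real k * (g n + C * norm (real l *\<^sub>R w - vec_of_int n))) / real (k * l)"
        unfolding \<phi>_def prod.case
      proof (rule divide_right_mono)
        have "g ?u \<le> real l * g m + real k * g n"
          using add[of "int l *s m" "int k *s n"] g_smult[of l m] g_smult[of k n] by linarith
        moreover have "real (k * l) *\<^sub>R (v + w) - vec_of_int ?u =
            real l *\<^sub>R (real k *\<^sub>R v - vec_of_int m) + real k *\<^sub>R (real l *\<^sub>R w - vec_of_int n)"
          by (simp add: vec_of_int_add vec_of_int_smult algebra_simps)
        then have "norm (real (k * l) *\<^sub>R (v + w) - vec_of_int ?u) \<le>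
            real l * norm (real k *\<^sub>R v - vec_of_int m) + real k * norm (real l *\<^sub>R w - vec_of_int n)"
          by (metis abs_of_nat norm_scaleR norm_triangle_ineq)
        then have "C * norm (real (k * l) *\<^sub>R (v + w) - vec_of_int ?u) \<le>
            C * (real l * norm (real k *\<^sub>R v - vec_of_int m) + real k * norm (real l *\<^sub>R w - vec_of_int n))"
          using C by (rule mult_left_mono)
        ultimately show "g ?u + C * norm (real (k * l) *\<^sub>R (v + w) - vec_of_int ?u) \<le>
            real l * (g m + C * norm (real k *\<^sub>R v - vec_of_int m)) + real k * (g n + C * norm (real l *\<^sub>R w - vec_of_int n))"
          by (simp only: distrib_left mult.left_commute[of C])
      qed simp
      also have "\<dots> = \<phi> v (k, m) + \<phi> w (l, n)"
        using k l by (simp add: \<phi>_def add_divide_distrib)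
      finally show ?thesis .
    qed
    then have "L (v + w) - \<phi> w (l, n) \<le> L v" if "l \<ge> 1" for l n
      using that by (intro L_ge) (fastforce simp: algebra_simps)
    then have "L (v + w) - L v \<le> L w"
      by (intro L_ge) (fastforce simp: algebra_simps)
    then show ?thesis by simp
  qed
  have L_uminus_le: "L (- v) \<le> L v" for v
  proof (rule L_ge)
    fix k :: nat and m assume "k \<ge> 1"
    then have "L (- v) \<le> \<phi> (- v) (k, - m)" by (rule L_le)
    also have "real k *\<^sub>R (- v) - vec_of_int (- m) = - (real k *\<^sub>R v - vec_of_int m)"
      by (simp add: vec_of_int_uminus)
    then have "\<phi> (- v) (k, - m) = \<phi> v (k, m)"
      unfolding \<phi>_def prod.case by (simp only: uminus norm_minus_cancel)
    finally show "L (- v) \<le> \<phi> v (k, m)" .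
  qed
  have L_uminus: "L (- v) = L v" for v
    using L_uminus_le[of v] L_uminus_le[of "- v"] by simp
  have L_nat: "L (real j *\<^sub>R v) = real j * L v" for j v
  proof (rule antisym)
    show "L (real j *\<^sub>R v) \<le> real j * L v"
    proof (induction j)
      case (Suc j)
      then show ?case using L_add[of "real j *\<^sub>R v" v] by (simp add: algebra_simps)
    qed (simp add: L_0)
    show "real j * L v \<le> L (real j *\<^sub>R v)"
    proof (cases "j = 0")
      case False
      show ?thesis
      proof (rule L_ge)
        fix k :: nat and m assume k: "k \<ge> 1"
        \<comment> \<open>The denominator \<open>k * j\<close> for \<open>v\<close> corresponds
          exactly to the denominator \<open>k\<close> for \<open>j\<close> times
          \<open>v\<close>.\<close>
        have "real j * L v \<le> real j * \<phi> v (k * j, m)"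
          using k False by (intro mult_left_mono L_le) auto
        also have "\<dots> = \<phi> (real j *\<^sub>R v) (k, m)"
          using False by (simp add: \<phi>_def)
        finally show "real j * L v \<le> \<phi> (real j *\<^sub>R v) (k, m)" .
      qed
    qed (simp add: L_0)
  qed
  have L_diff: "\<bar>L v - L w\<bar> \<le> L (v - w)" for v w
    using L_add[of "v - w" w] L_add[of "w - v" v] L_uminus[of "v - w"] by simp
  have L_scale_pos: "L (c *\<^sub>R v) = c * L v" if c: "c \<ge> 0" for c v
  proof -
    have "\<bar>L (c *\<^sub>R v) - c * L v\<bar> \<le> 0"
    proof (rule nonpos_of_bounded_multiples)
      fix k :: nat assume "k \<ge> 1"
      \<comment> \<open>Compare \<open>k * c\<close> with its integer part, for which homogeneity is
        known. The fractional part \<open>f\<close> costs at most \<open>C * norm v + L v\<close>, a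
        bound independent of \<open>k\<close>.\<close>
      define j where "j = nat \<lfloor>real k * c\<rfloor>"
      define f where "f = real k * c - real j"
      have "real j = of_int \<lfloor>real k * c\<rfloor>" using c by (simp add: j_def of_nat_nat)
      then have f: "0 \<le> f" "f \<le> 1" unfolding f_def by linarith+
      have "\<bar>L ((real k * c) *\<^sub>R v) - L (real j *\<^sub>R v)\<bar> \<le> L (f *\<^sub>R v)"
        using L_diff[of "(real k * c) *\<^sub>R v" "real j *\<^sub>R v"] by (simp add: f_def scaleR_diff_left)
      also have "\<dots> \<le> C * norm (f *\<^sub>R v)" by (rule L_norm)
      also have "\<dots> = f * (C * norm v)" using f by simp
      also have "\<dots> \<le> 1 * (C * norm v)" using f C by (intro mult_right_mono) auto
      finally have "\<bar>L (real k *\<^sub>R (c *\<^sub>R v)) - real j * L v\<bar> \<le> C * norm v" by (simp add: L_nat)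
      then have 1: "\<bar>real k * L (c *\<^sub>R v) - real j * L v\<bar> \<le> C * norm v" by (simp only: L_nat)
      have "f * L v \<le> 1 * L v" using f L_nonneg by (intro mult_right_mono) auto
      moreover have "0 \<le> f * L v" using f L_nonneg by auto
      moreover have "real k * c * L v = real j * L v + f * L v" by (simp add: f_def algebra_simps)
      ultimately have "\<bar>real k * L (c *\<^sub>R v) - real k * c * L v\<bar> \<le> C * norm v + L v"
        using 1 by linarith
      moreover have "real k * \<bar>L (c *\<^sub>R v) - c * L v\<bar> = \<bar>real k * L (c *\<^sub>R v) - real k * c * L v\<bar>"
      proof -
        have "real k * L (c *\<^sub>R v) - real k * c * L v = real k * (L (c *\<^sub>R v) - c * L v)"
          by (simp add: algebra_simps)
        then show ?thesis by (simp only: abs_mult abs_of_nat)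
      qed
      ultimately show "real k * \<bar>L (c *\<^sub>R v) - c * L v\<bar> \<le> C * norm v + L v" by simp
    qed
    then show ?thesis by simp
  qed
  have "L (c *\<^sub>R v) = \<bar>c\<bar> * L v" for c v
    using L_scale_pos[of "\<bar>c\<bar>" v] L_uminus[of "c *\<^sub>R v"] by (cases "c \<ge> 0") auto
  then have "seminorm_on L" using L_add unfolding seminorm_on_def by blast
  moreover have "L (vec_of_int n) = (INF k\<in>{1..}. g (int k *s n) / real k)" for n
  proof (rule antisym)
    show "L (vec_of_int n) \<le> (INF k\<in>{1..}. g (int k *s n) / real k)"
    proof (rule cINF_greatest)
      fix k :: nat assume "k \<in> {1..}"
      then show "L (vec_of_int n) \<le> g (int k *s n) / real k"
        using L_le[of k "vec_of_int n" "int k *s n"] by (simp add: \<phi>_def vec_of_int_smult)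
    qed simp
    show "(INF k\<in>{1..}. g (int k *s n) / real k) \<le> L (vec_of_int n)"
    proof (rule L_ge)
      fix k :: nat and m assume k: "k \<ge> 1"
      have "(INF k\<in>{1..}. g (int k *s n) / real k) \<le> g (int k *s n) / real k"
        using k nonneg by (intro cINF_lower bdd_belowI2[of _ 0]) auto
      also have "\<dots> \<le> (g m + C * norm (real k *\<^sub>R vec_of_int n - vec_of_int m)) / real k"
        using add[of m "int k *s n - m"] bound[of "int k *s n - m"]
        by (intro divide_right_mono) (auto simp: vec_of_int_diff vec_of_int_smult)
      finally show "(INF k\<in>{1..}. g (int k *s n) / real k) \<le> \<phi> (vec_of_int n) (k, m)"
        by (simp add: \<phi>_def)
    qed
  qed
  ultimately show ?thesis using L_norm by blast
qed

lemma norm_vec_of_int_le: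
  fixes n :: "int ^ 'd"
  assumes "\<And>l. \<bar>n $ l\<bar> \<le> int k"
  shows "norm (vec_of_int n) \<le> real CARD('d) * real k"
proof -
  have "norm (vec_of_int n) \<le> (\<Sum>l\<in>UNIV. \<bar>vec_of_int n $ l\<bar>)" by (rule norm_le_l1_cart)
  also have "\<dots> \<le> (\<Sum>l\<in>(UNIV :: 'd set). real k)"
  proof (rule sum_mono)
    fix l
    have "real_of_int \<bar>n $ l\<bar> \<le> real_of_int (int k)" using assms by (simp only: of_int_le_iff)
    then show "\<bar>vec_of_int n $ l\<bar> \<le> real k" by (simp add: vec_of_int_def)
  qed
  finally show ?thesis by simp
qed

section \<open>From directions to all lattice points\<close>

context ergodic_semimetric begin

lemma mean_linear_bound: "\<exists>C\<ge>0. \<forall>n. mean n \<le> C * norm (vec_of_int n)"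
proof -
  define K where "K = (\<Sum>i\<in>UNIV. mean (axis i 1))"
  have K: "K \<ge> 0" unfolding K_def by (intro sum_nonneg mean_nonneg)
  have "mean n \<le> (real CARD('d) * K) * norm (vec_of_int n)" for n
  proof -
    have "mean n \<le> (\<Sum>i\<in>UNIV. \<bar>real_of_int (n $ i)\<bar>) * K"
    proof (rule l1_path_bound)
      fix z i
      have "mean (axis i 1) \<le> K"
        unfolding K_def by (rule member_le_sum) (auto simp: mean_nonneg)
      then show "\<bar>mean (z + axis i 1) - mean z\<bar> \<le> K"
        using mean_add[of z "axis i 1"] mean_add[of "z + axis i 1" "- axis i 1"] mean_uminus[of "axis i 1"] by simp
    qed (simp add: mean_0)
    also have "\<dots> \<le> (\<Sum>i\<in>(UNIV :: 'd set). norm (vec_of_int n)) * K"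
    proof (intro mult_right_mono sum_mono K)
      fix i
      show "\<bar>real_of_int (n $ i)\<bar> \<le> norm (vec_of_int n)"
        using component_le_norm_cart[of "vec_of_int n" i] by (simp add: vec_of_int_def)
    qed
    finally show ?thesis by (simp add: mult_ac)
  qed
  then show ?thesis using K by (intro exI[of _ "real CARD('d) * K"]) auto
qed

text \<open>Round \<open>n\<close> coordinatewise down to a multiple \<open>int k *s m\<close> with
  mesh \<open>k = R div D\<close>. The rounding error is small by equicontinuity for
  \<open>\<rho> x\<close> and by the norm bound for \<open>L\<close>, and \<open>m\<close> ranges
  over a finite set that does not depend on \<open>R\<close>, so pointwise convergence along rays
  becomes uniform.\<close>

lemma shape_estimate:
  assumes L: "seminorm_on L" and C: "C \<ge> 0" "\<And>v. L v \<le> C * norm v" and rate: "\<And>n. L (vec_of_int n) = rate n"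
    and x: "x \<in> regular"
    and dir: "\<And>n i. \<exists>k0. \<forall>k\<ge>k0. \<bar>\<rho> x 0 (int k *s n) - real k * rate n\<bar> \<le> 1 / 2 ^ i * real k"
    and \<epsilon>: "\<epsilon> > 0"
  shows "\<exists>R1. \<forall>R\<ge>R1. \<forall>n\<in>cube R. \<bar>\<rho> x 0 n - L (vec_of_int n)\<bar> \<le> \<epsilon> * real R"
proof -
  interpret lattice_semimetric "\<rho> x" using x by (intro semimetric regular_space)
  let ?A = "C * real CARD('d)"
  \<comment> \<open>In units of \<open>R / 2 ^ i\<close> the errors are 2 from equicontinuity, used
    at radius \<open>2 * R\<close>, then 1 from the ray and \<open>?A\<close> from
    \<open>L\<close>.\<close>
  obtain i where i: "(3 + ?A) / \<epsilon> < 2 ^ i" using real_arch_pow[of 2] by auto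
  obtain j R0 where jR: "\<And>R p q. \<lbrakk>R \<ge> R0; p \<in> cube R; q \<in> cube R; \<forall>l. 2 ^ j * \<bar>(q - p) $ l\<bar> \<le> int R\<rbrakk> \<Longrightarrow> 2 ^ i * \<rho> x p q \<le> real R"
    using x unfolding regular_def equicontinuous_at_infinity_def by blast
  have "\<exists>k0. \<forall>m. \<forall>k\<ge>k0 m. \<bar>\<rho> x 0 (int k *s m) - real k * rate m\<bar> \<le> 1 / 2 ^ i * real k"
    by (rule choice, rule allI, rule dir)
  then obtain k0 where k0: "\<And>m k. k \<ge> k0 m \<Longrightarrow> \<bar>\<rho> x 0 (int k *s m) - real k * rate m\<bar> \<le> 1 / 2 ^ i * real k"
    by blast
  \<comment> \<open>The factor \<open>2 ^ j\<close> makes the mesh fine enough for equicontinuity,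
    the factor \<open>2 ^ i\<close> makes \<open>k\<close> at most \<open>R / 2 ^ i\<close>.\<close>
  define D :: nat where "D = 2 ^ (i + j)"
  have D: "D \<ge> 1" "2 ^ i \<le> D" "2 ^ j \<le> D" unfolding D_def by (auto simp: power_add)
  \<comment> \<open>A sum over the finite set of directions dominates each single threshold.\<close>
  define K0 where "K0 = (\<Sum>m\<in>(cube (2 * D) :: (int ^ 'd) set). k0 m)"
  have "\<bar>\<rho> x 0 n - L (vec_of_int n)\<bar> \<le> \<epsilon> * real R"
    if R: "R \<ge> R0 + D * (K0 + 1)" and n: "n \<in> cube R" for R and n :: "int ^ 'd"
  proof -
    define k where "k = R div D"
    have "K0 + 1 = (D * (K0 + 1)) div D" using D(1) by (intro nonzero_mult_div_cancel_left[symmetric]) auto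
    also have "\<dots> \<le> k" unfolding k_def using R by (intro div_le_mono) auto
    finally have k: "k \<ge> K0 + 1" .
    have Dk: "D * k \<le> R" unfolding k_def by simp
    have "R < D * k + D" unfolding k_def using D(1) dividend_less_div_times[of D R] by (simp add: mult.commute add.commute)
    also have "\<dots> \<le> D * k + D * k" using k by simp
    finally have R2: "R \<le> 2 * D * k" by simp
    have kR: "k \<le> R" using Dk D(1) by (metis le_trans mult_1 mult_le_mono1)
    define m where "m = (\<chi> l. n $ l div int k)"
    have k_pos: "int k > 0" using k by simp
    have rem: "n $ l - int k * m $ l = n $ l mod int k" for l
      by (simp add: m_def minus_mult_div_eq_mod)
    then have rem_bound: "0 \<le> n $ l - int k * m $ l" "n $ l - int k * m $ l < int k" for l
      using k_pos by auto
    have n_bound: "\<bar>n $ l\<bar> \<le> int R" for l using n by (auto simp: cube_def)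
    have "m \<in> cube (2 * D)"
      unfolding cube_def
    proof clarify
      fix l
      have nl: "\<bar>n $ l\<bar> \<le> int (2 * D) * int k"
        using n_bound[of l] R2 by (metis of_nat_le_iff of_nat_mult order_trans)
      have "n $ l div int k \<le> int (2 * D) * int k div int k" using nl k_pos by (intro zdiv_mono1) auto
      moreover have "- int (2 * D) * int k div int k \<le> n $ l div int k" using nl k_pos by (intro zdiv_mono1) auto
      moreover have "int (2 * D) * int k div int k = int (2 * D)" "- int (2 * D) * int k div int k = - int (2 * D)"
        using k_pos by (intro nonzero_mult_div_cancel_right; simp)+
      ultimately show "\<bar>m $ l\<bar> \<le> int (2 * D)" unfolding m_def vec_lambda_beta by linarith
    qed
    then have "k0 m \<le> K0" unfolding K0_def by (intro member_le_sum) auto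
    then have 1: "\<bar>\<rho> x 0 (int k *s m) - real k * rate m\<bar> \<le> 1 / 2 ^ i * real k"
      using k by (intro k0) simp
    have "2 ^ i * \<rho> x (int k *s m) n \<le> real (2 * R)"
    proof (rule jR)
      show "R0 \<le> 2 * R" using R by simp
      show "n \<in> cube (2 * R)" using n cube_mono[of R "2 * R"] by auto
      show "int k *s m \<in> cube (2 * R)"
        unfolding cube_def
      proof clarify
        fix l
        show "\<bar>(int k *s m) $ l\<bar> \<le> int (2 * R)"
          using rem_bound[of l] n_bound[of l] kR by simp
      qed
      show "\<forall>l. 2 ^ j * \<bar>(n - int k *s m) $ l\<bar> \<le> int (2 * R)"
      proof
        fix l
        have "int (2 ^ j) \<le> int D" using D(3) by (simp only: of_nat_le_iff)
        moreover have "\<bar>(n - int k *s m) $ l\<bar> \<le> int k" using rem_bound[of l] by simp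
        ultimately have "int (2 ^ j) * \<bar>(n - int k *s m) $ l\<bar> \<le> int D * int k"
          by (intro mult_mono) auto
        then have "2 ^ j * \<bar>(n - int k *s m) $ l\<bar> \<le> int D * int k" by simp
        also have "\<dots> \<le> int (2 * R)" using Dk by (simp flip: of_nat_mult)
        finally show "2 ^ j * \<bar>(n - int k *s m) $ l\<bar> \<le> int (2 * R)" .
      qed
    qed
    then have 2: "\<rho> x (int k *s m) n \<le> 2 * real R / 2 ^ i" by (simp add: field_simps)
    have L_add: "L (u + v) \<le> L u + L v" and L_scale: "L (c *\<^sub>R v) = \<bar>c\<bar> * L v" for u v c
      using L unfolding seminorm_on_def by blast+
    have 3: "\<bar>L (vec_of_int n) - real k * rate m\<bar> \<le> ?A * real k"
    proof -
      let ?w = "vec_of_int (n - int k *s m)"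
      have "norm ?w \<le> real CARD('d) * real k"
        using rem_bound by (intro norm_vec_of_int_le) (auto simp: less_imp_le)
      then have "C * norm ?w \<le> C * (real CARD('d) * real k)" using C(1) by (rule mult_left_mono)
      then have w: "L ?w \<le> ?A * real k" using C(2)[of ?w] by simp
      have "L (- ?w) = L ?w" using L_scale[of "-1" ?w] by simp
      moreover have "vec_of_int n = real k *\<^sub>R vec_of_int m + ?w" "real k *\<^sub>R vec_of_int m = vec_of_int n + - ?w"
        by (simp_all add: vec_of_int_diff vec_of_int_smult)
      ultimately have "\<bar>L (vec_of_int n) - L (real k *\<^sub>R vec_of_int m)\<bar> \<le> L ?w"
        using L_add[of "real k *\<^sub>R vec_of_int m" ?w] L_add[of "vec_of_int n" "- ?w"] by (simp add: abs_le_iff)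
      then show ?thesis using w by (simp add: L_scale rate)
    qed
    have "\<bar>\<rho> x 0 n - L (vec_of_int n)\<bar> \<le> \<rho> x (int k *s m) n + 1 / 2 ^ i * real k + ?A * real k"
      using 1 3 triangle_diff[of 0 n "int k *s m"] by linarith
    also have "\<dots> \<le> 2 * real R / 2 ^ i + 1 / 2 ^ i * real R + ?A * (real R / 2 ^ i)"
    proof (intro add_mono 2 mult_left_mono)
      show "real k \<le> real R" using kR by simp
      have "2 ^ i * k \<le> R" using D(2) Dk by (metis le_trans mult_le_mono1)
      then have "real (2 ^ i * k) \<le> real R" by (simp only: of_nat_le_iff)
      then show "real k \<le> real R / 2 ^ i" by (simp add: field_simps)
    qed (use C in auto)
    also have "\<dots> = (3 + ?A) / 2 ^ i * real R" by (simp add: add_divide_distrib algebra_simps)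
    also have "\<dots> \<le> \<epsilon> * real R"
      using i \<epsilon> by (intro mult_right_mono) (auto simp: field_simps)
    finally show ?thesis .
  qed
  then show ?thesis by blast
qed

theorem shape:
  "\<exists>L :: real ^ 'd \<Rightarrow> real. seminorm_on L \<and>
     (AE x in M. ((\<lambda>n. (\<rho> x 0 n - L (vec_of_int n)) / norm (vec_of_int n)) \<longlongrightarrow> 0)
                   (filtercomap (\<lambda>n. norm (vec_of_int n)) at_top))"
proof -
  obtain C where C: "C \<ge> 0" "\<And>n. mean n \<le> C * norm (vec_of_int n)" using mean_linear_bound by blast
  obtain L :: "real ^ 'd \<Rightarrow> real" where L: "seminorm_on L" "\<And>v. L v \<le> C * norm v" "\<And>n. L (vec_of_int n) = rate n"
    using seminorm_extension[of mean C, OF mean_nonneg mean_0 mean_add mean_uminus C] unfolding rate_def by blast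
  have "AE x in M. ((\<lambda>n. (\<rho> x 0 n - L (vec_of_int n)) / norm (vec_of_int n)) \<longlongrightarrow> 0)
                   (filtercomap (\<lambda>n. norm (vec_of_int n)) at_top)"
    using AE_regular AE_rate
  proof eventually_elim
    case (elim x)
    show ?case
    proof (rule tendstoI)
      fix e :: real assume e: "e > 0"
      then have e2: "e / 2 > 0" by simp
      obtain R1 where R1: "\<And>R n. R \<ge> R1 \<Longrightarrow> n \<in> cube R \<Longrightarrow> \<bar>\<rho> x 0 n - L (vec_of_int n)\<bar> \<le> e / 2 * real R"
        using shape_estimate[OF L(1) C(1) L(2,3) elim(1) _ e2] elim(2) by blast
      have "dist ((\<rho> x 0 n - L (vec_of_int n)) / norm (vec_of_int n)) 0 < e"
        if n: "norm (vec_of_int n) \<ge> real CARD('d) * real R1 + 1" for n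
      proof -
        \<comment> \<open>The sup norm of \<open>n\<close>. The Euclidean norm is at most d times
          \<open>R\<close>, so the threshold forces \<open>R1 \<le> R\<close>; it is also at least
          \<open>R\<close>, which makes the cube estimate relative to the norm. The added 1 in the
          threshold keeps the denominator positive.\<close>
        define R where "R = nat (Max (range (\<lambda>l. \<bar>n $ l\<bar>)))"
        have le: "\<bar>n $ l\<bar> \<le> int R" for l
        proof -
          have "\<bar>n $ l\<bar> \<le> Max (range (\<lambda>l. \<bar>n $ l\<bar>))" by (rule Max_ge) auto
          then show ?thesis unfolding R_def by linarith
        qed
        have "Max (range (\<lambda>l. \<bar>n $ l\<bar>)) \<in> range (\<lambda>l. \<bar>n $ l\<bar>)" by (intro Max_in) auto
        then obtain l where "Max (range (\<lambda>l. \<bar>n $ l\<bar>)) = \<bar>n $ l\<bar>" by blast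
        then have l: "int R = \<bar>n $ l\<bar>" unfolding R_def by simp
        have "real CARD('d) * real R1 + 1 \<le> real CARD('d) * real R"
          using n norm_vec_of_int_le[OF le] by linarith
        then have "real CARD('d) * real R1 \<le> real CARD('d) * real R" by linarith
        then have "R1 \<le> R" by simp
        then have "\<bar>\<rho> x 0 n - L (vec_of_int n)\<bar> \<le> e / 2 * real R"
          using le by (intro R1) (auto simp: cube_def)
        also have "real R \<le> norm (vec_of_int n)"
        proof -
          have "real R = \<bar>vec_of_int n $ l\<bar>"
            using l by (simp add: vec_of_int_def)
          then show ?thesis using component_le_norm_cart[of "vec_of_int n" l] by simp
        qed
        finally have "\<bar>\<rho> x 0 n - L (vec_of_int n)\<bar> \<le> e / 2 * norm (vec_of_int n)" using e by simp
        moreover have pos: "norm (vec_of_int n) > 0" using n by (smt (verit) mult_nonneg_nonneg of_nat_0_le_iff)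
        moreover have "e / 2 * norm (vec_of_int n) < e * norm (vec_of_int n)" using pos e by simp
        ultimately have "\<bar>\<rho> x 0 n - L (vec_of_int n)\<bar> < e * norm (vec_of_int n)" by linarith
        then show ?thesis using pos by (simp add: dist_real_def abs_divide field_simps)
      qed
      then show "\<forall>\<^sub>F n in filtercomap (\<lambda>n. norm (vec_of_int n)) at_top.
          dist ((\<rho> x 0 n - L (vec_of_int n)) / norm (vec_of_int n)) 0 < e"
        unfolding eventually_filtercomap_at_top_linorder by blast
    qed
  qed
  with L(1) show ?thesis by blast
qed

end

theorem theorem2:
  fixes M :: "'a measure" and T :: "int ^ 'd \<Rightarrow> 'a \<Rightarrow> 'a"
    and \<rho> :: "'a \<Rightarrow> int ^ 'd \<Rightarrow> int ^ 'd \<Rightarrow> real"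
  assumes "ergodic_Zd_action M T"
    and "random_semimetric M T \<rho>"
    and "\<forall>n. (\<lambda>x. \<rho> x 0 n) \<in> lorentz_space (real CARD('d)) 1 M"
  shows "\<exists>L :: real ^ 'd \<Rightarrow> real. seminorm_on L \<and>
           (AE x in M. ((\<lambda>n. (\<rho> x 0 n - L (vec_of_int n)) / norm (vec_of_int n)) \<longlongrightarrow> 0)
                         (filtercomap (\<lambda>n. norm (vec_of_int n)) at_top))"
proof -
  interpret prob_space M using assms(1) by (simp add: ergodic_Zd_action_def)
  interpret ergodic_semimetric M T \<rho>
  proof
    show "T k \<in> M \<rightarrow>\<^sub>M M" "distr M M (T k) = M" for k
      using assms(1) by (simp_all add: ergodic_Zd_action_def)
    show "T 0 x = x" "T (k + l) x = T k (T l x)" if "x \<in> space M" for x k l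
      using assms(1) that by (simp_all add: ergodic_Zd_action_def)
    show "\<rho> x m n \<ge> 0" "\<rho> x m m = 0" "\<rho> x m n = \<rho> x n m" "\<rho> x m l \<le> \<rho> x m n + \<rho> x n l"
      if "x \<in> space M" for x m n l
      using assms(2) that unfolding random_semimetric_def by blast+
    show "(\<lambda>x. \<rho> x m n) \<in> borel_measurable M" for m n
      using assms(2) by (simp add: random_semimetric_def)
    show "\<rho> (T k x) m n = \<rho> x (m + k) (n + k)" if "x \<in> space M" for x k m n
      using assms(2) that by (simp add: random_semimetric_def)
    show "(\<lambda>x. \<rho> x 0 n) \<in> lorentz_space (real CARD('d)) 1 M" for n
      using assms(3) by blast
    show "measure M A = 0 \<or> measure M A = 1" if "A \<in> sets M" "\<And>k. T k -` A \<inter> space M = A" for A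
      using assms(1) that by (simp add: ergodic_Zd_action_def)
  qed
  show ?thesis by (rule shape)
qed

end
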